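(* Let $\mathbb{K}$ be an algebraically closed field and let $m,n$ be positive integers. Then the set $\mathcal{T}=\{(I(\mathsf{MSV}_w),J_w): w\in\mathsf{Mat}_{m\times n}\}$ is a finite transition system in $\mathbb{K}[\mathsf{Mat}_{m\times n}]$, with respect to the reverse lexicographic term order.
   Context: $[k]=\{1,\dots,k\}$. $\mathsf{Mat}_{m\times n}$ is the affine variety of $m\times n$ matrices over $\mathbb{K}$, and $M_{[i][j]}$ is the upper left $i\times j$ submatrix of $M$. For $w\in\mathsf{Mat}_{m\times n}$, the matrix Schubert variety is $$\mathsf{MSV}_w=\{M\in\mathsf{Mat}_{m\times n}:\operatorname{rank}M_{[i][j]}\le\operatorname{rank}w_{[i][j]}\text{ for all }(i,j)\in[m]\times[n]\}.$$ The coordinate ring is $\mathbb{K}[\mathsf{Mat}_{m\times n}]=\mathbb{K}[x_{ij}:1\le i\le m,1\le j\le n]$ with $x_{ij}(M)=M_{ij}$. For a subset $V$ of an affine space, $I(V)$ is the ideal of all polynomials vanishing on $V$. Let $\mathcal{X}=[x_{ij}]$ be the $m\times n$ matrix of variables, let $\mathcal{X}_{RC}$ be its submatrix in rows $R$ and columns $C$, and for a $k\times k$ matrix $M$ let $\operatorname{adiag}(M)=M_{1,k}M_{2,k-1}\cdots M_{k,1}$. Define the monomial ideal $$J_w=\langle\operatorname{adiag}(\mathcal{X}_{RC}): i\in[m],\ j\in[n],\ R\subseteq[i],\ C\subseteq[j],\ |R|=|C|=1+\operatorname{rank}w_{[i][j]}\rangle.$$ Reverse lexicographic term order: monomials of smaller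 degree are smaller; for distinct monomials $\mathsf{m}_1=\prod x_{ij}^{a_{ij}}$ and $\mathsf{m}_2=\prod x_{ij}^{b_{ij}}$ of the same degree, $\mathsf{m}_1<\mathsf{m}_2$ if and only if $a_{ij}>b_{ij}$ for the lexicographically largest index $(i,j)$ with $a_{ij}\ne b_{ij}$. For a polynomial $f\ne0$, $\operatorname{init}(f)$ is the maximal monomial occurring in $f$ with nonzero coefficient, and $\operatorname{init}(0)=0$; for an ideal $I$, $\operatorname{init}(I)$ is the $\mathbb{K}$-span of $\{\operatorname{init}(f):f\in I\}$. For an ideal $I$ and a polynomial $f\neq0$, $(I:\langle f\rangle)=\{g: fg\in I\}$. Definition (transition system) in a polynomial ring $S$ over $\mathbb{K}$ with a fixed term order. Let $\mathcal{T}$ be a set of pairs $(I,J)$ of proper ideals of $S$ such that: (T1) for each $(I,J)\in\mathcal{T}$, $J$ is a monomial ideal contained in $\operatorname{init}(I)$, with $J=\operatorname{init}(I)$ if $I$ is maximal; (T2) if $(I,J),(I',J')\in\mathcal{T}$ have $I=I'$ then $J=J'$. The set $\mathcal{T}$ is a transition system if for each $(I,J)\in\mathcal{T}$ where $I$ is neither maximal nor equal to $J$, there exist a non-constant $f\in S$ with $f\notin I$ and a nonempty finite set $\Phi\subseteq\mathcal{T}$ such that: (T3) $I+\langle f\rangle\subseteq\bigcap_{(P,Q)\in\Phi}P$ and $J+\langle\operatorname{init}(f)\rangle=\bigcap_{(P,Q)\in\Phi}Q$; (T4) if $I':=(I:\langle f\rangle)$ is not equal to $I$ and $J':=(J:\langle\operatorname{init}(f)\rangle)$,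 then $(I',J')\in\mathcal{T}$. *)

theory Defs
  imports
    "HOL-Library.Poly_Mapping"
    "HOL-Computational_Algebra.Polynomial"
    "HOL-Algebra.Ideal"
    "Jordan_Normal_Form.DL_Rank_Submatrix"
begin

section \<open>Multivariate polynomials\<close>

text \<open>
  A monomial is a finitely supported exponent vector, a polynomial is a finitely supported
  map from monomials to coefficients. The type itself has all of \<open>'v\<close> as variables;
  the polynomial ring in a set \<open>V\<close> of variables is the carrier of \<open>mpoly_ring V\<close>.
\<close>

type_synonym 'v monom = "'v \<Rightarrow>\<^sub>0 nat"
type_synonym ('v, 'k) mpoly = "'v monom \<Rightarrow>\<^sub>0 'k"

definition mpoly_ring :: "'v set \<Rightarrow> ('v, 'k::field) mpoly ring" where
  "mpoly_ring V =
    \<lparr>carrier = {p. \<forall>t \<in> Poly_Mapping.keys p. Poly_Mapping.keys t \<subseteq> V},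
     monoid.mult = (*), one = 1, zero = 0, add = (+)\<rparr>"

definition monomial :: "'v monom \<Rightarrow> ('v, 'k::field) mpoly" where
  "monomial t = Poly_Mapping.single t 1"

definition const :: "'k::field \<Rightarrow> ('v, 'k) mpoly" where
  "const c = Poly_Mapping.single 0 c"

definition var :: "'v \<Rightarrow> ('v, 'k::field) mpoly" where
  "var v = monomial (Poly_Mapping.single v 1)"

definition eval :: "('v \<Rightarrow> 'k) \<Rightarrow> ('v, 'k::field) mpoly \<Rightarrow> 'k" where
  "eval a p = (\<Sum>t \<in> Poly_Mapping.keys p.
     Poly_Mapping.lookup p t * (\<Prod>v \<in> Poly_Mapping.keys t. a v ^ Poly_Mapping.lookup t v))"

definition kspan :: "('v, 'k::field) mpoly set \<Rightarrow> ('v, 'k) mpoly set" where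
  "kspan = Modules.module.span (\<lambda>c p. const c * p)"

definition monomial_ideal :: "'v set \<Rightarrow> ('v, 'k::field) mpoly set \<Rightarrow> bool" where
  "monomial_ideal V J \<longleftrightarrow>
    (\<exists>A. (\<forall>t \<in> A. Poly_Mapping.keys t \<subseteq> V) \<and> J = genideal (mpoly_ring V) (monomial ` A))"

definition colon :: "'v set \<Rightarrow> ('v, 'k::field) mpoly set \<Rightarrow> ('v, 'k) mpoly \<Rightarrow> ('v, 'k) mpoly set" where
  "colon V I f = {g \<in> carrier (mpoly_ring V). f * g \<in> I}"


section \<open>Initial terms\<close>

text \<open>
  Here \<open>prec\<close> is the strict version of the term order. The initial term of a nonzero
  polynomial is taken without its coefficient.
\<close>

definition init :: "('v monom \<Rightarrow> 'v monom \<Rightarrow> bool) \<Rightarrow> ('v, 'k::field) mpoly \<Rightarrow> ('v, 'k) mpoly" where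
  "init prec f = (if f = 0 then 0
     else monomial (THE t. t \<in> Poly_Mapping.keys f \<and>
       (\<forall>s \<in> Poly_Mapping.keys f. s \<noteq> t \<longrightarrow> prec s t)))"

definition init_ideal ::
    "('v monom \<Rightarrow> 'v monom \<Rightarrow> bool) \<Rightarrow> ('v, 'k::field) mpoly set \<Rightarrow> ('v, 'k) mpoly set" where
  "init_ideal prec I = kspan (init prec ` I)"

definition mdeg :: "'v monom \<Rightarrow> nat" where
  "mdeg t = (\<Sum>v \<in> Poly_Mapping.keys t. Poly_Mapping.lookup t v)"

definition lex_less :: "nat \<times> nat \<Rightarrow> nat \<times> nat \<Rightarrow> bool" where
  "lex_less p q \<longleftrightarrow> fst p < fst q \<or> (fst p = fst q \<and> snd p < snd q)"

text \<open>In the equal-degree case, \<open>p\<close> is the lexicographically largest index where \<open>a\<close> and \<open>b\<close> differ.\<close>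

definition revlex :: "(nat \<times> nat) monom \<Rightarrow> (nat \<times> nat) monom \<Rightarrow> bool" where
  "revlex a b \<longleftrightarrow> mdeg a < mdeg b \<or>
    (mdeg a = mdeg b \<and>
      (\<exists>p. Poly_Mapping.lookup a p > Poly_Mapping.lookup b p \<and>
        (\<forall>q. lex_less p q \<longrightarrow>
          Poly_Mapping.lookup a q = Poly_Mapping.lookup b q)))"


section \<open>Transition systems\<close>

definition transition_system ::
    "'v set \<Rightarrow> ('v monom \<Rightarrow> 'v monom \<Rightarrow> bool) \<Rightarrow>
     (('v, 'k::field) mpoly set \<times> ('v, 'k) mpoly set) set \<Rightarrow> bool" where
  "transition_system V prec T \<longleftrightarrow>
    (let S = mpoly_ring V in
      (\<forall>(I, J) \<in> T. ideal I S \<and> I \<noteq> carrier S \<and> ideal J S \<and> J \<noteq> carrier S) \<and>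
      (\<forall>(I, J) \<in> T. monomial_ideal V J \<and> J \<subseteq> init_ideal prec I \<and>
         (maximalideal I S \<longrightarrow> J = init_ideal prec I)) \<and>
      (\<forall>(I, J) \<in> T. \<forall>(I', J') \<in> T. I = I' \<longrightarrow> J = J') \<and>
      (\<forall>(I, J) \<in> T. \<not> maximalideal I S \<and> I \<noteq> J \<longrightarrow>
         (\<exists>f \<Phi>. f \<in> carrier S \<and> f \<notin> range const \<and> f \<notin> I \<and>
            finite \<Phi> \<and> \<Phi> \<noteq> {} \<and> \<Phi> \<subseteq> T \<and>
            I <+>\<^bsub>S\<^esub> genideal S {f} \<subseteq> (\<Inter>(P, Q) \<in> \<Phi>. P) \<and>
            J <+>\<^bsub>S\<^esub> genideal S {init prec f} = (\<Inter>(P, Q) \<in> \<Phi>. Q) \<and>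
            (colon V I f \<noteq> I \<longrightarrow> (colon V I f, colon V J (init prec f)) \<in> T))))"


section \<open>Matrix Schubert varieties\<close>

text \<open>
  Rows and columns of matrices are numbered from \<open>0\<close>, so the coordinate ring of
  \<open>m \<times> n\<close> matrices has variable set \<open>{0..<m} \<times> {0..<n}\<close>, while \<open>i\<close>, \<open>j\<close> below count
  the rows and columns of an upper left submatrix and range over \<open>{1..m}\<close>, \<open>{1..n}\<close>.
\<close>

definition mat_vars :: "nat \<Rightarrow> nat \<Rightarrow> (nat \<times> nat) set" where
  "mat_vars m n = {0..<m} \<times> {0..<n}"

text \<open>The first argument of \<open>vec_space.rank\<close> is the number of rows.\<close>

definition corner_rank :: "'k::field mat \<Rightarrow> nat \<Rightarrow> nat \<Rightarrow> nat" where
  "corner_rank M i j = vec_space.rank i (submatrix M {0..<i} {0..<j})"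

definition MSV :: "nat \<Rightarrow> nat \<Rightarrow> 'k::field mat \<Rightarrow> 'k mat set" where
  "MSV m n w = {M \<in> carrier_mat m n.
     \<forall>i \<in> {1..m}. \<forall>j \<in> {1..n}. corner_rank M i j \<le> corner_rank w i j}"

definition vanishing_ideal ::
    "nat \<Rightarrow> nat \<Rightarrow> 'k::field mat set \<Rightarrow> (nat \<times> nat, 'k) mpoly set" where
  "vanishing_ideal m n A =
    {f \<in> carrier (mpoly_ring (mat_vars m n)). \<forall>M \<in> A. eval (\<lambda>p. M $$ p) f = 0}"

definition generic_mat :: "nat \<Rightarrow> nat \<Rightarrow> (nat \<times> nat, 'k::field) mpoly mat" where
  "generic_mat m n = mat m n var"

definition adiag :: "'a::comm_ring_1 mat \<Rightarrow> 'a" where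
  "adiag M = (\<Prod>a < dim_row M. M $$ (a, dim_row M - 1 - a))"

definition J_ideal :: "nat \<Rightarrow> nat \<Rightarrow> 'k::field mat \<Rightarrow> (nat \<times> nat, 'k) mpoly set" where
  "J_ideal m n w = genideal (mpoly_ring (mat_vars m n))
     {adiag (submatrix (generic_mat m n) R C) | R C i j.
        i \<in> {1..m} \<and> j \<in> {1..n} \<and> R \<subseteq> {0..<i} \<and> C \<subseteq> {0..<j} \<and>
        card R = 1 + corner_rank w i j \<and> card C = 1 + corner_rank w i j}"

end

theory Submission
  imports Defs
begin

text \<open>
  Write \<open>r w a b\<close> for the rank of the upper left \<open>a \<times> b\<close> corner of \<open>w\<close>. An antidiagonal is a
  sequence of positions whose rows increase and whose columns decrease. A monomial with support
  \<open>S\<close> lies outside the ideal \<open>J\<close> of \<open>w\<close> iff for all \<open>a\<close>, \<open>b\<close> the antidiagonals of \<open>S\<close> inside the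
  \<open>a \<times> b\<close> corner have length at most \<open>r w a b\<close>. The combinatorial heart of the proof is
  \<open>antidiag_rank_realised\<close>: the maximal length of these antidiagonals, as a function of
  \<open>a\<close> and \<open>b\<close>, is itself the table of corner ranks of some matrix \<open>w\<^sub>S\<close>. So the monomial avoids the
  ideal of \<open>w\<^sub>S\<close>, and it avoids the ideal of \<open>w\<close> iff \<open>r w\<^sub>S \<le> r w\<close>.

  This yields the transitions. For \<open>w \<noteq> 0\<close> take a nonzero entry \<open>(i, j)\<close> with \<open>i + j\<close> minimal, let
  \<open>f\<close> be the variable \<open>x\<close> at this position, and let \<open>\<Phi>\<close> consist of the pairs of all \<open>w'\<close> with
  \<open>r w' \<le> r w\<close> that vanish on the corner ending at \<open>(i, j)\<close>. A monomial outside \<open>J + (x)\<close> has a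
  support \<open>S\<close> that avoids \<open>(i, j)\<close>, so \<open>w\<^sub>S\<close> is one of these \<open>w'\<close> and the monomial lies outside the
  intersection (\<open>J_ideal_transition\<close>). The other inclusions hold because smaller corner ranks give
  smaller varieties and larger ideals.

  The colon condition is void, because \<open>x\<close> is not a zero divisor modulo the vanishing ideal
  (\<open>vanishes_if_multiple_vanishes\<close>): every matrix of the variety with \<open>x = 0\<close> lies on a
  line inside the variety whose other points have the pivot of row \<open>i\<close> further to the left, after
  finitely many such steps in column \<open>j\<close>; and a polynomial that vanishes on a line except at one
  point also vanishes there, the field being infinite. The lines are found in the normal form \<open>L v U\<close> with \<open>L\<close> lower and \<open>U\<close> upper
  unitriangular and \<open>v\<close> a partial permutation pattern (\<open>normal_form\<close>), where corner ranks
  count nonzero entries.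

  The remaining conditions compare the two ideals of one \<open>w\<close>. The antidiagonal is the leading term
  of a minor (\<open>minor_leading\<close>), so \<open>J\<close> lies in the initial ideal; a maximal vanishing
  ideal is that of the origin, which forces \<open>w = 0\<close>; and the vanishing ideal determines the corner
  ranks (\<open>corner_rank_le_if_ideal_subset\<close>), hence \<open>J\<close>.
\<close>

section \<open>The polynomial ring and its monomial ideals\<close>

abbreviation supp :: "('a \<Rightarrow>\<^sub>0 'b::zero) \<Rightarrow> 'a set" where
  "supp \<equiv> Poly_Mapping.keys"

lemma mpoly_ring_ops [simp]:
  "x \<otimes>\<^bsub>mpoly_ring V\<^esub> y = x * y" "x \<oplus>\<^bsub>mpoly_ring V\<^esub> y = x + y"
  "\<one>\<^bsub>mpoly_ring V\<^esub> = 1" "\<zero>\<^bsub>mpoly_ring V\<^esub> = 0"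
  by (simp_all add: mpoly_ring_def)

lemma carrier_mpoly_ring:
  "p \<in> carrier (mpoly_ring V) \<longleftrightarrow> (\<forall>t \<in> supp p. supp t \<subseteq> V)"
  by (simp add: mpoly_ring_def)

lemma keys_add_monom: "supp (s + t :: 'v monom) = supp s \<union> supp t"
  by (auto simp: in_keys_iff lookup_add)

lemma carrier_add [simp]:
  "p \<in> carrier (mpoly_ring V) \<Longrightarrow> q \<in> carrier (mpoly_ring V) \<Longrightarrow> p + q \<in> carrier (mpoly_ring V)"
  using Poly_Mapping.keys_add[of p q] by (auto simp: carrier_mpoly_ring)

lemma carrier_mult [simp]:
  "p \<in> carrier (mpoly_ring V) \<Longrightarrow> q \<in> carrier (mpoly_ring V) \<Longrightarrow> p * q \<in> carrier (mpoly_ring V)"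
  using Poly_Mapping.keys_mult[of p q]
  unfolding carrier_mpoly_ring by (fastforce simp: keys_add_monom)

lemma carrier_0 [simp]: "0 \<in> carrier (mpoly_ring V)"
  and carrier_1 [simp]: "1 \<in> carrier (mpoly_ring V)"
  and carrier_uminus [simp]: "p \<in> carrier (mpoly_ring V) \<Longrightarrow> - p \<in> carrier (mpoly_ring V)"
  by (simp_all add: carrier_mpoly_ring in_keys_iff)

lemma carrier_single: "supp t \<subseteq> V \<Longrightarrow> Poly_Mapping.single t c \<in> carrier (mpoly_ring V)"
  by (auto simp: carrier_mpoly_ring)

lemma carrier_sum: "(\<And>x. x \<in> F \<Longrightarrow> h x \<in> carrier (mpoly_ring V)) \<Longrightarrow> sum h F \<in> carrier (mpoly_ring V)"
  by (induction F rule: infinite_finite_induct) auto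

lemma carrier_prod: "(\<And>x. x \<in> F \<Longrightarrow> h x \<in> carrier (mpoly_ring V)) \<Longrightarrow> prod h F \<in> carrier (mpoly_ring V)"
  by (induction F rule: infinite_finite_induct) auto

lemma mpoly_ring_cring: "cring (mpoly_ring V)"
proof (rule cringI)
  show "abelian_group (mpoly_ring V)"
    by (rule abelian_groupI) (auto simp: add_ac intro: bexI[where x="- _"])
  show "Group.comm_monoid (mpoly_ring V)"
    by (rule comm_monoidI) (auto simp: mult_ac)
qed (auto simp: algebra_simps)

lemma mpoly_ring_ring: "ring (mpoly_ring V)"
  using mpoly_ring_cring cring_def by blast

lemma poly_mapping_sum_single:
  "p = (\<Sum>t \<in> supp p. Poly_Mapping.single t (Poly_Mapping.lookup p t))"
  by (rule poly_mapping_eqI)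
     (auto simp: lookup_sum lookup_single when_def in_keys_iff sum.delta' cong: if_cong)

text \<open>
  Closure under negation follows from closure under multiplication by the constant \<open>- 1\<close>.
\<close>

lemma ideal_mpoly_ring_iff:
  fixes I :: "('v, 'k::field) mpoly set"
  shows "ideal I (mpoly_ring V) \<longleftrightarrow> I \<subseteq> carrier (mpoly_ring V) \<and> 0 \<in> I \<and> (\<forall>p\<in>I. \<forall>q\<in>I. p + q \<in> I) \<and>
     (\<forall>p\<in>carrier (mpoly_ring V). \<forall>q\<in>I. p * q \<in> I)" (is "_ \<longleftrightarrow> ?R")
proof
  assume *: "ideal I (mpoly_ring V)"
  show ?R
    using additive_subgroup.a_subset[OF ideal.axioms(1)[OF *]]
      additive_subgroup.zero_closed[OF ideal.axioms(1)[OF *]]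
      additive_subgroup.a_closed[OF ideal.axioms(1)[OF *]] ideal.I_l_closed[OF *]
    by auto
next
  assume R: ?R
  have inv: "\<ominus>\<^bsub>mpoly_ring V\<^esub> p = - p" if "p \<in> carrier (mpoly_ring V)" for p
    by (rule abelian_group.minus_equality[OF ring.is_abelian_group[OF mpoly_ring_ring]])
       (use that in auto)
  have neg: "- p \<in> I" if "p \<in> I" for p
    using R that by (metis carrier_1 carrier_uminus mult_minus1)
  show "ideal I (mpoly_ring V)"
  proof (rule idealI[OF mpoly_ring_ring])
    show "subgroup I (add_monoid (mpoly_ring V))"
    proof (rule group.subgroupI)
      show "group (add_monoid (mpoly_ring V))"
        by (rule abelian_group.a_group[OF ring.is_abelian_group[OF mpoly_ring_ring]])
      fix p assume p: "p \<in> I"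
      then have "p \<in> carrier (mpoly_ring V)" using R by auto
      then have "inv\<^bsub>add_monoid (mpoly_ring V)\<^esub> p = - p" using inv[of p] by (simp add: a_inv_def)
      then show "inv\<^bsub>add_monoid (mpoly_ring V)\<^esub> p \<in> I" using neg p by simp
    qed (use R in auto)
    fix a x :: "('v, 'k) mpoly" assume *: "a \<in> I" "x \<in> carrier (mpoly_ring V)"
    show "x \<otimes>\<^bsub>mpoly_ring V\<^esub> a \<in> I" using R * by simp
    then show "a \<otimes>\<^bsub>mpoly_ring V\<^esub> x \<in> I" by (simp add: mult.commute)
  qed
qed

lemma ideal_sum:
  assumes "ideal I (mpoly_ring V)" "\<And>x. x \<in> F \<Longrightarrow> h x \<in> I"
  shows "sum h F \<in> I"
  using assms(2) by (induction F rule: infinite_finite_induct) (use assms(1) in \<open>auto simp: ideal_mpoly_ring_iff\<close>)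

text \<open>
  The polynomials all of whose terms are divisible by a generator form an ideal, since the
  terms of a product are sums of exponent vectors of the factors. Conversely each single term of
  such a polynomial is a multiple of a generator.
\<close>

lemma genideal_monomials:
  assumes "\<And>a. a \<in> A \<Longrightarrow> supp a \<subseteq> V"
  shows "genideal (mpoly_ring V) (monomial ` A :: ('v, 'k::field) mpoly set) =
    {p \<in> carrier (mpoly_ring V). \<forall>t \<in> supp p. \<exists>a\<in>A. \<exists>s. t = a + s}" (is "?G = ?D")
proof
  have gens: "monomial ` A \<subseteq> carrier (mpoly_ring V)"
    using assms by (auto simp: monomial_def intro!: carrier_single)
  show "?G \<subseteq> ?D"
  proof (rule ring.genideal_minimal[OF mpoly_ring_ring])
    show "ideal ?D (mpoly_ring V)"
    proof (unfold ideal_mpoly_ring_iff, intro conjI ballI)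
      fix p q :: "('v, 'k) mpoly" assume pq: "p \<in> ?D" "q \<in> ?D"
      show "p + q \<in> ?D" using pq Poly_Mapping.keys_add[of p q] by auto
    next
      fix p q :: "('v, 'k) mpoly" assume p: "p \<in> carrier (mpoly_ring V)" and q: "q \<in> ?D"
      have "\<exists>a\<in>A. \<exists>s. t = a + s" if "t \<in> supp (p * q)" for t
      proof -
        have "t \<in> {u + v | u v. u \<in> supp p \<and> v \<in> supp q}"
          using that Poly_Mapping.keys_mult[of p q] by (rule rev_subsetD)
        then obtain u v where uv: "v \<in> supp q" "t = u + v" by blast
        then obtain a s where "a \<in> A" "v = a + s" using q by blast
        then show ?thesis using uv by (metis add.left_commute)
      qed
      then show "p * q \<in> ?D" using p q by auto
    qed auto
    show "monomial ` A \<subseteq> ?D"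
      using gens by (auto simp: monomial_def) (metis add_0_right)
  qed
  show "?D \<subseteq> ?G"
  proof
    fix p assume p: "p \<in> ?D"
    have G: "ideal ?G (mpoly_ring V)" by (rule ring.genideal_ideal[OF mpoly_ring_ring gens])
    have "Poly_Mapping.single t (Poly_Mapping.lookup p t) \<in> ?G" if t: "t \<in> supp p" for t
    proof -
      obtain a s where as: "a \<in> A" "t = a + s" using p t by blast
      have "supp t \<subseteq> V" using p t by (auto simp: carrier_mpoly_ring)
      then have "supp s \<subseteq> V" using as by (auto simp: keys_add_monom)
      then have "Poly_Mapping.single s (Poly_Mapping.lookup p t) \<in> carrier (mpoly_ring V)"
        by (rule carrier_single)
      moreover have "monomial a \<in> ?G" using ring.genideal_self[OF mpoly_ring_ring gens] as(1) by auto
      ultimately have "Poly_Mapping.single s (Poly_Mapping.lookup p t) * monomial a \<in> ?G"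
        using ideal.I_l_closed[OF G, of "monomial a"] by (metis mpoly_ring_ops(1))
      then show ?thesis by (simp add: as monomial_def mult_single add.commute)
    qed
    then have "(\<Sum>t \<in> supp p. Poly_Mapping.single t (Poly_Mapping.lookup p t)) \<in> ?G"
      by (intro ideal_sum[OF G])
    then show "p \<in> ?G" by (subst poly_mapping_sum_single)
  qed
qed

section \<open>Evaluation of polynomials\<close>

definition monom_eval :: "('v \<Rightarrow> 'k::field) \<Rightarrow> 'v monom \<Rightarrow> 'k" where
  "monom_eval a t = (\<Prod>v \<in> supp t. a v ^ Poly_Mapping.lookup t v)"

lemma monom_eval_superset:
  assumes "finite F" "supp t \<subseteq> F"
  shows "monom_eval a t = (\<Prod>v \<in> F. a v ^ Poly_Mapping.lookup t v)"
  unfolding monom_eval_def by (rule prod.mono_neutral_left) (use assms in \<open>auto simp: in_keys_iff\<close>)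

lemma monom_eval_add: "monom_eval a (s + t) = monom_eval a s * monom_eval a t"
proof -
  let ?F = "supp s \<union> supp t"
  show ?thesis
    by (simp add: monom_eval_superset[of ?F] keys_add_monom lookup_add power_add prod.distrib)
qed

lemma eval_superset:
  assumes "finite F" "supp p \<subseteq> F"
  shows "eval a p = (\<Sum>t \<in> F. Poly_Mapping.lookup p t * monom_eval a t)"
  unfolding eval_def monom_eval_def[symmetric]
  by (rule sum.mono_neutral_left) (use assms in \<open>auto simp: in_keys_iff\<close>)

lemma eval_add: "eval a (p + q) = eval a p + eval a q"
proof -
  let ?F = "supp p \<union> supp q"
  show ?thesis using Poly_Mapping.keys_add[of p q]
    by (simp add: eval_superset[of ?F] lookup_add algebra_simps sum.distrib)
qed

lemma eval_0 [simp]: "eval a 0 = 0" by (simp add: eval_def)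

lemma eval_single: "eval a (Poly_Mapping.single t c) = c * monom_eval a t"
  by (subst eval_superset[of "{t}"]) auto

lemma eval_sum: "eval a (sum h F) = (\<Sum>x\<in>F. eval a (h x))"
  by (induction F rule: infinite_finite_induct) (auto simp: eval_add)

lemma eval_mult: "eval a (p * q) = eval a p * eval a q"
proof -
  let ?s = "\<lambda>p t. Poly_Mapping.single t (Poly_Mapping.lookup p t)"
  have "p * q = (\<Sum>s\<in>supp p. \<Sum>t\<in>supp q. ?s p s * ?s q t)"
    unfolding sum_product[symmetric] poly_mapping_sum_single[symmetric] ..
  then have "eval a (p * q) = (\<Sum>s\<in>supp p. \<Sum>t\<in>supp q. eval a (?s p s) * eval a (?s q t))"
    by (simp add: eval_sum eval_single mult_single monom_eval_add algebra_simps)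
  also have "\<dots> = eval a p * eval a q"
    unfolding sum_product[symmetric] eval_sum[symmetric] poly_mapping_sum_single[symmetric] ..
  finally show ?thesis .
qed

lemma eval_const [simp]: "eval a (const c) = c"
  by (simp add: const_def eval_single monom_eval_def)

lemma eval_1 [simp]: "eval a 1 = 1"
  using eval_const[of a 1] by (simp add: const_def)

lemma eval_var [simp]: "eval a (var v) = a v"
  by (simp add: var_def monomial_def eval_single monom_eval_def)

lemma eval_hom: "comm_ring_hom (eval a)"
  by unfold_locales (auto simp: eval_add eval_mult)

section \<open>Rank of matrix products\<close>

lemma mult_mat_index:
  assumes "A \<in> carrier_mat a b" "B \<in> carrier_mat b c" "i < a" "j < c"
  shows "(A * B) $$ (i, j) = (\<Sum>z<b. A $$ (i, z) * B $$ (z, j))"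
  using assms by (auto simp: scalar_prod_def atLeast0LessThan intro!: sum.cong)

text \<open>
  The columns of \<open>A * Q\<close> lie in the column space of \<open>A\<close>.
\<close>

lemma rank_mult_right:
  fixes A :: "'a::field mat"
  assumes A: "A \<in> carrier_mat n k" and Q: "Q \<in> carrier_mat k c"
  shows "vec_space.rank n (A * Q) \<le> vec_space.rank n A"
proof -
  interpret vec_space "TYPE('a)" n .
  have AQ: "A * Q \<in> carrier_mat n c" using A Q by simp
  have "col_space (A * Q) \<subseteq> col_space A"
  proof
    fix y assume "y \<in> col_space (A * Q)"
    then obtain x where x: "x \<in> carrier_vec c" "(A * Q) *\<^sub>v x = y"
      using col_space_eq[OF AQ] A Q by auto
    then have "A *\<^sub>v (Q *\<^sub>v x) = y" using assoc_mult_mat_vec[OF A Q] by simp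
    then show "y \<in> col_space A" unfolding col_space_eq[OF A]
      using x(1) A Q by auto
  qed
  then have sub: "span (set (cols (A * Q))) \<subseteq> span (set (cols A))" by (simp add: col_space_def)
  have sA: "VectorSpace.subspace class_ring (span (set (cols A))) V"
    by (rule span_is_subspace) (use A cols_dim[of A] in auto)
  have sAQ: "VectorSpace.subspace class_ring (span (set (cols (A * Q)))) V"
    by (rule span_is_subspace) (use A cols_dim[of "A * Q"] in auto)
  have "VectorSpace.subspace class_ring (span (set (cols (A * Q)))) (vs (span (set (cols A))))"
    by (rule nested_subspaces[OF sA sAQ sub])
  then show ?thesis
    unfolding rank_def
    using vectorspace.subspace_dim[OF subspace_is_vs[OF sA]] fin_dim_span_cols[OF A] fin_dim_span_cols[OF AQ]
    by auto
qed

text \<open>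
  Linearly independent columns of \<open>P * A\<close> come from columns of \<open>A\<close> which are themselves
  independent, because multiplication by \<open>P\<close> preserves every linear relation between columns.
\<close>

lemma rank_mult_left:
  fixes A :: "'a::field mat"
  assumes P: "P \<in> carrier_mat p n" and A: "A \<in> carrier_mat n c"
  shows "vec_space.rank p (P * A) \<le> vec_space.rank n A"
proof -
  interpret vp: vec_space "TYPE('a)" p .
  interpret vn: vec_space "TYPE('a)" n .
  have PA: "P * A \<in> carrier_mat p c" using P A by simp
  obtain S where S: "maximal S (\<lambda>T. T \<subseteq> set (cols (P * A)) \<and> vp.lin_indpt T)"
    using maximal_exists[of "(\<lambda>T. T \<subseteq> set (cols (P * A)) \<and> vp.lin_indpt T)" "card (set (cols (P * A)))" "{}"]
    by (meson List.finite_set card_mono empty_iff empty_subsetI vp.finite_lin_indpt2 rev_finite_subset)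
  then have S': "S \<subseteq> set (cols (P * A))" "vp.lin_indpt S" by (auto simp: maximal_def)
  obtain ys where ys: "set ys = S" "distinct ys"
    using finite_distinct_list[of S] finite_subset[OF S'(1)] by auto
  have "\<forall>y\<in>S. \<exists>j<c. col (P * A) j = y"
    using S'(1) PA by (fastforce simp: cols_def)
  then obtain jj where jj: "\<And>y. y \<in> S \<Longrightarrow> jj y < c \<and> col (P * A) (jj y) = y" by metis
  define B where "B = mat_of_cols n (map (\<lambda>y. col A (jj y)) ys)"
  have B: "B \<in> carrier_mat n (length ys)" unfolding B_def by auto
  have Bcol: "col B l = col A (jj (ys ! l))" if "l < length ys" for l
    using that A unfolding B_def by auto
  have PBcol: "col (P * B) l = ys ! l" if l: "l < length ys" for l
  proof -
    have s: "ys ! l \<in> S" using ys l nth_mem by auto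
    have "col (P * B) l = P *\<^sub>v col B l" using P B l by auto
    also have "\<dots> = col (P * A) (jj (ys ! l))" using Bcol[OF l] jj[OF s] col_mult2[OF P A] by metis
    finally show ?thesis using jj[OF s] by simp
  qed
  have PB: "P * B \<in> carrier_mat p (length ys)" using P B by simp
  have cPB: "cols (P * B) = ys"
    by (rule nth_equalityI) (use PB PBcol in auto)
  have dB: "distinct (cols B)"
  proof (rule distinct_conv_nth[THEN iffD2], intro allI impI notI)
    fix i j assume ij: "i < length (cols B)" "j < length (cols B)" "i \<noteq> j" "cols B ! i = cols B ! j"
    then have "col B i = col B j" by auto
    then have "col (P * B) i = col (P * B) j" using P B ij by auto
    then show False using PBcol ij B ys(2) by (auto simp: distinct_conv_nth)
  qed
  have "vn.lin_indpt (set (cols B))"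
  proof
    assume "vn.lin_dep (set (cols B))"
    then obtain v where v: "v \<in> carrier_vec (length ys)" "v \<noteq> 0\<^sub>v (length ys)" "B *\<^sub>v v = 0\<^sub>v n"
      using vn.lin_depE[OF B _ dB] by blast
    have "(P * B) *\<^sub>v v = 0\<^sub>v p" using v P B by (auto simp: assoc_mult_mat_vec)
    then have "vp.lin_dep (set (cols (P * B)))"
      using vp.lin_depI[OF PB v(1,2)] cPB ys by auto
    then show False using S' cPB ys by simp
  qed
  moreover have "set (cols B) \<subseteq> set (cols A)"
    using A B Bcol jj ys(1) by (auto simp: cols_def)
  ultimately have "card (set (cols B)) \<le> vn.rank A" by (intro vn.rank_ge_card_indpt[OF A])
  moreover have "card (set (cols B)) = card S"
    using distinct_card[OF dB] distinct_card[OF ys(2)] B ys(1) by simp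
  moreover have "vp.rank (P * A) = card S" by (rule vp.rank_card_indpt[OF PA S])
  ultimately show ?thesis by simp
qed

lemma rank_one: "vec_space.rank k (1\<^sub>m k :: 'a::field mat) = k"
  by (rule vec_space.low_rank_det_zero) auto

lemma rank_mult_both_sides:
  fixes A :: "'a::field mat"
  assumes "X \<in> carrier_mat k a" "A \<in> carrier_mat a b" "Y \<in> carrier_mat b l"
  shows "vec_space.rank k (X * A * Y) \<le> vec_space.rank a A"
  using rank_mult_right[of "X * A" k b Y l] rank_mult_left[of X k a A b] assms by simp

text \<open>
  Picking rows by \<open>f\<close> (scaled by \<open>u\<close>) and columns by \<open>g\<close> is a product with selection
  matrices, so the rank bounds for products apply to submatrices.
\<close>

lemma mult_select:
  fixes A :: "'a::comm_ring_1 mat"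
  assumes A: "A \<in> carrier_mat a b" and fg: "\<And>l. l < k \<Longrightarrow> f l < a" "\<And>l. l < k' \<Longrightarrow> g l < b"
  shows "mat k a (\<lambda>(l, x). if x = f l then u l else 0) * A * mat b k' (\<lambda>(y, l). if y = g l then 1 else 0)
    = mat k k' (\<lambda>(l, l'). u l * A $$ (f l, g l'))" (is "?X * A * ?Y = ?R")
proof (rule eq_matI)
  fix i j assume "i < dim_row ?R" "j < dim_col ?R"
  then have ij: "i < k" "j < k'" by auto
  have XA: "(?X * A) $$ (i, z) = u i * A $$ (f i, z)" if "z < b" for z
    using ij that A fg by (subst mult_mat_index[of _ k a _ b]) (auto simp: if_distrib[of "\<lambda>x. x * _"] sum.delta cong: if_cong)
  show "(?X * A * ?Y) $$ (i, j) = ?R $$ (i, j)"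
    using ij A fg XA by (subst mult_mat_index[of _ k b _ k']) (auto simp: if_distrib[of "\<lambda>x. _ * x"] sum.delta cong: if_cong)
qed (use A in auto)

lemma rank_reindex:
  fixes A :: "'a::field mat"
  assumes A: "A \<in> carrier_mat a b" and fg: "\<And>l. l < k \<Longrightarrow> f l < a" "\<And>l. l < k \<Longrightarrow> g l < b"
  shows "vec_space.rank k (mat k k (\<lambda>(l, l'). A $$ (f l, g l'))) \<le> vec_space.rank a A"
  using rank_mult_both_sides[OF _ A, of "mat k a (\<lambda>(l, x). if x = f l then 1 else 0)" k "mat b k (\<lambda>(y, l). if y = g l then 1 else 0)" k]
    mult_select[OF A, of k f k g "\<lambda>_. 1"] fg by simp

section \<open>Partial permutation matrices\<close>

text \<open>
  The nonzero entries are not normalised to one: elimination with unitriangular matrices cannot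
  rescale them, and only their positions matter for ranks.
\<close>

definition partial_perm :: "nat \<Rightarrow> nat \<Rightarrow> 'a::zero mat \<Rightarrow> bool" where
  "partial_perm a b v \<longleftrightarrow> (\<forall>x<a. \<forall>x'<a. \<forall>y<b. \<forall>y'<b.
     v $$ (x, y) \<noteq> 0 \<longrightarrow> v $$ (x', y') \<noteq> 0 \<longrightarrow> (x = x' \<longleftrightarrow> y = y'))"

definition dots :: "'a::zero mat \<Rightarrow> nat \<Rightarrow> nat \<Rightarrow> (nat \<times> nat) set" where
  "dots v a b = {p \<in> {..<a} \<times> {..<b}. v $$ p \<noteq> 0}"

lemma finite_dots [simp]: "finite (dots v a b)"
  by (simp add: dots_def)

text \<open>
  Enumerate the nonzero entries. Selecting their rows and columns turns \<open>A\<close> into an identity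
  matrix, which bounds the rank from below; conversely \<open>A\<close> factors through a space with one
  coordinate per nonzero entry.
\<close>

lemma rank_partial_perm:
  fixes A :: "'a::field mat"
  assumes A: "A \<in> carrier_mat a b" and sp: "partial_perm a b A"
  shows "\<exists>X\<in>carrier_mat (card (dots A a b)) a. \<exists>Y\<in>carrier_mat b (card (dots A a b)).
    X * A * Y = 1\<^sub>m (card (dots A a b))"
    and "vec_space.rank a A = card (dots A a b)"
proof -
  define c where "c = card (dots A a b)"
  obtain h where h: "bij_betw h {0..<c} (dots A a b)"
    unfolding c_def using ex_bij_betw_nat_finite[OF finite_dots] by blast
  have hD: "h l \<in> dots A a b" if "l < c" for l using h that by (auto simp: bij_betw_def)
  then have h1: "fst (h l) < a" "snd (h l) < b" "A $$ h l \<noteq> 0" if "l < c" for l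
    using that by (fastforce simp: dots_def)+
  have hinj: "h l = h l' \<longleftrightarrow> l = l'" if "l < c" "l' < c" for l l'
    using h that by (auto simp: bij_betw_def inj_on_def)
  let ?X = "mat c a (\<lambda>(l, x). if x = fst (h l) then 1 / A $$ h l else 0)"
  let ?Y = "mat b c (\<lambda>(y, l). if y = snd (h l) then 1 else 0)"
  have "?X * A * ?Y = mat c c (\<lambda>(l, l'). 1 / A $$ h l * A $$ (fst (h l), snd (h l')))"
    by (rule mult_select[OF A]) (use h1 in auto)
  also have "\<dots> = 1\<^sub>m c"
  proof (rule eq_matI)
    fix l l' assume "l < dim_row (1\<^sub>m c :: 'a mat)" "l' < dim_col (1\<^sub>m c :: 'a mat)"
    then have l: "l < c" "l' < c" by auto
    have "l = l'" if nz: "A $$ (fst (h l), snd (h l')) \<noteq> 0"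
    proof -
      have "fst (h l) = fst (h l') \<longleftrightarrow> snd (h l') = snd (h l')"
        using sp nz h1[OF l(1)] h1[OF l(2)] unfolding partial_perm_def by (metis prod.collapse)
      moreover have "fst (h l) = fst (h l) \<longleftrightarrow> snd (h l) = snd (h l')"
        using sp nz h1[OF l(1)] h1[OF l(2)] unfolding partial_perm_def by (metis prod.collapse)
      ultimately show ?thesis using hinj[OF l] by (auto simp: prod_eq_iff)
    qed
    then show "mat c c (\<lambda>(l, l'). 1 / A $$ h l * A $$ (fst (h l), snd (h l'))) $$ (l, l') = 1\<^sub>m c $$ (l, l')"
      using l h1 by auto
  qed auto
  finally have one: "?X * A * ?Y = 1\<^sub>m c" .
  then show "\<exists>X\<in>carrier_mat (card (dots A a b)) a. \<exists>Y\<in>carrier_mat b (card (dots A a b)).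
    X * A * Y = 1\<^sub>m (card (dots A a b))"
    unfolding c_def[symmetric] by (intro bexI[of _ ?X] bexI[of _ ?Y]) auto
  have "c \<le> vec_space.rank a A"
    using rank_mult_both_sides[of ?X c a A b ?Y c] A unfolding one by (simp add: rank_one)
  moreover have "vec_space.rank a A \<le> c"
  proof -
    let ?B = "mat a c (\<lambda>(x, l). if x = fst (h l) then A $$ h l else 0)"
    let ?C = "mat c b (\<lambda>(l, y). if y = snd (h l) then 1 else 0)"
    have "A = ?B * ?C"
    proof (rule eq_matI)
      fix x y assume "x < dim_row (?B * ?C)" "y < dim_col (?B * ?C)"
      then have xy: "x < a" "y < b" by auto
      have "(?B * ?C) $$ (x, y) = (\<Sum>l<c. if h l = (x, y) then A $$ (x, y) else 0)"
        using xy by (subst mult_mat_index[of _ a c _ b]) (auto intro!: sum.cong simp: prod_eq_iff)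
      also have "\<dots> = A $$ (x, y)"
      proof (cases "A $$ (x, y) = 0")
        case False
        then have "(x, y) \<in> dots A a b" using xy by (auto simp: dots_def)
        then have "(x, y) \<in> h ` {0..<c}" using h by (simp add: bij_betw_def)
        then obtain l0 where "l0 < c" "h l0 = (x, y)" by auto
        then have "h l = (x, y) \<longleftrightarrow> l = l0" if "l < c" for l using hinj that by metis
        then have "(\<Sum>l<c. if h l = (x, y) then A $$ (x, y) else 0) = (\<Sum>l<c. if l = l0 then A $$ (x, y) else 0)"
          by (intro sum.cong) auto
        then show ?thesis using \<open>l0 < c\<close> by simp
      qed simp
      finally show "A $$ (x, y) = (?B * ?C) $$ (x, y)" by simp
    qed (use A in auto)
    then show ?thesis
      using rank_mult_right[of ?B a c ?C b] vec_space.rank_le_nc[of ?B a c] by simp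
  qed
  ultimately show "vec_space.rank a A = card (dots A a b)" by (simp add: c_def)
qed

section \<open>Triangular multipliers and corners\<close>

definition unit_lower :: "nat \<Rightarrow> 'a::{zero,one} mat \<Rightarrow> bool" where
  "unit_lower m L \<longleftrightarrow> L \<in> carrier_mat m m \<and> (\<forall>x<m. L $$ (x, x) = 1) \<and> (\<forall>y<m. \<forall>x<y. L $$ (x, y) = 0)"

definition unit_upper :: "nat \<Rightarrow> 'a::{zero,one} mat \<Rightarrow> bool" where
  "unit_upper n U \<longleftrightarrow> U \<in> carrier_mat n n \<and> (\<forall>x<n. U $$ (x, x) = 1) \<and> (\<forall>x<n. \<forall>y<x. U $$ (x, y) = 0)"

lemma unit_lower_mult:
  fixes L :: "'a::comm_ring_1 mat"
  assumes "unit_lower m L" "unit_lower m L'"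
  shows "unit_lower m (L * L')"
proof -
  have c: "L \<in> carrier_mat m m" "L' \<in> carrier_mat m m" using assms by (auto simp: unit_lower_def)
  have "(L * L') $$ (x, y) = 0" if "y < m" "x < y" for x y
  proof -
    have "(L * L') $$ (x, y) = (\<Sum>z<m. L $$ (x, z) * L' $$ (z, y))"
      using that by (intro mult_mat_index[OF c]) auto
    also have "\<dots> = 0"
      by (rule sum.neutral) (use that assms in \<open>auto simp: unit_lower_def, metis linorder_neqE_nat mult_zero_left mult_zero_right order.strict_trans\<close>)
    finally show ?thesis .
  qed
  moreover have "(L * L') $$ (x, x) = 1" if "x < m" for x
  proof -
    have "(L * L') $$ (x, x) = (\<Sum>z<m. L $$ (x, z) * L' $$ (z, x))"
      using that by (intro mult_mat_index[OF c]) auto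
    also have "\<dots> = (\<Sum>z<m. if z = x then 1 else 0)"
    proof (rule sum.cong)
      fix z assume "z \<in> {..<m}"
      then show "L $$ (x, z) * L' $$ (z, x) = (if z = x then 1 else 0)"
        using that assms by (cases z x rule: linorder_cases) (auto simp: unit_lower_def)
    qed simp
    finally show ?thesis using that by simp
  qed
  ultimately show ?thesis using c by (auto simp: unit_lower_def)
qed

lemma unit_upper_transpose: "unit_upper n U \<longleftrightarrow> unit_lower n (transpose_mat U) \<and> U \<in> carrier_mat n n"
  by (auto simp: unit_lower_def unit_upper_def)

lemma unit_upper_mult:
  fixes U :: "'a::comm_ring_1 mat"
  assumes "unit_upper n U" "unit_upper n U'"
  shows "unit_upper n (U * U')"
  using unit_lower_mult[of n "transpose_mat U'" "transpose_mat U"] assms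
  by (auto simp: unit_upper_transpose transpose_mult[of U n n U' n])

lemma unit_lower_left_inverse:
  fixes L :: "'a::field mat"
  assumes "unit_lower m L"
  obtains P where "P \<in> carrier_mat m m" "P * L = 1\<^sub>m m" "L * P = 1\<^sub>m m"
proof -
  have c: "L \<in> carrier_mat m m" using assms by (auto simp: unit_lower_def)
  have "det L = prod_list (diag_mat L)"
    by (rule det_lower_triangular[of m]) (use assms in \<open>auto simp: unit_lower_def\<close>)
  also have "\<dots> = (\<Prod>i = 0..<dim_row L. L $$ (i, i))" by (rule prod_list_diag_prod)
  also have "\<dots> = 1" using assms by (auto simp: unit_lower_def)
  finally have "det L \<noteq> 0" by simp
  from det_non_zero_imp_unit[OF c this, of "()"]
  show thesis using that by (auto simp: Units_def ring_mat_def)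
qed

lemma unit_upper_right_inverse:
  fixes U :: "'a::field mat"
  assumes "unit_upper n U"
  obtains Q where "Q \<in> carrier_mat n n" "U * Q = 1\<^sub>m n"
proof -
  have U: "unit_lower n (transpose_mat U)" "U \<in> carrier_mat n n" using assms by (auto simp: unit_upper_transpose)
  then obtain P where P: "P \<in> carrier_mat n n" "P * transpose_mat U = 1\<^sub>m n"
    using unit_lower_left_inverse by metis
  have "transpose_mat (P * transpose_mat U) = 1\<^sub>m n" using P by simp
  then have "U * transpose_mat P = 1\<^sub>m n" using transpose_mult[of P n n "transpose_mat U" n] P U by simp
  then show thesis using that[of "transpose_mat P"] P by simp
qed

definition corner :: "nat \<Rightarrow> nat \<Rightarrow> 'a mat \<Rightarrow> 'a mat" where
  "corner a b M = mat a b (\<lambda>p. M $$ p)"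

lemma corner_carrier [simp]: "corner a b M \<in> carrier_mat a b"
  and corner_index [simp]: "x < a \<Longrightarrow> y < b \<Longrightarrow> corner a b M $$ (x, y) = M $$ (x, y)"
  by (auto simp: corner_def)

lemma pick_initial:
  assumes "x < a"
  shows "pick {0..<a} x = x"
proof -
  have "{z \<in> {0..<a}. z < x} = {0..<x}" using assms by auto
  then have "card {z \<in> {0..<a}. z < x} = x" by (metis card_atLeastLessThan diff_zero)
  moreover have "x \<in> {0..<a}" using assms by simp
  ultimately show ?thesis using pick_card_in_set by metis
qed

lemma submatrix_initial:
  assumes "M \<in> carrier_mat m n" "a \<le> m" "b \<le> n"
  shows "submatrix M {0..<a} {0..<b} = corner a b M"
proof -
  have "{i. i < m \<and> i \<in> {0..<a}} = {0..<a}" "{i. i < n \<and> i \<in> {0..<b}} = {0..<b}" using assms by auto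
  then have c: "card {i. i < dim_row M \<and> i \<in> {0..<a}} = a" "card {i. i < dim_col M \<and> i \<in> {0..<b}} = b"
    using assms(1) by auto
  show ?thesis unfolding submatrix_def c corner_def
    by (rule cong_mat) (simp_all add: pick_initial)
qed

lemma corner_rank_eq:
  assumes "M \<in> carrier_mat m n" "a \<le> m" "b \<le> n"
  shows "corner_rank M a b = vec_space.rank a (corner a b M)"
  using submatrix_initial[OF assms] by (simp add: corner_rank_def)

lemma corner_unit_lower: "unit_lower m L \<Longrightarrow> a \<le> m \<Longrightarrow> unit_lower a (corner a a L)"
  by (auto simp: unit_lower_def)

lemma corner_unit_upper: "unit_upper m L \<Longrightarrow> a \<le> m \<Longrightarrow> unit_upper a (corner a a L)"
  by (auto simp: unit_upper_def)

text \<open>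
  Rows of \<open>L\<close> above \<open>a\<close> are supported on the first \<open>a\<close> columns, so taking corners is compatible
  with left multiplication by \<open>L\<close>.
\<close>

lemma corner_mult_lower:
  fixes A :: "'a::comm_ring_1 mat"
  assumes L: "unit_lower m L" and A: "A \<in> carrier_mat m n" and ab: "a \<le> m" "b \<le> n"
  shows "corner a b (L * A) = corner a a L * corner a b A"
proof (rule eq_matI)
  fix x y assume "x < dim_row (corner a a L * corner a b A)" "y < dim_col (corner a a L * corner a b A)"
  then have xy: "x < a" "y < b" by (auto simp: corner_def)
  have "(L * A) $$ (x, y) = (\<Sum>z<m. L $$ (x, z) * A $$ (z, y))"
    by (rule mult_mat_index[of _ m m _ n]) (use L A xy ab in \<open>auto simp: unit_lower_def\<close>)
  also have "\<dots> = (\<Sum>z<a. L $$ (x, z) * A $$ (z, y))"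
    by (rule sum.mono_neutral_right) (use L A xy ab in \<open>auto simp: unit_lower_def\<close>)
  also have "\<dots> = (corner a a L * corner a b A) $$ (x, y)"
    using xy by (subst mult_mat_index[of _ a a _ b]) auto
  finally show "corner a b (L * A) $$ (x, y) = (corner a a L * corner a b A) $$ (x, y)"
    using xy by simp
qed (auto simp: corner_def)

lemma corner_mult_upper:
  fixes A :: "'a::comm_ring_1 mat"
  assumes U: "unit_upper n U" and A: "A \<in> carrier_mat m n" and ab: "a \<le> m" "b \<le> n"
  shows "corner a b (A * U) = corner a b A * corner b b U"
proof (rule eq_matI)
  fix x y assume "x < dim_row (corner a b A * corner b b U)" "y < dim_col (corner a b A * corner b b U)"
  then have xy: "x < a" "y < b" by (auto simp: corner_def)
  have "(A * U) $$ (x, y) = (\<Sum>z<n. A $$ (x, z) * U $$ (z, y))"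
    by (rule mult_mat_index[of _ m n _ n]) (use U A xy ab in \<open>auto simp: unit_upper_def\<close>)
  also have "\<dots> = (\<Sum>z<b. A $$ (x, z) * U $$ (z, y))"
    by (rule sum.mono_neutral_right) (use U A xy ab in \<open>auto simp: unit_upper_def\<close>)
  also have "\<dots> = (corner a b A * corner b b U) $$ (x, y)"
    using xy by (subst mult_mat_index[of _ a b _ b]) auto
  finally show "corner a b (A * U) $$ (x, y) = (corner a b A * corner b b U) $$ (x, y)"
    using xy by simp
qed (auto simp: corner_def)

lemma corner_mult_triangular:
  fixes v :: "'a::comm_ring_1 mat"
  assumes "unit_lower m L" "unit_upper n U" "v \<in> carrier_mat m n" "a \<le> m" "b \<le> n"
  shows "corner a b (L * v * U) = corner a a L * corner a b v * corner b b U"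
proof -
  have "L * v \<in> carrier_mat m n" using assms by (auto simp: unit_lower_def)
  then have "corner a b (L * v * U) = corner a b (L * v) * corner b b U"
    by (rule corner_mult_upper[OF assms(2) _ assms(4,5)])
  then show ?thesis unfolding corner_mult_lower[OF assms(1,3-5)] .
qed

lemma mult_mat_reassoc:
  fixes P :: "'a::semiring_1 mat"
  assumes "P \<in> carrier_mat a b" "L \<in> carrier_mat b c" "v \<in> carrier_mat c d" "U \<in> carrier_mat d e" "Q \<in> carrier_mat e f"
  shows "P * (L * v * U) * Q = (P * L) * v * (U * Q)"
proof -
  have "P * (L * v * U) = P * (L * v) * U"
    by (rule assoc_mult_mat[symmetric, of _ a b _ d _ e]) (use assms in auto)
  moreover have "P * (L * v) = (P * L) * v"
    by (rule assoc_mult_mat[symmetric, of _ a b _ c _ d]) (use assms in auto)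
  moreover have "(P * L) * v * U * Q = (P * L) * v * (U * Q)"
    by (rule assoc_mult_mat[of _ a d _ e _ f]) (use assms in auto)
  ultimately show ?thesis by simp
qed

text \<open>
  Corners of unitriangular matrices are unitriangular, hence invertible. The second part
  recovers the corner of \<open>v\<close> itself, not just its rank.
\<close>

lemma corner_rank_mult_triangular:
  fixes v :: "'a::field mat"
  assumes L: "unit_lower m L" and U: "unit_upper n U" and v: "v \<in> carrier_mat m n" and ab: "a \<le> m" "b \<le> n"
  shows "corner_rank (L * v * U) a b = corner_rank v a b"
    and "\<exists>P\<in>carrier_mat a a. \<exists>Q\<in>carrier_mat b b. P * corner a b (L * v * U) * Q = corner a b v"
proof -
  let ?L = "corner a a L" and ?U = "corner b b U" and ?v = "corner a b v"
  have LvU: "L * v * U \<in> carrier_mat m n" using L U v by (auto simp: unit_lower_def unit_upper_def)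
  obtain P where P: "P \<in> carrier_mat a a" "P * ?L = 1\<^sub>m a"
    using unit_lower_left_inverse[OF corner_unit_lower[OF L ab(1)]] by metis
  obtain Q where Q: "Q \<in> carrier_mat b b" "?U * Q = 1\<^sub>m b"
    using unit_upper_right_inverse[OF corner_unit_upper[OF U ab(2)]] by metis
  have c: "?L \<in> carrier_mat a a" "?v \<in> carrier_mat a b" "?U \<in> carrier_mat b b" by auto
  have "P * (?L * ?v * ?U) * Q = (P * ?L) * ?v * (?U * Q)"
    by (subst mult_mat_reassoc[OF P(1) c Q(1)]) (rule refl)
  also have "\<dots> = ?v" using P Q by (simp add: left_mult_one_mat[of _ a b] right_mult_one_mat[of _ a b])
  finally have *: "P * corner a b (L * v * U) * Q = ?v" using corner_mult_triangular[OF L U v ab] by simp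
  then show "\<exists>P\<in>carrier_mat a a. \<exists>Q\<in>carrier_mat b b. P * corner a b (L * v * U) * Q = ?v" using P Q by blast
  have "vec_space.rank a ?v \<le> vec_space.rank a (corner a b (L * v * U))"
    using rank_mult_both_sides[OF P(1) corner_carrier Q(1), of "L * v * U"] * by simp
  moreover have "vec_space.rank a (corner a b (L * v * U)) \<le> vec_space.rank a ?v"
    unfolding corner_mult_triangular[OF L U v ab] by (rule rank_mult_both_sides[of _ a a _ b _ b]) auto
  ultimately show "corner_rank (L * v * U) a b = corner_rank v a b"
    using LvU v ab by (simp add: corner_rank_eq)
qed

lemma corner_rank_partial_perm:
  fixes v :: "'a::field mat"
  assumes "v \<in> carrier_mat m n" "a \<le> m" "b \<le> n" "partial_perm a b v"
  shows "corner_rank v a b = card (dots v a b)"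
proof -
  have "dots (corner a b v) a b = dots v a b" by (auto simp: dots_def)
  moreover have "partial_perm a b (corner a b v)" using assms(4) by (simp add: partial_perm_def)
  ultimately show ?thesis
    using rank_partial_perm(2)[of "corner a b v" a b] assms by (simp add: corner_rank_eq)
qed

lemma partial_perm_mono: "partial_perm m n v \<Longrightarrow> a \<le> m \<Longrightarrow> b \<le> n \<Longrightarrow> partial_perm a b v"
  by (simp add: partial_perm_def)

section \<open>Normal form preserving all corner ranks\<close>

text \<open>
  The state of the elimination after \<open>k\<close> rows: every nonzero entry of these rows is the only
  one in its row and in its column.
\<close>

definition cleared_rows :: "nat \<Rightarrow> nat \<Rightarrow> nat \<Rightarrow> 'a::zero mat \<Rightarrow> bool" where
  "cleared_rows m n k v \<longleftrightarrow> (\<forall>x<k. \<forall>y<n. v $$ (x, y) \<noteq> 0 \<longrightarrow>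
     (\<forall>y'<n. y' \<noteq> y \<longrightarrow> v $$ (x, y') = 0) \<and> (\<forall>x'<m. x' \<noteq> x \<longrightarrow> v $$ (x', y) = 0))"

lemma cleared_rows_entry:
  assumes c: "cleared_rows m n k v" and x: "x < k" and y: "y < n" and nz: "v $$ (x, y) \<noteq> 0"
  shows "(\<forall>y'<n. y' \<noteq> y \<longrightarrow> v $$ (x, y') = 0) \<and> (\<forall>x'<m. x' \<noteq> x \<longrightarrow> v $$ (x', y) = 0)"
  by (rule c[unfolded cleared_rows_def, THEN spec, THEN mp, THEN spec, THEN mp, THEN mp, OF x y nz])

text \<open>
  The leftmost nonzero entry \<open>(k, q)\<close> of row \<open>k\<close> is the pivot. Column operations to the right
  clear the rest of row \<open>k\<close>, then row operations downwards clear the rest of column \<open>q\<close>. The rows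
  above \<open>k\<close> are zero in column \<open>q\<close>, so neither changes them.
\<close>

lemma normal_form_step:
  fixes v :: "'a::field mat"
  assumes v: "v \<in> carrier_mat m n" and k: "k < m"
    and cleared: "cleared_rows m n k v"
  shows "\<exists>L v' U. unit_lower m L \<and> unit_upper n U \<and> v' \<in> carrier_mat m n \<and> v = L * v' * U \<and>
    cleared_rows m n (Suc k) v'"
proof (cases "\<exists>q<n. v $$ (k, q) \<noteq> 0")
  case False
  have Q: "(\<forall>y'<n. y' \<noteq> y \<longrightarrow> v $$ (x, y') = 0) \<and> (\<forall>x'<m. x' \<noteq> x \<longrightarrow> v $$ (x', y) = 0)"
    if "x < k" "y < n" "v $$ (x, y) \<noteq> 0" for x y
    using cleared_rows_entry[OF cleared that] .
  have one: "unit_lower m (1\<^sub>m m :: 'a mat)" "unit_upper n (1\<^sub>m n :: 'a mat)" "v = 1\<^sub>m m * v * 1\<^sub>m n"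
    using v by (auto simp: unit_lower_def unit_upper_def)
  have dot: "(\<forall>y'<n. y' \<noteq> y \<longrightarrow> v $$ (x, y') = 0) \<and> (\<forall>x'<m. x' \<noteq> x \<longrightarrow> v $$ (x', y) = 0)"
    if "x < Suc k" "y < n" "v $$ (x, y) \<noteq> 0" for x y
  proof -
    have "x \<noteq> k" using False that by auto
    then show ?thesis using Q[of x y] that by simp
  qed
  show ?thesis
    by (rule exI[of _ "1\<^sub>m m"], rule exI[of _ v], rule exI[of _ "1\<^sub>m n"])
       (simp only: one(1,2) v one(3)[symmetric], use dot in \<open>unfold cleared_rows_def, blast\<close>)
next
  case True
  have Q: "(\<forall>y'<n. y' \<noteq> y \<longrightarrow> v $$ (x, y') = 0) \<and> (\<forall>x'<m. x' \<noteq> x \<longrightarrow> v $$ (x', y) = 0)"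
    if "x < k" "y < n" "v $$ (x, y) \<noteq> 0" for x y
    using cleared_rows_entry[OF cleared that] .
  define q where "q = (LEAST q. q < n \<and> v $$ (k, q) \<noteq> 0)"
  have q: "q < n" "v $$ (k, q) \<noteq> 0"
    using LeastI_ex[OF True] unfolding q_def by auto
  have qmin: "v $$ (k, y) = 0" if "y < q" for y
    using not_less_Least[of y "\<lambda>q. q < n \<and> v $$ (k, q) \<noteq> 0"] that q(1) unfolding q_def[symmetric] by auto
  have vq0: "v $$ (x, q) = 0" if "x < k" for x
    using Q[of x q] that q k by (metis nat_neq_iff)
  define c where "c = (\<lambda>y. if y > q then v $$ (k, y) / v $$ (k, q) else 0)"
  define d where "d = (\<lambda>x. if x > k then v $$ (x, q) / v $$ (k, q) else 0)"
  \<comment> \<open>The inverses of the two elementary operations, so that \<open>v = L * v' * U\<close>.\<close>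
  define L where "L = mat m m (\<lambda>(x, z). (if z = x then 1 else 0) + (if z = k then d x else 0))"
  define U where "U = mat n n (\<lambda>(z, y). (if z = y then 1 else 0) + (if z = q then c y else 0))"
  define v' where "v' = mat m n (\<lambda>(x, y). if x = k then (if y = q then v $$ (k, q) else 0)
    else if y = q then 0 else v $$ (x, y) - c y * v $$ (x, q))"
  have Lm: "(L * A) $$ (x, y) = A $$ (x, y) + d x * A $$ (k, y)"
    if "A \<in> carrier_mat m n" "x < m" "y < n" for A x y
  proof -
    have "(L * A) $$ (x, y) = (\<Sum>z<m. L $$ (x, z) * A $$ (z, y))"
      using that by (intro mult_mat_index[of _ m m _ n]) (auto simp: L_def)
    also have "\<dots> = (\<Sum>z<m. (if z = x then A $$ (z, y) else 0) + (if z = k then d x * A $$ (z, y) else 0))"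
      by (rule sum.cong) (use that in \<open>auto simp: L_def distrib_right\<close>)
    also have "\<dots> = A $$ (x, y) + d x * A $$ (k, y)"
      using that k by (simp add: sum.distrib)
    finally show ?thesis .
  qed
  have Um: "(A * U) $$ (x, y) = A $$ (x, y) + A $$ (x, q) * c y"
    if "A \<in> carrier_mat m n" "x < m" "y < n" for A x y
  proof -
    have "(A * U) $$ (x, y) = (\<Sum>z<n. A $$ (x, z) * U $$ (z, y))"
      using that by (intro mult_mat_index[of _ m n _ n]) (auto simp: U_def)
    also have "\<dots> = (\<Sum>z<n. (if z = y then A $$ (x, z) else 0) + (if z = q then A $$ (x, z) * c y else 0))"
      by (rule sum.cong) (use that in \<open>auto simp: U_def distrib_left\<close>)
    also have "\<dots> = A $$ (x, y) + A $$ (x, q) * c y"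
      using that q by (simp add: sum.distrib)
    finally show ?thesis .
  qed
  have v': "v' \<in> carrier_mat m n" by (simp add: v'_def)
  have Lc: "L \<in> carrier_mat m m" and Uc: "U \<in> carrier_mat n n" by (simp_all add: L_def U_def)
  have Lu: "unit_lower m L" by (auto simp: unit_lower_def L_def d_def)
  have Uu: "unit_upper n U" by (auto simp: unit_upper_def U_def c_def)
  have eq: "v = L * v' * U"
  proof (rule eq_matI)
    fix x y assume "x < dim_row (L * v' * U)" "y < dim_col (L * v' * U)"
    then have xy: "x < m" "y < n" using Lc Uc by auto
    have "(L * v' * U) $$ (x, y) = v' $$ (x, y) + d x * v' $$ (k, y) + (v' $$ (x, q) + d x * v' $$ (k, q)) * c y"
      using Um[of "L * v'", OF _ xy] Lm[OF v' xy] Lm[OF v' xy(1) q(1)] Lc v'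
      by (metis mult_carrier_mat)
    also have "\<dots> = v $$ (x, y)"
      using xy q(1) k qmin vq0 q(2)
      by (cases x k rule: linorder_cases; cases y q rule: linorder_cases) (auto simp: v'_def c_def d_def)
    finally show "v $$ (x, y) = (L * v' * U) $$ (x, y)" by simp
  qed (use v Lc Uc in auto)
  have dot: "(\<forall>y'<n. y' \<noteq> y \<longrightarrow> v' $$ (x, y') = 0) \<and> (\<forall>x'<m. x' \<noteq> x \<longrightarrow> v' $$ (x', y) = 0)"
    if x: "x < Suc k" and y: "y < n" and nz: "v' $$ (x, y) \<noteq> 0" for x y
  proof (cases "x = k")
    case True
    then show ?thesis using nz y k by (auto simp: v'_def split: if_splits)
  next
    case False
    then have xk: "x < k" using x by simp
    have row: "v' $$ (x, y') = v $$ (x, y')" if "y' < n" for y'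
      using xk k that vq0[OF xk] by (auto simp: v'_def)
    have nzv: "v $$ (x, y) \<noteq> 0" using row nz y by simp
    have "y \<noteq> q" using nzv vq0[OF xk] by auto
    have "v $$ (k, y) = 0" using Q[OF xk y nzv] k xk by auto
    then have "c y = 0" by (simp add: c_def)
    then show ?thesis using row Q[OF xk y nzv] \<open>y \<noteq> q\<close> y by (auto simp: v'_def)
  qed
  show ?thesis
    by (rule exI[of _ L], rule exI[of _ v'], rule exI[of _ U])
       (simp only: Lu Uu v' eq[symmetric], use dot in \<open>unfold cleared_rows_def, blast\<close>)
qed

text \<open>
  Gaussian elimination that only adds rows to lower rows and columns to columns further right.
  By \<open>corner_rank_mult_triangular\<close> it changes no corner rank, so corner ranks of any matrix
  count the nonzero entries of a partial permutation pattern.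
\<close>

lemma normal_form:
  fixes M :: "'a::field mat"
  assumes M: "M \<in> carrier_mat m n"
  obtains L v U where "unit_lower m L" "unit_upper n U" "v \<in> carrier_mat m n" "partial_perm m n v" "M = L * v * U"
proof -
  have "k \<le> m \<Longrightarrow> \<exists>L v U. unit_lower m L \<and> unit_upper n U \<and> v \<in> carrier_mat m n \<and> M = L * v * U \<and>
    cleared_rows m n k v" for k
  proof (induction k)
    case 0
    have "unit_lower m (1\<^sub>m m :: 'a mat)" "unit_upper n (1\<^sub>m n :: 'a mat)" "M = 1\<^sub>m m * M * 1\<^sub>m n"
      "cleared_rows m n 0 M"
      using M by (auto simp: unit_lower_def unit_upper_def cleared_rows_def)
    then show ?case using M by metis
  next
    case (Suc k)
    then obtain L v U where 1: "unit_lower m L" "unit_upper n U" "v \<in> carrier_mat m n" "M = L * v * U"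
      "cleared_rows m n k v"
      by auto
    obtain L' v' U' where 3: "unit_lower m L'" "unit_upper n U'" "v' \<in> carrier_mat m n" "v = L' * v' * U'"
      "cleared_rows m n (Suc k) v'"
      using normal_form_step[OF 1(3) _ 1(5)] Suc.prems by auto
    have c: "L \<in> carrier_mat m m" "L' \<in> carrier_mat m m" "U \<in> carrier_mat n n" "U' \<in> carrier_mat n n"
      using 1 3 by (auto simp: unit_lower_def unit_upper_def)
    have "M = (L * L') * v' * (U' * U)"
      unfolding 1(4) 3(4) by (rule mult_mat_reassoc[OF c(1,2) 3(3) c(4,3)])
    then show ?case using unit_lower_mult[OF 1(1) 3(1)] unit_upper_mult[OF 3(2) 1(2)] 3(3,5) by metis
  qed
  from this[OF order_refl] obtain L v U where *: "unit_lower m L" "unit_upper n U" "v \<in> carrier_mat m n"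
    "M = L * v * U" and **: "cleared_rows m n m v" by blast
  have "partial_perm m n v" using ** unfolding partial_perm_def cleared_rows_def by metis
  then show thesis using that[OF *(1-3) _ *(4)] by simp
qed

text \<open>
  An identity matrix of size \<open>r\<close>, where \<open>r\<close> is the corner rank, obtained from the corner by
  fixed multipliers. As the multipliers are constant, this detects a large corner rank by the
  nonvanishing of a polynomial in the entries.
\<close>

lemma corner_rank_witness:
  fixes M :: "'a::field mat"
  assumes M: "M \<in> carrier_mat m n" and ab: "a \<le> m" "b \<le> n"
  shows "\<exists>X\<in>carrier_mat (corner_rank M a b) a. \<exists>Y\<in>carrier_mat b (corner_rank M a b).
    X * corner a b M * Y = 1\<^sub>m (corner_rank M a b)"
proof -
  obtain L v U where *: "unit_lower m L" "unit_upper n U" "v \<in> carrier_mat m n" "partial_perm m n v" "M = L * v * U"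
    using normal_form[OF M] .
  let ?k = "corner_rank M a b"
  have pp: "partial_perm a b (corner a b v)"
    using partial_perm_mono[OF *(4) ab] by (simp add: partial_perm_def)
  have "?k = vec_space.rank a (corner a b v)"
    using corner_rank_mult_triangular(1)[OF *(1,2,3) ab] corner_rank_eq[OF *(3) ab] *(5) by simp
  then have k: "?k = card (dots (corner a b v) a b)"
    using rank_partial_perm(2)[OF corner_carrier pp] by simp
  obtain X Y where XY: "X \<in> carrier_mat ?k a" "Y \<in> carrier_mat b ?k" "X * corner a b v * Y = 1\<^sub>m ?k"
    using rank_partial_perm(1)[OF corner_carrier pp] unfolding k by blast
  obtain P Q where PQ: "P \<in> carrier_mat a a" "Q \<in> carrier_mat b b" "P * corner a b M * Q = corner a b v"
    using corner_rank_mult_triangular(2)[OF *(1,2,3) ab] *(5) by auto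
  have cM: "corner a b M \<in> carrier_mat a b" by simp
  have "(X * P) * corner a b M * (Q * Y) = X * (P * corner a b M * Q) * Y"
    by (subst mult_mat_reassoc[OF XY(1) PQ(1) cM PQ(2) XY(2)]) (rule refl)
  then have "(X * P) * corner a b M * (Q * Y) = 1\<^sub>m ?k" using PQ XY by simp
  moreover have "X * P \<in> carrier_mat ?k a" "Q * Y \<in> carrier_mat b ?k" using XY PQ by auto
  ultimately show ?thesis by blast
qed

section \<open>The reverse lexicographic order\<close>

lemma mdeg_superset:
  assumes "finite F" "supp t \<subseteq> F"
  shows "mdeg t = (\<Sum>v \<in> F. Poly_Mapping.lookup t v)"
  unfolding mdeg_def by (rule sum.mono_neutral_left) (use assms in \<open>auto simp: in_keys_iff\<close>)

lemma mdeg_add: "mdeg (s + t) = mdeg s + mdeg t"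
proof -
  let ?F = "supp s \<union> supp t"
  show ?thesis by (simp add: mdeg_superset[of ?F] keys_add_monom lookup_add sum.distrib)
qed

lemma lex_less_total: "lex_less p q \<or> p = q \<or> lex_less q p"
  by (auto simp: lex_less_def prod_eq_iff)

lemma lex_less_trans: "lex_less p q \<Longrightarrow> lex_less q r \<Longrightarrow> lex_less p r"
  by (auto simp: lex_less_def)

lemma lex_less_asym: "lex_less p q \<Longrightarrow> \<not> lex_less q p"
  by (auto simp: lex_less_def)

text \<open>
  Comparing exponent vectors of equal degree requires the last position where they differ.
\<close>

lemma lex_max_exists:
  assumes "finite D" "D \<noteq> {}"
  shows "\<exists>p\<in>D. \<forall>q. lex_less p q \<longrightarrow> q \<notin> D"
  using assms
proof (induction D rule: finite_ne_induct)
  case (singleton x)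
  then show ?case using lex_less_asym by blast
next
  case (insert x F)
  then obtain p where p: "p \<in> F" "\<And>q. lex_less p q \<Longrightarrow> q \<notin> F" by blast
  show ?case
  proof (cases "lex_less p x")
    case True
    then show ?thesis using p lex_less_trans lex_less_asym by (metis insert_iff)
  next
    case False
    then show ?thesis using p by (metis insert_iff)
  qed
qed

lemma revlexE:
  assumes "revlex a b" "mdeg a = mdeg b"
  obtains p where "Poly_Mapping.lookup a p > Poly_Mapping.lookup b p"
    "\<And>q. lex_less p q \<Longrightarrow> Poly_Mapping.lookup a q = Poly_Mapping.lookup b q"
proof -
  have "\<exists>p. Poly_Mapping.lookup a p > Poly_Mapping.lookup b p \<and>
      (\<forall>q. lex_less p q \<longrightarrow> Poly_Mapping.lookup a q = Poly_Mapping.lookup b q)"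
    using assms by (simp add: revlex_def)
  then show thesis using that by blast
qed

lemma revlex_mdeg_le: "revlex a b \<Longrightarrow> mdeg a \<le> mdeg b"
  unfolding revlex_def by linarith

lemma revlexI:
  assumes "mdeg a = mdeg b" "Poly_Mapping.lookup a p > Poly_Mapping.lookup b p"
    "\<And>q. lex_less p q \<Longrightarrow> Poly_Mapping.lookup a q = Poly_Mapping.lookup b q"
  shows "revlex a b"
  unfolding revlex_def using assms by (intro disjI2 conjI exI[of _ p]) simp_all

lemma revlex_asym:
  assumes "revlex a b"
  shows "\<not> revlex b a"
proof
  assume ba: "revlex b a"
  then have eq: "mdeg a = mdeg b" using assms revlex_mdeg_le by (metis order_antisym)
  obtain p where p: "Poly_Mapping.lookup a p > Poly_Mapping.lookup b p"
      "\<And>r. lex_less p r \<Longrightarrow> Poly_Mapping.lookup a r = Poly_Mapping.lookup b r"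
    using revlexE[OF assms eq] by blast
  obtain q where q: "Poly_Mapping.lookup b q > Poly_Mapping.lookup a q"
      "\<And>r. lex_less q r \<Longrightarrow> Poly_Mapping.lookup b r = Poly_Mapping.lookup a r"
    using revlexE[OF ba eq[symmetric]] by blast
  from lex_less_total[of p q] show False
    using p(1) q(1) p(2)[of q] q(2)[of p] by auto
qed

lemma revlex_trans: 
  assumes "revlex a b" "revlex b c"
  shows "revlex a c"
proof (cases "mdeg a < mdeg b \<or> mdeg b < mdeg c")
  case True
  then have "mdeg a < mdeg c" using assms[THEN revlex_mdeg_le] by linarith
  then show ?thesis by (simp add: revlex_def)
next
  case False
  then have eq: "mdeg a = mdeg b" "mdeg b = mdeg c" using assms[THEN revlex_mdeg_le] by auto
  obtain p where p: "Poly_Mapping.lookup a p > Poly_Mapping.lookup b p"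
      "\<And>r. lex_less p r \<Longrightarrow> Poly_Mapping.lookup a r = Poly_Mapping.lookup b r"
    using revlexE[OF assms(1) eq(1)] by blast
  obtain q where q: "Poly_Mapping.lookup b q > Poly_Mapping.lookup c q"
      "\<And>r. lex_less q r \<Longrightarrow> Poly_Mapping.lookup b r = Poly_Mapping.lookup c r"
    using revlexE[OF assms(2) eq(2)] by blast
  \<comment> \<open>The larger of the two positions is the last one where \<open>a\<close> and \<open>c\<close> differ.\<close>
  define r where "r = (if lex_less p q then q else p)"
  have "Poly_Mapping.lookup a r > Poly_Mapping.lookup c r"
    using p(1) q(1) p(2)[of q] q(2)[of p] lex_less_total[of p q] unfolding r_def by auto
  moreover have "Poly_Mapping.lookup a r' = Poly_Mapping.lookup c r'" if "lex_less r r'" for r'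
    using that p(2)[of r'] q(2)[of r'] lex_less_total[of p q] lex_less_trans[of p q r'] lex_less_trans[of q p r']
    unfolding r_def by (auto split: if_splits)
  ultimately show ?thesis using eq by (intro revlexI[of _ _ r]) auto
qed

lemma revlex_total: "a \<noteq> b \<Longrightarrow> revlex a b \<or> revlex b a"
proof -
  assume "a \<noteq> b"
  let ?D = "{p. Poly_Mapping.lookup a p \<noteq> Poly_Mapping.lookup b p}"
  have "?D \<subseteq> supp a \<union> supp b" by (auto simp: in_keys_iff)
  then have "finite ?D" by (rule finite_subset) simp
  moreover have "?D \<noteq> {}" using \<open>a \<noteq> b\<close> poly_mapping_eqI[of a b] by blast
  ultimately have "\<exists>p\<in>?D. \<forall>q. lex_less p q \<longrightarrow> q \<notin> ?D" by (rule lex_max_exists)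
  then obtain p where p: "p \<in> ?D" "\<forall>q. lex_less p q \<longrightarrow> q \<notin> ?D" by (rule bexE)
  then have ne: "Poly_Mapping.lookup a p \<noteq> Poly_Mapping.lookup b p"
    and eq: "\<And>q. lex_less p q \<Longrightarrow> Poly_Mapping.lookup a q = Poly_Mapping.lookup b q" by blast+
  show ?thesis
  proof (cases "mdeg a = mdeg b")
    case True
    show ?thesis
    proof (cases "Poly_Mapping.lookup a p > Poly_Mapping.lookup b p")
      case less: True
      show ?thesis by (rule disjI1, rule revlexI[OF True less eq])
    next
      case False
      then have less: "Poly_Mapping.lookup b p > Poly_Mapping.lookup a p" using ne by simp
      show ?thesis by (rule disjI2, rule revlexI[OF True[symmetric] less eq[symmetric]])
    qed
  next
    case False
    then have "mdeg a < mdeg b \<or> mdeg b < mdeg a" by linarith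
    then show ?thesis unfolding revlex_def by blast
  qed
qed

lemma revlex_add: "revlex a b \<Longrightarrow> revlex (s + a) (s + b)"
  by (simp add: revlex_def mdeg_add lookup_add)

lemma revlex_max_exists:
  assumes "finite F" "F \<noteq> {}"
  shows "\<exists>t\<in>F. \<forall>s\<in>F. s \<noteq> t \<longrightarrow> revlex s t"
  using assms
proof (induction F rule: finite_ne_induct)
  case (insert x F)
  then obtain t where t: "t \<in> F" "\<And>s. s \<in> F \<Longrightarrow> s \<noteq> t \<Longrightarrow> revlex s t" by blast
  show ?case
  proof (cases "revlex t x")
    case True
    then have "\<forall>s\<in>insert x F. s \<noteq> x \<longrightarrow> revlex s x" using t revlex_trans by (metis insert_iff)
    then show ?thesis by blast
  next
    case False
    then have "\<forall>s\<in>insert x F. s \<noteq> t \<longrightarrow> revlex s t" using t revlex_total by (metis insert_iff)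
    then show ?thesis using t by blast
  qed
qed simp

lemma init_eqI:
  assumes "t \<in> supp f" "\<And>s. s \<in> supp f \<Longrightarrow> s \<noteq> t \<Longrightarrow> revlex s t"
  shows "init revlex f = monomial t"
proof -
  have "f \<noteq> 0" using assms(1) by auto
  moreover have "(THE t. t \<in> supp f \<and> (\<forall>s \<in> supp f. s \<noteq> t \<longrightarrow> revlex s t)) = t"
  proof (rule the_equality)
    show "t \<in> supp f \<and> (\<forall>s \<in> supp f. s \<noteq> t \<longrightarrow> revlex s t)"
      using assms by blast
    fix u assume u: "u \<in> supp f \<and> (\<forall>s \<in> supp f. s \<noteq> u \<longrightarrow> revlex s u)"
    show "u = t"
    proof (rule ccontr)
      assume "u \<noteq> t"
      then have "revlex u t" "revlex t u" using assms u by auto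
      then show False using revlex_asym by blast
    qed
  qed
  ultimately show ?thesis by (simp add: init_def)
qed

lemma init_in_keys:
  assumes "f \<noteq> 0"
  shows "\<exists>t\<in>supp f. init revlex f = monomial t"
  using revlex_max_exists[of "supp f"] init_eqI assms by (metis finite_keys keys_eq_empty)

lemma lookup_single_mult:
  fixes f :: "('v, 'k::field) mpoly"
  shows "Poly_Mapping.lookup (Poly_Mapping.single s c * f) (s + t) = c * Poly_Mapping.lookup f t"
proof -
  have "Poly_Mapping.single s c * f =
      (\<Sum>u\<in>supp f. Poly_Mapping.single (s + u) (c * Poly_Mapping.lookup f u))"
  proof -
    have "Poly_Mapping.single s c * f = Poly_Mapping.single s c *
        (\<Sum>u\<in>supp f. Poly_Mapping.single u (Poly_Mapping.lookup f u))"
      using poly_mapping_sum_single[of f] by (rule arg_cong)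
    then show ?thesis by (simp add: sum_distrib_left mult_single)
  qed
  then have "Poly_Mapping.lookup (Poly_Mapping.single s c * f) (s + t) =
      (\<Sum>u\<in>supp f. if u = t then c * Poly_Mapping.lookup f t else 0)"
    by (auto simp: lookup_sum lookup_single when_def intro!: sum.cong)
  then show ?thesis by (simp add: in_keys_iff)
qed

text \<open>
  The leading term is multiplicative because \<open>revlex\<close> is compatible with adding exponents.
\<close>

lemma init_monomial_mult:
  fixes f :: "(nat \<times> nat, 'k::field) mpoly"
  assumes "t \<in> supp f" "\<And>s. s \<in> supp f \<Longrightarrow> s \<noteq> t \<Longrightarrow> revlex s t"
  shows "init revlex (monomial u * f) = monomial (u + t)"
proof (rule init_eqI)
  show "u + t \<in> supp (monomial u * f)"
    using assms(1) by (simp add: in_keys_iff monomial_def lookup_single_mult)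
  fix s assume s: "s \<in> supp (monomial u * f)" "s \<noteq> u + t"
  have "s \<in> {a + b | a b. a \<in> supp (monomial u :: (nat \<times> nat, 'k) mpoly) \<and> b \<in> supp f}"
    using s(1) Poly_Mapping.keys_mult by (rule rev_subsetD)
  then obtain b where "b \<in> supp f" "s = u + b" by (auto simp: monomial_def)
  then show "revlex s (u + t)" using assms(2)[of b] s(2) by (auto intro: revlex_add)
qed

section \<open>Antidiagonals and minors\<close>

text \<open>
  Positions are listed from north-east to south-west by their rows \<open>f\<close> and columns \<open>g\<close>, so that
  antidiagonals can be cut and spliced at an index.
\<close>

definition antidiagonal :: "(nat \<times> nat) set \<Rightarrow> nat \<Rightarrow> nat \<Rightarrow> nat \<Rightarrow> (nat \<Rightarrow> nat) \<Rightarrow> (nat \<Rightarrow> nat) \<Rightarrow> bool" where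
  "antidiagonal S a b k f g \<longleftrightarrow> (\<forall>l<k. f l < a \<and> g l < b \<and> (f l, g l) \<in> S) \<and>
     (\<forall>l<k. \<forall>l'<l. f l' < f l \<and> g l < g l')"

definition has_antidiagonal :: "(nat \<times> nat) set \<Rightarrow> nat \<Rightarrow> nat \<Rightarrow> nat \<Rightarrow> bool" where
  "has_antidiagonal S a b k \<longleftrightarrow> (\<exists>f g. antidiagonal S a b k f g)"

definition antidiag_monom :: "nat \<Rightarrow> (nat \<Rightarrow> nat) \<Rightarrow> (nat \<Rightarrow> nat) \<Rightarrow> (nat \<times> nat) monom" where
  "antidiag_monom k f g = (\<Sum>l<k. Poly_Mapping.single (f l, g l) 1)"

lemma lookup_antidiag_monom:
  assumes "inj_on f {..<k}"
  shows "Poly_Mapping.lookup (antidiag_monom k f g) p = (if \<exists>l<k. p = (f l, g l) then 1 else 0)"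
proof -
  have "Poly_Mapping.lookup (antidiag_monom k f g) p = (\<Sum>l<k. if p = (f l, g l) then 1 else 0)"
    unfolding antidiag_monom_def by (auto simp: lookup_sum lookup_single when_def intro!: sum.cong)
  also have "\<dots> = (if \<exists>l<k. p = (f l, g l) then 1 else 0)"
  proof (cases "\<exists>l<k. p = (f l, g l)")
    case True
    then obtain l0 where l0: "l0 < k" "p = (f l0, g l0)" by blast
    have "p = (f l, g l) \<longleftrightarrow> l = l0" if "l < k" for l
      using that l0 inj_onD[OF assms, of l l0] by auto
    then have "(\<Sum>l<k. if p = (f l, g l) then 1 else 0) = (\<Sum>l<k. if l = l0 then 1 else (0::nat))"
      by (intro sum.cong) auto
    then show ?thesis using l0 True by simp
  qed auto
  finally show ?thesis .
qed

lemma mdeg_antidiag_monom: "mdeg (antidiag_monom k f g) = k"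
proof -
  have "mdeg (Poly_Mapping.single p 1) = 1" for p :: "nat \<times> nat" by (simp add: mdeg_def)
  moreover have "mdeg (0 :: (nat \<times> nat) monom) = 0" by (simp add: mdeg_def)
  ultimately show ?thesis unfolding antidiag_monom_def by (induction k) (auto simp: mdeg_add)
qed

lemma antidiagonal_inj: "antidiagonal S a b k f g \<Longrightarrow> inj_on f {..<k}"
  unfolding antidiagonal_def inj_on_def by (metis lessThan_iff nat_neq_iff)

text \<open>
  Let \<open>i\<close> be the last index moved by \<open>\<pi>\<close>. Then \<open>\<pi> i < i\<close>, so in row \<open>f i\<close> the permuted monomial
  has its variable further to the right than the antidiagonal, while the rows below agree. In the
  reverse lexicographic order this makes the permuted monomial smaller.
\<close>

lemma revlex_permuted:
  assumes ad: "antidiagonal S a b k f g" and \<pi>: "\<pi> permutes {0..<k}" "\<pi> \<noteq> id"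
  shows "revlex (antidiag_monom k f (g \<circ> \<pi>)) (antidiag_monom k f g)"
proof -
  have f: "f l' < f l" and g: "g l < g l'" if "l < k" "l' < l" for l l'
    using ad that by (auto simp: antidiagonal_def)
  note inj = antidiagonal_inj[OF ad]
  let ?D = "{l. \<pi> l \<noteq> l}"
  have sub: "?D \<subseteq> {0..<k}" using \<pi>(1) by (auto simp: permutes_def)
  then have fin: "finite ?D" by (rule finite_subset) simp
  have "?D \<noteq> {}" using \<pi>(2) by (auto simp: fun_eq_iff)
  define i where "i = Max ?D"
  have i: "\<pi> i \<noteq> i" using Max_in[OF fin \<open>?D \<noteq> {}\<close>] by (simp add: i_def)
  then have ik: "i < k" using sub by auto
  have above: "\<pi> l = l" if "l > i" for l
    using Max_ge[OF fin, of l] that unfolding i_def[symmetric] by (metis (mono_tags) linorder_not_le mem_Collect_eq)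
  have "\<pi> i \<le> i"
  proof (rule ccontr)
    assume "\<not> \<pi> i \<le> i"
    then have "\<pi> (\<pi> i) = \<pi> i" using above by simp
    then show False using i permutes_inj[OF \<pi>(1)] by (simp add: inj_eq)
  qed
  then have lt: "\<pi> i < i" using i by simp
  have gi: "g i < g (\<pi> i)" using g[OF ik lt] .
  let ?p = "(f i, g (\<pi> i))"
  have fi: "f l = f i \<longleftrightarrow> l = i" if "l < k" for l
    using that ik inj by (auto simp: inj_on_def)
  have "Poly_Mapping.lookup (antidiag_monom k f (g \<circ> \<pi>)) ?p = 1"
    unfolding lookup_antidiag_monom[OF inj] using ik by auto
  moreover have "Poly_Mapping.lookup (antidiag_monom k f g) ?p = 0"
  proof -
    have "\<not> (\<exists>l<k. ?p = (f l, g l))"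
    proof
      assume "\<exists>l<k. ?p = (f l, g l)"
      then obtain l where l: "l < k" "f l = f i" "g l = g (\<pi> i)" by auto
      then have "l = i" using fi[OF l(1)] by simp
      then show False using l(3) gi by simp
    qed
    then show ?thesis unfolding lookup_antidiag_monom[OF inj] by (simp only: if_False)
  qed
  moreover have "Poly_Mapping.lookup (antidiag_monom k f (g \<circ> \<pi>)) q = Poly_Mapping.lookup (antidiag_monom k f g) q"
    if q: "lex_less ?p q" for q
  proof -
    have "q = (f l, (g \<circ> \<pi>) l) \<longleftrightarrow> q = (f l, g l)" if l: "l < k" for l
    proof (cases l i rule: linorder_cases)
      case less
      then show ?thesis using f[OF ik less] q by (auto simp: lex_less_def)
    next
      case equal
      then show ?thesis using gi q by (auto simp: lex_less_def)
    next
      case greater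
      then show ?thesis using above by simp
    qed
    then show ?thesis unfolding lookup_antidiag_monom[OF inj] by (intro if_cong) auto
  qed
  ultimately show ?thesis by (intro revlexI[of _ _ ?p]) (auto simp: mdeg_antidiag_monom)
qed

lemma monomial_sum: "finite F \<Longrightarrow> (\<Prod>x\<in>F. monomial (h x)) = monomial (sum h F)"
  by (induction F rule: finite_induct) (simp_all add: monomial_def mult_single)

text \<open>
  For decreasing \<open>g\<close> the antidiagonal term of the minor belongs to the identity permutation, so
  its coefficient is one.
\<close>

definition minor :: "nat \<Rightarrow> (nat \<Rightarrow> nat) \<Rightarrow> (nat \<Rightarrow> nat) \<Rightarrow> (nat \<times> nat, 'k::field) mpoly" where
  "minor k f g = det (mat k k (\<lambda>(l, l'). var (f l, g l')))"

lemma minor_expansion: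
  "minor k f g = (\<Sum>\<pi> | \<pi> permutes {0..<k}. Poly_Mapping.single (antidiag_monom k f (g \<circ> \<pi>)) (signof \<pi> :: 'k::field))"
proof -
  have "signof \<pi> * (\<Prod>l = 0..<k. mat k k (\<lambda>(l, l'). var (f l, g l')) $$ (l, \<pi> l))
      = Poly_Mapping.single (antidiag_monom k f (g \<circ> \<pi>)) (signof \<pi> :: 'k)" if \<pi>: "\<pi> permutes {0..<k}" for \<pi>
  proof -
    have "(\<Prod>l = 0..<k. mat k k (\<lambda>(l, l'). var (f l, g l')) $$ (l, \<pi> l))
        = (\<Prod>l<k. monomial (Poly_Mapping.single (f l, g (\<pi> l)) 1) :: (nat \<times> nat, 'k) mpoly)"
      using \<pi> permutes_in_image[OF \<pi>] by (auto simp: var_def atLeast0LessThan intro!: prod.cong)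
    also have "\<dots> = monomial (antidiag_monom k f (g \<circ> \<pi>))"
      unfolding antidiag_monom_def by (simp add: monomial_sum)
    finally show ?thesis by (simp add: monomial_def sign_def single_uminus)
  qed
  then show ?thesis unfolding minor_def by (subst det_def'[of _ k]) (auto intro!: sum.cong)
qed

lemma keys_minor: "supp (minor k f g :: (nat \<times> nat, 'k::field) mpoly) \<subseteq> {antidiag_monom k f (g \<circ> \<pi>) | \<pi>. \<pi> permutes {0..<k}}"
proof
  fix s assume "s \<in> supp (minor k f g :: (nat \<times> nat, 'k) mpoly)"
  then have "(\<Sum>\<pi> | \<pi> permutes {0..<k}. Poly_Mapping.lookup
      (Poly_Mapping.single (antidiag_monom k f (g \<circ> \<pi>)) (signof \<pi> :: 'k)) s) \<noteq> 0"
    by (simp add: minor_expansion in_keys_iff lookup_sum)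
  then obtain \<pi> where "\<pi> \<in> {\<pi>. \<pi> permutes {0..<k}}"
    "Poly_Mapping.lookup (Poly_Mapping.single (antidiag_monom k f (g \<circ> \<pi>)) (signof \<pi> :: 'k)) s \<noteq> 0"
    by (rule sum.not_neutral_contains_not_neutral)
  then have "\<pi> permutes {0..<k}" "s = antidiag_monom k f (g \<circ> \<pi>)"
    by (simp_all add: lookup_single when_def split: if_splits)
  then show "s \<in> {antidiag_monom k f (g \<circ> \<pi>) | \<pi>. \<pi> permutes {0..<k}}" by blast
qed

lemma minor_leading:
  assumes ad: "antidiagonal S a b k f g"
  shows "antidiag_monom k f g \<in> supp (minor k f g :: (nat \<times> nat, 'k::field) mpoly)"
    and "s \<in> supp (minor k f g :: (nat \<times> nat, 'k) mpoly) \<Longrightarrow> s \<noteq> antidiag_monom k f g \<Longrightarrow>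
      revlex s (antidiag_monom k f g)"
proof -
  have ne: "antidiag_monom k f (g \<circ> \<pi>) = antidiag_monom k f g \<longleftrightarrow> \<pi> = id" if "\<pi> permutes {0..<k}" for \<pi>
    using revlex_permuted[OF ad that] revlex_asym by (metis comp_id)
  have "Poly_Mapping.lookup (minor k f g :: (nat \<times> nat, 'k) mpoly) (antidiag_monom k f g) =
      (\<Sum>\<pi> | \<pi> permutes {0..<k}. if \<pi> = id then 1 else 0)"
    unfolding minor_expansion lookup_sum
    by (rule sum.cong) (auto simp: lookup_single when_def ne sign_id)
  also have "\<dots> = 1" by (simp add: finite_permutations permutes_id)
  finally show "antidiag_monom k f g \<in> supp (minor k f g :: (nat \<times> nat, 'k) mpoly)"
    by (simp add: in_keys_iff)
  show "s \<in> supp (minor k f g :: (nat \<times> nat, 'k) mpoly) \<Longrightarrow> s \<noteq> antidiag_monom k f g \<Longrightarrow>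
      revlex s (antidiag_monom k f g)"
    using keys_minor[of k f g] revlex_permuted[OF ad] by fastforce
qed

lemma det_in_carrier:
  assumes A: "A \<in> carrier_mat k k" and c: "\<And>l l'. l < k \<Longrightarrow> l' < k \<Longrightarrow> A $$ (l, l') \<in> carrier (mpoly_ring V)"
  shows "det A \<in> carrier (mpoly_ring V)"
  unfolding det_def'[OF A]
proof (intro carrier_sum carrier_mult carrier_prod)
  fix \<pi> l assume "\<pi> \<in> {\<pi>. \<pi> permutes {0..<k}}" "l \<in> {0..<k}"
  then show "A $$ (l, \<pi> l) \<in> carrier (mpoly_ring V)"
    using permutes_in_image[of \<pi> "{0..<k}" l] by (intro c) auto
next
  fix \<pi> show "signof \<pi> \<in> carrier (mpoly_ring V)" by (simp add: sign_def)
qed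

lemma var_in_carrier: "v \<in> V \<Longrightarrow> var v \<in> carrier (mpoly_ring V)"
  by (simp add: var_def monomial_def carrier_single)

lemma const_in_carrier: "const c \<in> carrier (mpoly_ring V)"
  by (simp add: const_def carrier_single)

lemma eval_det:
  assumes "A \<in> carrier_mat k k"
  shows "eval a (det A) = det (map_mat (eval a) A)"
  using comm_ring_hom.hom_det[OF eval_hom] by metis

lemma eval_minor: "eval (\<lambda>p. M $$ p) (minor k f g) = det (mat k k (\<lambda>(l, l'). M $$ (f l, g l')))"
proof -
  have "map_mat (eval (\<lambda>p. M $$ p)) (mat k k (\<lambda>(l, l'). var (f l, g l'))) = mat k k (\<lambda>(l, l'). M $$ (f l, g l'))"
    by (rule eq_matI) auto
  then show ?thesis unfolding minor_def by (subst eval_det[of _ k]) auto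
qed

lemma det_zero_of_rank_less:
  fixes A :: "'a::field mat"
  assumes "A \<in> carrier_mat k k" "vec_space.rank k A < k"
  shows "det A = 0"
  using vec_space.low_rank_det_zero[OF assms(1)] assms(2) by auto

text \<open>
  A submatrix of the corner has at most the rank of the corner, which is too small for its size.
\<close>

lemma det_reindex_vanishes_on_MSV:
  assumes M: "M \<in> MSV m n w" and ij: "i \<in> {1..m}" "j \<in> {1..n}"
    and fg: "\<And>l. l < k \<Longrightarrow> f l < i" "\<And>l. l < k \<Longrightarrow> g l < j" and k: "k > corner_rank w i j"
  shows "det (mat k k (\<lambda>(l, l'). M $$ (f l, g l'))) = 0"
proof (rule det_zero_of_rank_less)
  have Mc: "M \<in> carrier_mat m n" and r: "corner_rank M i j \<le> corner_rank w i j"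
    using M ij by (auto simp: MSV_def)
  have "mat k k (\<lambda>(l, l'). M $$ (f l, g l')) = mat k k (\<lambda>(l, l'). corner i j M $$ (f l, g l'))"
    by (rule cong_mat) (use fg in auto)
  moreover have "vec_space.rank k (mat k k (\<lambda>(l, l'). corner i j M $$ (f l, g l'))) \<le> vec_space.rank i (corner i j M)"
    by (rule rank_reindex[of _ i j]) (use fg in auto)
  moreover have "vec_space.rank i (corner i j M) = corner_rank M i j"
    using corner_rank_eq[OF Mc, of i j] ij by simp
  ultimately show "vec_space.rank k (mat k k (\<lambda>(l, l'). M $$ (f l, g l'))) < k" using r k by simp
qed simp

lemma vanishing_ideal_ideal: "ideal (vanishing_ideal m n A) (mpoly_ring (mat_vars m n))"
  by (auto simp: ideal_mpoly_ring_iff vanishing_ideal_def eval_add eval_mult)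

lemma minor_in_vanishing_ideal:
  fixes w :: "'k::field mat"
  assumes ij: "i \<in> {1..m}" "j \<in> {1..n}" and ad: "antidiagonal S i j (Suc (corner_rank w i j)) f g"
  shows "minor (Suc (corner_rank w i j)) f g \<in> vanishing_ideal m n (MSV m n w)"
proof -
  have fg: "f l < i" "g l < j" if "l < Suc (corner_rank w i j)" for l using ad that by (auto simp: antidiagonal_def)
  have "minor (Suc (corner_rank w i j)) f g \<in> carrier (mpoly_ring (mat_vars m n) :: (nat \<times> nat, 'k) mpoly ring)"
    unfolding minor_def
    by (rule det_in_carrier) (use fg ij in \<open>fastforce intro: var_in_carrier simp: mat_vars_def\<close>)+
  moreover have "eval (\<lambda>p. M $$ p) (minor (Suc (corner_rank w i j)) f g) = 0" if "M \<in> MSV m n w" for M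
    unfolding eval_minor by (rule det_reindex_vanishes_on_MSV[OF that ij]) (use fg in auto)
  ultimately show ?thesis by (simp add: vanishing_ideal_def)
qed

section \<open>The antidiagonal ideal of a matrix\<close>

lemma pick_image:
  assumes "\<And>l l'. l < k \<Longrightarrow> l' < l \<Longrightarrow> f l' < f l" "l < k"
  shows "pick (f ` {..<k}) l = f l"
proof -
  have lt: "f l' < f l \<longleftrightarrow> l' < l" if "l' < k" for l'
    using assms(1)[of l l'] assms(1)[of l' l] assms(2) that by (cases l' l rule: linorder_cases) auto
  then have "{a \<in> f ` {..<k}. a < f l} = f ` {..<l}" using assms(2) by force
  moreover have "inj_on f {..<l}"
  proof (rule inj_onI)
    fix x y assume "x \<in> {..<l}" "y \<in> {..<l}" "f x = f y"
    then show "x = y" using assms(1)[of x y] assms(1)[of y x] assms(2)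
      by (cases x y rule: linorder_cases) auto
  qed
  ultimately have "card {a \<in> f ` {..<k}. a < f l} = l" by (simp add: card_image)
  then show ?thesis using pick_card_in_set[of "f l" "f ` {..<k}"] assms(2) by simp
qed

lemma adiag_submatrix:
  assumes "R \<subseteq> {0..<i}" "C \<subseteq> {0..<j}" "i \<le> m" "j \<le> n" "card R = k" "card C = k"
  shows "adiag (submatrix (generic_mat m n) R C :: (nat \<times> nat, 'k::field) mpoly mat) =
    monomial (antidiag_monom k (pick R) (\<lambda>l. pick C (k - 1 - l)))"
proof -
  let ?G = "generic_mat m n :: (nat \<times> nat, 'k) mpoly mat"
  have G: "dim_row ?G = m" "dim_col ?G = n" by (simp_all add: generic_mat_def)
  have "{a. a < m \<and> a \<in> R} = R" "{a. a < n \<and> a \<in> C} = C" using assms by auto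
  then have cR: "card {a. a < dim_row ?G \<and> a \<in> R} = k" and cC: "card {a. a < dim_col ?G \<and> a \<in> C} = k"
    using assms G by auto
  have "submatrix ?G R C $$ (l, l') = monomial (Poly_Mapping.single (pick R l, pick C l') 1)" if "l < k" "l' < k" for l l'
  proof -
    have "pick R l < m" "pick C l' < n"
      using pick_le[of l m R] pick_le[of l' n C] cR cC that G by auto
    moreover have "submatrix ?G R C $$ (l, l') = ?G $$ (pick R l, pick C l')"
      by (rule submatrix_index) (use that cR cC in auto)
    ultimately show ?thesis by (simp add: generic_mat_def var_def)
  qed
  then have "(\<Prod>l<k. submatrix ?G R C $$ (l, k - 1 - l)) =
      (\<Prod>l<k. monomial (Poly_Mapping.single (pick R l, pick C (k - 1 - l)) 1))"
    by (intro prod.cong) auto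
  moreover have "dim_row (submatrix ?G R C) = k" using cR by (simp add: dim_submatrix)
  ultimately show ?thesis unfolding adiag_def antidiag_monom_def by (simp add: monomial_sum)
qed

lemma antidiagonal_pick:
  assumes "R \<subseteq> {0..<i}" "C \<subseteq> {0..<j}" "card R = k" "card C = k"
  shows "antidiagonal UNIV i j k (pick R) (\<lambda>l. pick C (k - 1 - l))"
proof -
  have R: "pick R l < i" if "l < k" for l
    using subsetD[OF assms(1) pick_in_set[of l R]] that assms(3) by simp
  have C: "pick C l < j" if "l < k" for l
    using subsetD[OF assms(2) pick_in_set[of l C]] that assms(4) by simp
  have "pick C (k - 1 - l) < j" if "l < k" for l using that by (intro C) simp
  moreover have "pick R l' < pick R l" "pick C (k - 1 - l) < pick C (k - 1 - l')" if "l < k" "l' < l" for l l'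
    using pick_mono[of l R l'] pick_mono[of "k - 1 - l'" C "k - 1 - l"] assms that by auto
  ultimately show ?thesis using R by (simp add: antidiagonal_def)
qed

definition J_monoms :: "nat \<Rightarrow> nat \<Rightarrow> 'k::field mat \<Rightarrow> (nat \<times> nat) monom set" where
  "J_monoms m n w = {antidiag_monom (Suc (corner_rank w i j)) f g | i j f g.
     i \<in> {1..m} \<and> j \<in> {1..n} \<and> antidiagonal UNIV i j (Suc (corner_rank w i j)) f g}"

text \<open>
  Row and column sets of equal size correspond to increasing \<open>f\<close> and decreasing \<open>g\<close>: \<open>pick\<close>
  enumerates a set increasingly, and the columns have to be read backwards.
\<close>

lemma J_generators:
  "{adiag (submatrix (generic_mat m n) R C) | R C i j.
        i \<in> {1..m} \<and> j \<in> {1..n} \<and> R \<subseteq> {0..<i} \<and> C \<subseteq> {0..<j} \<and>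
        card R = 1 + corner_rank w i j \<and> card C = 1 + corner_rank w i j} =
   (monomial ` J_monoms m n w :: (nat \<times> nat, 'k::field) mpoly set)" (is "?L = ?R")
proof
  show "?L \<subseteq> ?R"
  proof
    fix x assume "x \<in> ?L"
    then obtain R C i j where ij: "i \<in> {1..m}" "j \<in> {1..n}" and RC: "R \<subseteq> {0..<i}" "C \<subseteq> {0..<j}"
      and c: "card R = Suc (corner_rank w i j)" "card C = Suc (corner_rank w i j)"
      and x: "x = adiag (submatrix (generic_mat m n) R C)" by auto
    have "x = monomial (antidiag_monom (Suc (corner_rank w i j)) (pick R) (\<lambda>l. pick C (Suc (corner_rank w i j) - 1 - l)))"
      unfolding x by (rule adiag_submatrix[OF RC _ _ c]) (use ij in auto)
    moreover have "antidiagonal UNIV i j (Suc (corner_rank w i j)) (pick R) (\<lambda>l. pick C (Suc (corner_rank w i j) - 1 - l))"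
      by (rule antidiagonal_pick[OF RC c])
    ultimately show "x \<in> ?R" using ij unfolding J_monoms_def by blast
  qed
  show "?R \<subseteq> ?L"
  proof
    fix x :: "(nat \<times> nat, 'k) mpoly" assume "x \<in> ?R"
    then obtain i j f g where ij: "i \<in> {1..m}" "j \<in> {1..n}"
      and ad: "antidiagonal UNIV i j (Suc (corner_rank w i j)) f g"
      and x: "x = monomial (antidiag_monom (Suc (corner_rank w i j)) f g)" by (auto simp: J_monoms_def)
    define k where "k = Suc (corner_rank w i j)"
    define h where "h = (\<lambda>l. g (k - 1 - l))"
    have f: "f l < i" "g l < j" if "l < k" for l using ad that by (auto simp: antidiagonal_def k_def)
    have mono: "f l' < f l" "g l < g l'" if "l < k" "l' < l" for l l'
      using ad that by (auto simp: antidiagonal_def k_def)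
    have hmono: "h l' < h l" if "l < k" "l' < l" for l l'
      unfolding h_def using that by (intro mono) auto
    let ?R = "f ` {..<k}" and ?C = "h ` {..<k}"
    have injf: "inj_on f {..<k}" using antidiagonal_inj[OF ad] by (simp add: k_def)
    have injh: "inj_on h {..<k}"
    proof (rule inj_onI)
      fix x y assume "x \<in> {..<k}" "y \<in> {..<k}" "h x = h y"
      then show "x = y" using hmono[of x y] hmono[of y x] by (cases x y rule: linorder_cases) auto
    qed
    have RC: "?R \<subseteq> {0..<i}" "?C \<subseteq> {0..<j}" using f by (auto simp: h_def)
    have card: "card ?R = k" "card ?C = k" using injf injh by (auto simp: card_image)
    have "adiag (submatrix (generic_mat m n) ?R ?C :: (nat \<times> nat, 'k) mpoly mat) =
        monomial (antidiag_monom k (pick ?R) (\<lambda>l. pick ?C (k - 1 - l)))"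
      by (rule adiag_submatrix[OF RC _ _ card]) (use ij in auto)
    also have "antidiag_monom k (pick ?R) (\<lambda>l. pick ?C (k - 1 - l)) = antidiag_monom k f g"
      unfolding antidiag_monom_def
    proof (rule sum.cong)
      fix l assume "l \<in> {..<k}"
      then have l: "l < k" by simp
      have "pick ?R l = f l" by (rule pick_image[OF mono(1) l])
      moreover have "pick ?C (k - 1 - l) = h (k - 1 - l)" by (rule pick_image[OF hmono]) (use l in auto)
      moreover have "h (k - 1 - l) = g l" using l by (simp add: h_def)
      ultimately show "Poly_Mapping.single (pick ?R l, pick ?C (k - 1 - l)) (1::nat) = Poly_Mapping.single (f l, g l) 1"
        by simp
    qed simp
    finally have "x = adiag (submatrix (generic_mat m n) ?R ?C)" unfolding x k_def by simp
    then show "x \<in> ?L" using ij RC card unfolding k_def by auto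
  qed
qed

lemma keys_antidiag_monom:
  "inj_on f {..<k} \<Longrightarrow> supp (antidiag_monom k f g) = (\<lambda>l. (f l, g l)) ` {..<k}"
  by (auto simp: in_keys_iff lookup_antidiag_monom split: if_splits)

text \<open>
  The antidiagonal monomial is squarefree, so divisibility is containment of supports.
\<close>

lemma antidiag_monom_dvd_iff:
  assumes "inj_on f {..<k}"
  shows "(\<exists>s. t = antidiag_monom k f g + s) \<longleftrightarrow> (\<forall>l<k. (f l, g l) \<in> supp t)"
proof
  assume "\<exists>s. t = antidiag_monom k f g + s"
  then show "\<forall>l<k. (f l, g l) \<in> supp t"
    using keys_antidiag_monom[OF assms, of g] by (auto simp: keys_add_monom)
next
  assume *: "\<forall>l<k. (f l, g l) \<in> supp t"
  have "t = antidiag_monom k f g + (t - antidiag_monom k f g)"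
  proof (rule poly_mapping_eqI)
    fix p
    have "Poly_Mapping.lookup (antidiag_monom k f g) p \<le> Poly_Mapping.lookup t p"
      unfolding lookup_antidiag_monom[OF assms] using * by (auto simp: in_keys_iff Suc_le_eq)
    then show "Poly_Mapping.lookup t p = Poly_Mapping.lookup (antidiag_monom k f g + (t - antidiag_monom k f g)) p"
      by (simp add: lookup_add lookup_minus)
  qed
  then show "\<exists>s. t = antidiag_monom k f g + s" by blast
qed

lemma J_monoms_dvd_iff:
  "(\<exists>a\<in>J_monoms m n w. \<exists>s. t = a + s) \<longleftrightarrow>
   (\<exists>i\<in>{1..m}. \<exists>j\<in>{1..n}. has_antidiagonal (supp t) i j (Suc (corner_rank w i j)))" (is "?L \<longleftrightarrow> ?R")
proof
  assume ?L
  then obtain i j f g s where ij: "i \<in> {1..m}" "j \<in> {1..n}"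
    and ad: "antidiagonal UNIV i j (Suc (corner_rank w i j)) f g"
    and t: "t = antidiag_monom (Suc (corner_rank w i j)) f g + s" by (auto simp: J_monoms_def)
  have "\<forall>l<Suc (corner_rank w i j). (f l, g l) \<in> supp t"
    using antidiag_monom_dvd_iff[OF antidiagonal_inj[OF ad]] t by blast
  then have "antidiagonal (supp t) i j (Suc (corner_rank w i j)) f g"
    using ad by (simp add: antidiagonal_def)
  then show ?R using ij unfolding has_antidiagonal_def by blast
next
  assume ?R
  then obtain i j f g where ij: "i \<in> {1..m}" "j \<in> {1..n}"
    and ad: "antidiagonal (supp t) i j (Suc (corner_rank w i j)) f g"
    by (auto simp: has_antidiagonal_def)
  have "\<forall>l<Suc (corner_rank w i j). (f l, g l) \<in> supp t" using ad by (simp add: antidiagonal_def)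
  then obtain s where "t = antidiag_monom (Suc (corner_rank w i j)) f g + s"
    using antidiag_monom_dvd_iff[OF antidiagonal_inj[OF ad]] by blast
  moreover have "antidiagonal UNIV i j (Suc (corner_rank w i j)) f g"
    using ad by (simp add: antidiagonal_def)
  ultimately show ?L using ij unfolding J_monoms_def by blast
qed

lemma J_monoms_keys:
  assumes "a \<in> J_monoms m n w"
  shows "supp a \<subseteq> mat_vars m n"
proof -
  obtain i j f g where ij: "i \<in> {1..m}" "j \<in> {1..n}"
    and ad: "antidiagonal UNIV i j (Suc (corner_rank w i j)) f g"
    and a: "a = antidiag_monom (Suc (corner_rank w i j)) f g" using assms by (auto simp: J_monoms_def)
  have "f l < i \<and> g l < j" if "l < Suc (corner_rank w i j)" for l using ad that by (simp add: antidiagonal_def)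
  then have "(f l, g l) \<in> mat_vars m n" if "l < Suc (corner_rank w i j)" for l
    using that ij by (fastforce simp: mat_vars_def)
  then show ?thesis unfolding a keys_antidiag_monom[OF antidiagonal_inj[OF ad]] by auto
qed

lemma J_ideal_eq: "J_ideal m n w = genideal (mpoly_ring (mat_vars m n)) (monomial ` J_monoms m n w)"
  unfolding J_ideal_def J_generators ..

lemma J_ideal_eq_divisible:
  fixes w :: "'k::field mat"
  shows "J_ideal m n w = {p \<in> carrier (mpoly_ring (mat_vars m n)).
    \<forall>t \<in> supp p. \<exists>a\<in>J_monoms m n w. \<exists>s. t = a + s}"
  unfolding J_ideal_eq by (rule genideal_monomials) (rule J_monoms_keys)

text \<open>
  Membership depends only on the supports of the occurring monomials.
\<close>

lemma mem_J_ideal_iff: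
  "p \<in> J_ideal m n w \<longleftrightarrow> p \<in> carrier (mpoly_ring (mat_vars m n)) \<and>
    (\<forall>t\<in>supp p. \<exists>i\<in>{1..m}. \<exists>j\<in>{1..n}.
      has_antidiagonal (supp t) i j (Suc (corner_rank w i j)))"
  unfolding J_ideal_eq_divisible J_monoms_dvd_iff by blast

lemma J_ideal_ideal: "ideal (J_ideal m n w) (mpoly_ring (mat_vars m n))"
  unfolding J_ideal_eq
  by (rule ring.genideal_ideal[OF mpoly_ring_ring])
     (auto simp: monomial_def intro: carrier_single subsetD[OF J_monoms_keys])

lemma monomial_ideal_J_ideal: "monomial_ideal (mat_vars m n) (J_ideal m n w)"
  unfolding monomial_ideal_def J_ideal_eq using J_monoms_keys by blast

text \<open>
  This makes the library facts on linear spans available for \<open>kspan\<close>.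
\<close>

lemma kspan_module: "Modules.module (\<lambda>c p. const c * p :: ('v, 'k::field) mpoly)"
proof
  fix a b :: 'k and x y :: "('v, 'k) mpoly"
  show "const a * (x + y) = const a * x + const a * y" by (simp add: distrib_left)
  show "const (a + b) * x = const a * x + const b * x" by (simp add: const_def single_add distrib_right)
  show "const a * (const b * x) = const (a * b) * x" by (simp add: const_def mult_single mult.assoc[symmetric])
  show "const 1 * x = x" by (simp add: const_def)
qed

text \<open>
  A monomial of \<open>J\<close> is a monomial times an antidiagonal, hence the initial term of that monomial
  times a minor; and the minor vanishes on the variety.
\<close>

lemma J_subset_init_ideal:
  fixes w :: "'k::field mat"
  shows "J_ideal m n w \<subseteq> init_ideal revlex (vanishing_ideal m n (MSV m n w))"
proof
  interpret K: Modules.module "\<lambda>c p. const c * p :: (nat \<times> nat, 'k) mpoly" by (rule kspan_module)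
  let ?I = "vanishing_ideal m n (MSV m n w)"
  fix p assume p: "p \<in> J_ideal m n w"
  have "Poly_Mapping.single t (Poly_Mapping.lookup p t) \<in> kspan (init revlex ` ?I)" if t: "t \<in> supp p" for t
  proof -
    obtain a s where "a \<in> J_monoms m n w" and ts: "t = a + s"
      using p t unfolding J_ideal_eq_divisible by blast
    then obtain i j f g where ij: "i \<in> {1..m}" "j \<in> {1..n}"
      and ad: "antidiagonal UNIV i j (Suc (corner_rank w i j)) f g"
      and a: "a = antidiag_monom (Suc (corner_rank w i j)) f g" by (auto simp: J_monoms_def)
    let ?m = "minor (Suc (corner_rank w i j)) f g :: (nat \<times> nat, 'k) mpoly"
    have "init revlex (monomial s * ?m) = monomial (s + a)"
      unfolding a by (rule init_monomial_mult) (use minor_leading[OF ad] in blast)+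
    moreover have "monomial s * ?m \<in> ?I"
    proof -
      have "supp t \<subseteq> mat_vars m n" using p t by (auto simp: mem_J_ideal_iff carrier_mpoly_ring)
      then have "(monomial s :: (nat \<times> nat, 'k) mpoly) \<in> carrier (mpoly_ring (mat_vars m n))"
        unfolding monomial_def by (intro carrier_single) (simp add: ts keys_add_monom)
      then show ?thesis
        using minor_in_vanishing_ideal[OF ij ad] vanishing_ideal_ideal[of m n "MSV m n w"]
        unfolding ideal_mpoly_ring_iff by simp
    qed
    ultimately have "monomial t \<in> init revlex ` ?I" unfolding ts by (metis add.commute image_eqI)
    then have "const (Poly_Mapping.lookup p t) * monomial t \<in> kspan (init revlex ` ?I)"
      unfolding kspan_def by (intro K.span_scale K.span_base)
    then show ?thesis by (simp add: const_def monomial_def mult_single)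
  qed
  then have "(\<Sum>t\<in>supp p. Poly_Mapping.single t (Poly_Mapping.lookup p t)) \<in> kspan (init revlex ` ?I)"
    unfolding kspan_def by (intro K.span_sum)
  then show "p \<in> init_ideal revlex ?I"
    unfolding init_ideal_def by (subst poly_mapping_sum_single)
qed

section \<open>Antidiagonal lengths as corner ranks\<close>

lemma has_antidiagonal_0 [simp]: "has_antidiagonal S a b 0"
  by (simp add: has_antidiagonal_def antidiagonal_def)

lemma has_antidiagonal_mono:
  assumes "has_antidiagonal S a b k" "k' \<le> k" "a \<le> a'" "b \<le> b'"
  shows "has_antidiagonal S a' b' k'"
proof -
  obtain f g where fg: "antidiagonal S a b k f g" using assms(1) by (auto simp: has_antidiagonal_def)
  have "antidiagonal S a' b' k' f g"
    unfolding antidiagonal_def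
  proof (intro conjI allI impI)
    fix l assume "l < k'"
    then have "l < k" using assms(2) by simp
    then show "f l < a'" "g l < b'" "(f l, g l) \<in> S" using fg assms(3,4) by (auto simp: antidiagonal_def)
    fix l' assume "l' < l"
    then show "f l' < f l" "g l < g l'" using fg \<open>l < k\<close> by (auto simp: antidiagonal_def)
  qed
  then show ?thesis by (auto simp: has_antidiagonal_def)
qed

lemma has_antidiagonal_bound: "has_antidiagonal S a b k \<Longrightarrow> k \<le> a \<and> k \<le> b"
proof -
  assume "has_antidiagonal S a b k"
  then obtain f g where fg: "antidiagonal S a b k f g" by (auto simp: has_antidiagonal_def)
  have "card {..<k} \<le> card {..<a}"
    by (rule card_inj_on_le[OF antidiagonal_inj[OF fg]]) (use fg in \<open>auto simp: antidiagonal_def\<close>)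
  moreover have "inj_on g {..<k}"
  proof (rule inj_onI)
    have m: "g l < g l'" if "l < k" "l' < l" for l l' using fg that by (auto simp: antidiagonal_def)
    fix x y assume "x \<in> {..<k}" "y \<in> {..<k}" "g x = g y"
    then show "x = y" using m[of x y] m[of y x] by (cases x y rule: linorder_cases) auto
  qed
  then have "card {..<k} \<le> card {..<b}"
    by (rule card_inj_on_le) (use fg in \<open>auto simp: antidiagonal_def\<close>)
  ultimately show ?thesis by simp
qed

definition antidiag_rank :: "(nat \<times> nat) set \<Rightarrow> nat \<Rightarrow> nat \<Rightarrow> nat" where
  "antidiag_rank S a b = Max {k. has_antidiagonal S a b k}"

lemma has_antidiagonal_iff: "has_antidiagonal S a b k \<longleftrightarrow> k \<le> antidiag_rank S a b"
proof -
  let ?K = "{k. has_antidiagonal S a b k}"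
  have fin: "finite ?K" by (rule finite_subset[of _ "{..a}"]) (use has_antidiagonal_bound in auto)
  have "?K \<noteq> {}" using has_antidiagonal_0 by blast
  then have "antidiag_rank S a b \<in> ?K" unfolding antidiag_rank_def using fin by (rule Max_in[rotated])
  then show ?thesis using has_antidiagonal_mono[of S a b "antidiag_rank S a b" k a b] Max_ge[OF fin, of k]
    by (auto simp: antidiag_rank_def)
qed

text \<open>
  Only the last position of an antidiagonal can lie in the last row.
\<close>

lemma antidiagonal_drop_row:
  assumes "has_antidiagonal S (Suc a) b (Suc k)"
  shows "has_antidiagonal S a b k"
proof -
  obtain f g where fg: "antidiagonal S (Suc a) b (Suc k) f g" using assms by (auto simp: has_antidiagonal_def)
  have "f l < a" if "l < k" for l
  proof -
    have "f l < f k" "f k < Suc a" using fg that by (auto simp: antidiagonal_def)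
    then show ?thesis by simp
  qed
  then have "antidiagonal S a b k f g" using fg by (simp add: antidiagonal_def)
  then show ?thesis by (auto simp: has_antidiagonal_def)
qed

text \<open>
  Only the first position of an antidiagonal can lie in the last column.
\<close>

lemma antidiagonal_drop_col:
  assumes "has_antidiagonal S a (Suc b) (Suc k)"
  shows "has_antidiagonal S a b k"
proof -
  obtain f g where fg: "antidiagonal S a (Suc b) (Suc k) f g" using assms by (auto simp: has_antidiagonal_def)
  have "g (Suc l) < b" if "l < k" for l
  proof -
    have "g (Suc l) < g 0" "g 0 < Suc b" using fg that by (auto simp: antidiagonal_def)
    then show ?thesis by simp
  qed
  then have "antidiagonal S a b k (f \<circ> Suc) (g \<circ> Suc)" using fg by (simp add: antidiagonal_def)
  then show ?thesis by (auto simp: has_antidiagonal_def)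
qed

text \<open>
  The positions up to index \<open>p\<close> of one antidiagonal are continued by the positions from index \<open>q\<close>
  on of another one.
\<close>

lemma antidiagonal_splice:
  assumes fg: "antidiagonal S a1 b1 k f g" and fg': "antidiagonal S a2 b2 k' f' g'"
    and p: "p < k" and q: "q < k'" and pq: "f p < f' q" "g' q < g p"
    and box: "\<And>l. l \<le> p \<Longrightarrow> f l < a \<and> g l < b" "\<And>l. q \<le> l \<Longrightarrow> l < k' \<Longrightarrow> f' l < a \<and> g' l < b"
  shows "has_antidiagonal S a b (Suc p + (k' - q))"
proof -
  define F where "F = (\<lambda>l. if l \<le> p then f l else f' (q + (l - Suc p)))"
  define G where "G = (\<lambda>l. if l \<le> p then g l else g' (q + (l - Suc p)))"
  have f: "f l' < f l" "g l < g l'" if "l < k" "l' < l" for l l' using fg that by (auto simp: antidiagonal_def)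
  have f': "f' l' < f' l" "g' l < g' l'" if "l < k'" "l' < l" for l l' using fg' that by (auto simp: antidiagonal_def)
  have "antidiagonal S a b (Suc p + (k' - q)) F G"
    unfolding antidiagonal_def
  proof (intro conjI allI impI)
    fix l assume l: "l < Suc p + (k' - q)"
    have l2: "q + (l - Suc p) < k'" if "\<not> l \<le> p" using l q that by linarith
    show "F l < a" "G l < b" using box(1)[of l] box(2)[of "q + (l - Suc p)"] l2 by (auto simp: F_def G_def)
    show "(F l, G l) \<in> S" using fg fg' p l2 by (auto simp: antidiagonal_def F_def G_def)
    fix l' assume l': "l' < l"
    consider "l \<le> p" | "l' \<le> p" "p < l" | "p < l'" using l' by linarith
    then have "F l' < F l \<and> G l < G l'"
    proof cases
      case 1
      then show ?thesis using f[of l l'] p l' by (simp add: F_def G_def)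
    next
      case 2
      have "f l' \<le> f p \<and> g p \<le> g l'" using f[of p l'] p 2(1) by (cases "l' = p") auto
      moreover have "f' q \<le> f' (q + (l - Suc p)) \<and> g' (q + (l - Suc p)) \<le> g' q"
      proof (cases "l = Suc p")
        case False
        then have "q < q + (l - Suc p)" using 2(2) by linarith
        moreover have "q + (l - Suc p) < k'" using l2 2(2) by simp
        ultimately show ?thesis using f'[of "q + (l - Suc p)" q] by linarith
      qed simp
      ultimately have "f l' < f' (q + (l - Suc p)) \<and> g' (q + (l - Suc p)) < g l'" using pq by linarith
      then show ?thesis using 2 by (simp add: F_def G_def)
    next
      case 3
      have "q + (l' - Suc p) < q + (l - Suc p)" using 3 l' by simp
      then show ?thesis using f'[of "q + (l - Suc p)" "q + (l' - Suc p)"] l2 3 l' by (simp add: F_def G_def)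
    qed
    then show "F l' < F l" "G l < G l'" by auto
  qed
  then show ?thesis by (auto simp: has_antidiagonal_def)
qed

text \<open>
  This is the key step towards supermodularity of the maximal lengths. Let \<open>A\<close> and \<open>B\<close> be the
  antidiagonals in the \<open>a \<times> (b + 1)\<close> and the \<open>(a + 1) \<times> b\<close> corner. As the \<open>a \<times> b\<close> corner has none of
  this length, \<open>A\<close> starts in column \<open>b\<close> and \<open>B\<close> ends in row \<open>a\<close>. If at some index \<open>A\<close> is strictly
  north-east of \<open>B\<close>, then the beginning of \<open>A\<close> up to this index followed by \<open>B\<close> from this index on
  is one position longer. If position \<open>k\<close> of \<open>B\<close> is strictly north-east of position \<open>k + 1\<close> of
  \<open>A\<close>, then splicing there gives an excluded antidiagonal of the \<open>a \<times> b\<close> corner. If neither ever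
  happens, then by induction \<open>A\<close> stays weakly below \<open>B\<close>, although \<open>B\<close> ends in the last row.
\<close>

lemma antidiagonal_exchange:
  assumes A: "has_antidiagonal S a (Suc b) (Suc c)" and B: "has_antidiagonal S (Suc a) b (Suc c)"
    and no: "\<not> has_antidiagonal S a b (Suc c)"
  shows "has_antidiagonal S (Suc a) (Suc b) (Suc (Suc c))"
proof (rule ccontr)
  assume no2: "\<not> has_antidiagonal S (Suc a) (Suc b) (Suc (Suc c))"
  obtain f g where fg: "antidiagonal S a (Suc b) (Suc c) f g" using A by (auto simp: has_antidiagonal_def)
  obtain f' g' where fg': "antidiagonal S (Suc a) b (Suc c) f' g'" using B by (auto simp: has_antidiagonal_def)
  have f: "f l < a" "g l < Suc b" if "l \<le> c" for l using fg that by (auto simp: antidiagonal_def)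
  have f': "f' l < Suc a" "g' l < b" if "l \<le> c" for l using fg' that by (auto simp: antidiagonal_def)
  have m: "f l' < f l" "g l < g l'" if "l \<le> c" "l' < l" for l l' using fg that by (auto simp: antidiagonal_def)
  have m': "f' l' < f' l" "g' l < g' l'" if "l \<le> c" "l' < l" for l l' using fg' that by (auto simp: antidiagonal_def)
  have g0: "g 0 = b"
  proof (rule ccontr)
    assume "g 0 \<noteq> b"
    then have "g 0 < b" using f(2)[of 0] by simp
    then have "g l < b" if "l \<le> c" for l using m(2)[of l 0] that by (cases "l = 0") auto
    then have "antidiagonal S a b (Suc c) f g" using fg by (simp add: antidiagonal_def)
    then show False using no by (auto simp: has_antidiagonal_def)
  qed
  have fc: "f' c = a"
  proof (rule ccontr)
    assume "f' c \<noteq> a"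
    then have "f' c < a" using f'(1)[of c] by simp
    then have "f' l < a" if "l \<le> c" for l using m'(1)[of c l] that by (cases "l = c") auto
    then have "antidiagonal S a b (Suc c) f' g'" using fg' by (simp add: antidiagonal_def)
    then show False using no by (auto simp: has_antidiagonal_def)
  qed
  \<comment> \<open>Otherwise continue the first antidiagonal by the second from the same index on: one too long.\<close>
  have i: "\<not> (f k < f' k \<and> g' k < g k)" if k: "k \<le> c" for k
  proof
    assume *: "f k < f' k \<and> g' k < g k"
    have "has_antidiagonal S (Suc a) (Suc b) (Suc k + (Suc c - k))"
    proof (rule antidiagonal_splice[OF fg fg'])
      show "f l < Suc a \<and> g l < Suc b" if "l \<le> k" for l using f[of l] that k by simp
      show "f' l < Suc a \<and> g' l < Suc b" if "l < Suc c" for l using f'[of l] that by simp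
    qed (use * k in auto)
    moreover have "Suc k + (Suc c - k) = Suc (Suc c)" using k by simp
    ultimately show False using no2 by simp
  qed
  \<comment> \<open>Otherwise splicing gives an excluded antidiagonal: it avoids both row \<open>a\<close> and column \<open>b\<close>.\<close>
  have ii: "\<not> (f' k < f (Suc k) \<and> g (Suc k) < g' k)" if k: "Suc k \<le> c" for k
  proof
    assume *: "f' k < f (Suc k) \<and> g (Suc k) < g' k"
    have "has_antidiagonal S a b (Suc k + (Suc c - Suc k))"
    proof (rule antidiagonal_splice[OF fg' fg])
      show "f' l < a \<and> g' l < b" if "l \<le> k" for l
        using f(1)[of "Suc k"] f'[of l] m'(1)[of k l] that k * by (cases "l = k") auto
      show "f l < a \<and> g l < b" if "Suc k \<le> l" "l < Suc c" for l
        using f(1)[of l] f'(2)[of k] m(2)[of l "Suc k"] that k * by (cases "l = Suc k") auto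
    qed (use * k in auto)
    moreover have "Suc k + (Suc c - Suc k) = Suc c" using k by simp
    ultimately show False using no by simp
  qed
  have "f' k \<le> f k \<and> g' k < g k" if "k \<le> c" for k
    using that
  proof (induction k)
    case 0
    then show ?case using i[of 0] f'(2)[of 0] g0 by auto
  next
    case (Suc k)
    then have IH: "f' k \<le> f k" "g' k < g k" by auto
    have "f' k < f (Suc k)" using m(1)[of "Suc k" k] Suc.prems IH by simp
    then have "g' (Suc k) < g (Suc k)" using ii[of k] m'(2)[of "Suc k" k] Suc.prems by simp
    then show ?case using i[of "Suc k"] Suc.prems by auto
  qed
  from this[of c] show False using fc f(1)[of c] by simp
qed

text \<open>
  The nonzero entries of \<open>w\<close> are placed where the mixed second difference of \<open>r\<close> is one. It is
  never negative by supermodularity, and its row and column sums telescope to single differences of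
  \<open>r\<close>, which are at most one. So \<open>w\<close> is a partial permutation matrix, and its corner ranks
  are the double sums, which telescope to \<open>r\<close>.
\<close>

lemma rank_function_realised:
  fixes r :: "nat \<Rightarrow> nat \<Rightarrow> nat"
  assumes zero: "\<And>b. r 0 b = 0" "\<And>a. r a 0 = 0"
    and row: "\<And>a b. r a b \<le> r (Suc a) b" "\<And>a b. r (Suc a) b \<le> Suc (r a b)"
    and col: "\<And>a b. r a b \<le> r a (Suc b)" "\<And>a b. r a (Suc b) \<le> Suc (r a b)"
    and super: "\<And>a b. r a (Suc b) + r (Suc a) b \<le> r (Suc a) (Suc b) + r a b"
  shows "\<exists>w \<in> carrier_mat m n. \<forall>a\<le>m. \<forall>b\<le>n. corner_rank (w :: 'k::field mat) a b = r a b"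
proof -
  define d where "d = (\<lambda>x y. int (r (Suc x) (Suc y)) + int (r x y) - int (r x (Suc y)) - int (r (Suc x) y))"
  define w :: "'k mat" where "w = mat m n (\<lambda>(x, y). of_int (d x y))"
  have d01: "d x y = 0 \<or> d x y = 1" for x y
    using super[of x y] row(2)[of x "Suc y"] row(1)[of x y] unfolding d_def by linarith
  have dnn: "d x y \<ge> 0" for x y using d01[of x y] by auto
  have rowsum: "(\<Sum>y<b. d x y) = int (r (Suc x) b) - int (r x b)" for x b
    using zero by (induction b) (auto simp: d_def)
  have colsum: "(\<Sum>x<a. d x y) = int (r a (Suc y)) - int (r a y)" for a y
    using zero by (induction a) (auto simp: d_def)
  have wd: "w $$ (x, y) \<noteq> 0 \<longleftrightarrow> d x y = 1" if "x < m" "y < n" for x y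
    using that d01[of x y] by (auto simp: w_def)
  have rowuniq: "y = y'" if "d x y = 1" "d x y' = 1" "y < n" "y' < n" for x y y'
  proof (rule ccontr)
    assume ne: "y \<noteq> y'"
    have "(\<Sum>z\<in>{y, y'}. d x z) \<le> (\<Sum>z<n. d x z)" by (rule sum_mono2) (use that dnn in auto)
    then show False using ne that rowsum[of x n] row(2)[of x n] by simp
  qed
  have coluniq: "x = x'" if "d x y = 1" "d x' y = 1" "x < m" "x' < m" for x x' y
  proof (rule ccontr)
    assume ne: "x \<noteq> x'"
    have "(\<Sum>z\<in>{x, x'}. d z y) \<le> (\<Sum>z<m. d z y)" by (rule sum_mono2) (use that dnn in auto)
    then show False using ne that colsum[where a=m and y=y] col(2)[of m y] by simp
  qed
  have pp: "partial_perm m n w"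
    unfolding partial_perm_def
  proof (intro allI impI)
    fix x x' y y' assume *: "x < m" "x' < m" "y < n" "y' < n" "w $$ (x, y) \<noteq> 0" "w $$ (x', y') \<noteq> 0"
    then have d: "d x y = 1" "d x' y' = 1" using wd by auto
    show "x = x' \<longleftrightarrow> y = y'"
      using rowuniq[of x y y'] coluniq[of x y x'] d * by auto
  qed
  have wc: "w \<in> carrier_mat m n" by (simp add: w_def)
  have "corner_rank w a b = r a b" if ab: "a \<le> m" "b \<le> n" for a b
  proof -
    have "corner_rank w a b = card (dots w a b)"
      by (rule corner_rank_partial_perm[OF wc ab partial_perm_mono[OF pp ab]])
    also have "int \<dots> = (\<Sum>p\<in>dots w a b. 1)" by simp
    also have "\<dots> = (\<Sum>p\<in>{..<a} \<times> {..<b}. if w $$ p \<noteq> 0 then 1 else 0)"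
      unfolding dots_def by (rule sum.inter_filter) simp
    also have "\<dots> = (\<Sum>p\<in>{..<a} \<times> {..<b}. d (fst p) (snd p))"
    proof (rule sum.cong)
      fix p assume "p \<in> {..<a} \<times> {..<b}"
      then have "fst p < m" "snd p < n" using ab by auto
      then show "(if w $$ p \<noteq> 0 then 1 else 0) = d (fst p) (snd p)"
        using wd[of "fst p" "snd p"] d01[of "fst p" "snd p"] by auto
    qed simp
    also have "\<dots> = (\<Sum>x<a. \<Sum>y<b. d x y)"
      by (simp add: sum.cartesian_product case_prod_unfold)
    also have "\<dots> = int (r a b)"
      unfolding rowsum using zero by (induction a) auto
    finally show ?thesis by simp
  qed
  then show ?thesis using wc by blast
qed

text \<open>
  The maximal antidiagonal lengths change by at most one per row and column, so supermodularity
  at \<open>(a, b)\<close> could only fail if adding a row or a column alone lengthens the antidiagonals while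
  adding both gives nothing more; \<open>antidiagonal_exchange\<close> excludes this.
\<close>

lemma antidiag_rank_realised:
  "\<exists>w \<in> carrier_mat m n. \<forall>a\<le>m. \<forall>b\<le>n. corner_rank (w :: 'k::field mat) a b = antidiag_rank S a b"
proof (rule rank_function_realised)
  let ?r = "antidiag_rank S"
  have h: "has_antidiagonal S a b (?r a b)" for a b by (simp add: has_antidiagonal_iff)
  show "?r 0 b = 0" for b using has_antidiagonal_bound[OF h, of 0 b] by simp
  show "?r a 0 = 0" for a using has_antidiagonal_bound[OF h, of a 0] by simp
  show r1: "?r a b \<le> ?r (Suc a) b" for a b
    using has_antidiagonal_mono[OF h[of a b], of "?r a b" "Suc a" b] by (simp add: has_antidiagonal_iff)
  show c1: "?r a b \<le> ?r a (Suc b)" for a b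
    using has_antidiagonal_mono[OF h[of a b], of "?r a b" a "Suc b"] by (simp add: has_antidiagonal_iff)
  show r2: "?r (Suc a) b \<le> Suc (?r a b)" for a b
  proof (cases "?r (Suc a) b")
    case (Suc k)
    then have "has_antidiagonal S a b k" using antidiagonal_drop_row[of S a b k] h[of "Suc a" b] by simp
    then show ?thesis using Suc by (simp add: has_antidiagonal_iff)
  qed simp
  show c2: "?r a (Suc b) \<le> Suc (?r a b)" for a b
  proof (cases "?r a (Suc b)")
    case (Suc k)
    then have "has_antidiagonal S a b k" using antidiagonal_drop_col[of S a b k] h[of a "Suc b"] by simp
    then show ?thesis using Suc by (simp add: has_antidiagonal_iff)
  qed simp
  show "?r a (Suc b) + ?r (Suc a) b \<le> ?r (Suc a) (Suc b) + ?r a b" for a b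
  proof -
    define c where "c = ?r a b"
    consider "?r a (Suc b) = c" | "?r (Suc a) b = c" | "?r a (Suc b) = Suc c" "?r (Suc a) b = Suc c"
      using r1[of a b] r2[of a b] c1[of a b] c2[of a b] unfolding c_def by linarith
    then show ?thesis
    proof cases
      case 1
      then show ?thesis using c1[of "Suc a" b] by (simp add: c_def)
    next
      case 2
      then show ?thesis using r1[of a "Suc b"] by (simp add: c_def)
    next
      case 3
      have "has_antidiagonal S (Suc a) (Suc b) (Suc (Suc c))"
        by (rule antidiagonal_exchange) (use 3 in \<open>simp_all add: has_antidiagonal_iff c_def\<close>)
      then show ?thesis using 3 by (simp add: has_antidiagonal_iff c_def)
    qed
  qed
qed

section \<open>An outer corner variable is not a zero divisor\<close>

text \<open>
  Otherwise one plus the product of all \<open>X - x\<close> has no root.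
\<close>

lemma infinite_alg_closed: "infinite (UNIV :: 'k::alg_closed_field set)"
proof
  assume fin: "finite (UNIV :: 'k set)"
  define p :: "'k poly" where "p = 1 + (\<Prod>x\<in>UNIV. [:-x, 1:])"
  have deg: "degree (\<Prod>x\<in>(UNIV :: 'k set). [:-x, 1:]) = card (UNIV :: 'k set)"
    by (subst degree_prod_eq_sum_degree) auto
  have "card (UNIV :: 'k set) > 0" using fin by (simp add: card_gt_0_iff)
  then have "degree p > 0" unfolding p_def by (subst degree_add_eq_right) (use deg in auto)
  then obtain x where "poly p x = 0" using alg_closed_imp_poly_has_root by blast
  moreover have "poly (\<Prod>x\<in>(UNIV :: 'k set). [:-x, 1:]) x = 0"
    unfolding poly_prod by (rule prod_zero[OF fin]) (auto intro: bexI[of _ x])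
  ultimately show False by (simp add: p_def)
qed

lemma eval_cong:
  assumes "p \<in> carrier (mpoly_ring V)" "\<And>v. v \<in> V \<Longrightarrow> a v = a' v"
  shows "eval a p = eval a' p"
proof -
  have "(\<Prod>v \<in> supp t. a v ^ Poly_Mapping.lookup t v) =
      (\<Prod>v \<in> supp t. a' v ^ Poly_Mapping.lookup t v)" if t: "t \<in> supp p" for t
  proof (rule prod.cong)
    fix v assume "v \<in> supp t"
    then have "v \<in> V" using assms(1) t by (auto simp: carrier_mpoly_ring)
    then show "a v ^ Poly_Mapping.lookup t v = a' v ^ Poly_Mapping.lookup t v" using assms(2) by simp
  qed simp
  then show ?thesis unfolding eval_def by simp
qed

lemma eval_along_curve: "\<exists>P. \<forall>t. eval (\<lambda>v. poly (h v) t) p = poly P t"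
proof (rule exI[of _ "\<Sum>s \<in> supp p. Polynomial.smult (Poly_Mapping.lookup p s) (\<Prod>v \<in> supp s. h v ^ Poly_Mapping.lookup s v)"], rule allI)
  fix t
  show "eval (\<lambda>v. poly (h v) t) p = poly (\<Sum>s \<in> supp p. Polynomial.smult (Poly_Mapping.lookup p s)
      (\<Prod>v \<in> supp s. h v ^ Poly_Mapping.lookup s v)) t"
    by (simp add: eval_def poly_sum poly_prod)
qed

lemma corner_rank_empty:
  fixes M :: "'a::field mat"
  assumes "M \<in> carrier_mat m n"
  shows "b \<le> n \<Longrightarrow> corner_rank M 0 b = 0" "a \<le> m \<Longrightarrow> corner_rank M a 0 = 0"
proof -
  have pp: "partial_perm 0 b M" "partial_perm a 0 M" for a b by (auto simp: partial_perm_def)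
  show "b \<le> n \<Longrightarrow> corner_rank M 0 b = 0"
    using corner_rank_partial_perm[OF assms _ _ pp(1), of b] by (simp add: dots_def)
  show "a \<le> m \<Longrightarrow> corner_rank M a 0 = 0"
    using corner_rank_partial_perm[OF assms _ _ pp(2), of a] by (simp add: dots_def)
qed

lemma MSV_corner_rank_le:
  assumes M: "M \<in> MSV m n w" and w: "w \<in> carrier_mat m n" and ab: "a \<le> m" "b \<le> n"
  shows "corner_rank M a b \<le> corner_rank w a b"
proof (cases "a = 0 \<or> b = 0")
  case True
  have "M \<in> carrier_mat m n" using M by (simp add: MSV_def)
  then have "corner_rank M a b = 0" using True corner_rank_empty[of M m n] ab by auto
  then show ?thesis by simp
next
  case False
  then show ?thesis using M ab by (simp add: MSV_def)
qed

lemma corner_rank_zero_entries: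
  fixes M :: "'a::field mat"
  assumes M: "M \<in> carrier_mat m n" and ab: "a \<le> m" "b \<le> n" and r: "corner_rank M a b = 0"
    and xy: "x < a" "y < b"
  shows "M $$ (x, y) = 0"
proof -
  let ?E = "mat 1 1 (\<lambda>(l, l'). corner a b M $$ (x, y))"
  have "vec_space.rank 1 ?E \<le> vec_space.rank a (corner a b M)"
    using rank_reindex[of "corner a b M" a b 1 "\<lambda>_. x" "\<lambda>_. y"] xy by simp
  then have "vec_space.rank 1 ?E < 1" using r corner_rank_eq[OF M ab] by simp
  then have "det ?E = 0" by (intro det_zero_of_rank_less) auto
  then show ?thesis using xy by (simp add: det_single)
qed

lemma dots_mono: "a \<le> a' \<Longrightarrow> b \<le> b' \<Longrightarrow> dots v a b \<subseteq> dots v a' b'"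
  by (auto simp: dots_def)

text \<open>
  The target of the next step in \<open>MSV_line\<close>. Here \<open>q\<close> is the column of the nonzero entry
  of row \<open>i\<close>, or \<open>n\<close>. If there are nonzero entries below row \<open>i\<close> in columns \<open>j\<close> to \<open>q - 1\<close>, take the
  topmost one as \<open>(a, b)\<close>; otherwise \<open>b = j\<close> and \<open>a = m\<close>, one past the last row.
\<close>

lemma pivot_exists:
  fixes v :: "'a::zero mat"
  assumes pp: "partial_perm m n v" and i: "i < m" and jq: "j < q" "q \<le> n"
    and box: "\<And>x. x < i \<Longrightarrow> v $$ (x, j) = 0" and row: "\<And>y. y < q \<Longrightarrow> v $$ (i, y) = 0"
  obtains a b where "i < a" "a \<le> m" "j \<le> b" "b < q" "a < m \<Longrightarrow> v $$ (a, b) \<noteq> 0"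
    "\<And>x y. i \<le> x \<Longrightarrow> x < a \<Longrightarrow> j \<le> y \<Longrightarrow> y < q \<Longrightarrow> v $$ (x, y) = 0"
    "\<And>x. x < a \<Longrightarrow> v $$ (x, b) = 0"
proof (cases "\<exists>x. x < m \<and> (\<exists>y. j \<le> y \<and> y < q \<and> i < x \<and> v $$ (x, y) \<noteq> 0)")
  case True
  define a where "a = (LEAST x. x < m \<and> (\<exists>y. j \<le> y \<and> y < q \<and> i < x \<and> v $$ (x, y) \<noteq> 0))"
  have "a < m \<and> (\<exists>y. j \<le> y \<and> y < q \<and> i < a \<and> v $$ (a, y) \<noteq> 0)"
    using LeastI_ex[OF True] unfolding a_def .
  then obtain b where ab: "a < m" "i < a" "j \<le> b" "b < q" "v $$ (a, b) \<noteq> 0" by auto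
  have above: "v $$ (x, y) = 0" if "i \<le> x" "x < a" "j \<le> y" "y < q" for x y
  proof (cases "x = i")
    case True
    then show ?thesis using row that by simp
  next
    case False
    show ?thesis
    proof (rule ccontr)
      assume "v $$ (x, y) \<noteq> 0"
      then have "x < m \<and> (\<exists>y. j \<le> y \<and> y < q \<and> i < x \<and> v $$ (x, y) \<noteq> 0)"
        using that False ab(1) by (intro conjI exI[of _ y]) auto
      then have "a \<le> x" unfolding a_def by (rule Least_le)
      then show False using that by simp
    qed
  qed
  have "v $$ (x, b) = 0" if "x < a" for x
  proof (rule ccontr)
    assume "v $$ (x, b) \<noteq> 0"
    then have "x = a \<longleftrightarrow> b = b" using pp ab that jq unfolding partial_perm_def
      by (metis order_less_le_trans order_less_trans)
    then show False using that by simp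
  qed
  then show thesis using that[of a b] ab above by simp
next
  case False
  then have below: "v $$ (x, y) = 0" if "i < x" "x < m" "j \<le> y" "y < q" for x y using that by blast
  have "v $$ (x, y) = 0" if "i \<le> x" "x < m" "j \<le> y" "y < q" for x y
    using below[of x y] row[of y] that by (cases "x = i") auto
  moreover from this have "v $$ (x, j) = 0" if "x < m" for x
    using box[of x] that jq by (cases "x < i") auto
  ultimately show thesis using that[of m j] i jq by simp
qed

text \<open>
  A new entry \<open>t\<close> at \<open>(i, b)\<close> can be removed by a row operation with row \<open>a\<close>, whose only nonzero
  entry is at \<open>b\<close>, and by a column operation with column \<open>q\<close>, whose only nonzero entry is at \<open>i\<close>.
  A corner containing row \<open>a\<close> or column \<open>q\<close> therefore does not gain rank. A corner that contains
  \<open>(i, b)\<close> but neither of these is still a partial permutation pattern, now with one more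
  entry. The values \<open>a = m\<close> and \<open>q = n\<close> stand for a missing row or column.
\<close>

lemma corner_rank_new_entry:
  fixes v :: "'k::field mat"
  assumes v: "v \<in> carrier_mat m n" and pp: "partial_perm m n v"
    and ij: "i < m" "b < q" "q \<le> n" and a: "i < a" "a \<le> m"
    and vab: "a < m \<Longrightarrow> v $$ (a, b) \<noteq> 0" and viq: "q < n \<Longrightarrow> v $$ (i, q) \<noteq> 0"
    and row: "\<And>y. y < q \<Longrightarrow> v $$ (i, y) = 0" and col: "\<And>x. x < a \<Longrightarrow> v $$ (x, b) = 0"
  defines "vt \<equiv> \<lambda>t. mat m n (\<lambda>(x, y). v $$ (x, y) + (if x = i \<and> y = b then t else 0))"
  shows "a' \<le> m \<Longrightarrow> b' \<le> n \<Longrightarrow> \<not> (i < a' \<and> a' \<le> a \<and> b < b' \<and> b' \<le> q) \<Longrightarrow>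
      corner_rank (vt t) a' b' \<le> corner_rank v a' b'"
    and "i < a' \<Longrightarrow> a' \<le> a \<Longrightarrow> b < b' \<Longrightarrow> b' \<le> q \<Longrightarrow> t \<noteq> 0 \<Longrightarrow>
      corner_rank (vt t) a' b' = Suc (card (dots v a' b'))"
    and "b' \<le> n \<Longrightarrow> corner_rank (vt t) i b' = corner_rank v i b'"
    and "corner_rank (vt 0) a' b' = corner_rank v a' b'"
proof -
  have vtc: "vt t \<in> carrier_mat m n" for t by (simp add: vt_def)
  have vt: "vt t $$ (x, y) = v $$ (x, y) + (if x = i \<and> y = b then t else 0)" if "x < m" "y < n" for t x y
    using that by (simp add: vt_def)
  have small: "corner_rank (vt t) a' b' = corner_rank v a' b'" if "a' \<le> m" "b' \<le> n" "a' \<le> i \<or> b' \<le> b" for a' b'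
  proof -
    have "corner a' b' (vt t) = corner a' b' v" by (rule eq_matI) (use that vt in \<open>auto simp: corner_def\<close>)
    then show ?thesis by (simp add: corner_rank_eq[OF vtc that(1,2)] corner_rank_eq[OF v that(1,2)])
  qed
  show "b' \<le> n \<Longrightarrow> corner_rank (vt t) i b' = corner_rank v i b'" using small[of i b'] ij(1) by simp
  have "vt 0 = v" by (rule eq_matI) (use v in \<open>auto simp: vt_def\<close>)
  then show "corner_rank (vt 0) a' b' = corner_rank v a' b'" by simp
  have uniq: "x = x' \<longleftrightarrow> y = y'" if "x < m" "x' < m" "y < n" "y' < n" "v $$ (x, y) \<noteq> 0" "v $$ (x', y') \<noteq> 0" for x x' y y'
    using pp that unfolding partial_perm_def by blast
  show "corner_rank (vt t) a' b' \<le> corner_rank v a' b'"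
    if ab': "a' \<le> m" "b' \<le> n" and out: "\<not> (i < a' \<and> a' \<le> a \<and> b < b' \<and> b' \<le> q)"
  proof -
    consider "a' \<le> i \<or> b' \<le> b" | "a < a'" | "q < b'" using out by linarith
    then show ?thesis
    proof cases
      case 1
      then show ?thesis using small[OF ab'] by simp
    next
      case 2
      then have am: "a < m" using ab' by simp
      define P where "P = mat a' a' (\<lambda>(x, z). (if z = x then 1 else 0) + (if x = i \<and> z = a then t / v $$ (a, b) else 0))"
      have "corner a' b' (vt t) = P * corner a' b' v"
      proof (rule eq_matI)
        fix x y assume "x < dim_row (P * corner a' b' v)" "y < dim_col (P * corner a' b' v)"
        then have xy: "x < a'" "y < b'" by (auto simp: P_def corner_def)
        have "(P * corner a' b' v) $$ (x, y) = (\<Sum>z<a'. P $$ (x, z) * corner a' b' v $$ (z, y))"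
          by (rule mult_mat_index[of _ a' a' _ b']) (use xy in \<open>auto simp: P_def\<close>)
        also have "\<dots> = (\<Sum>z<a'. (if z = x then v $$ (z, y) else 0) +
            (if z = a then (if x = i then t / v $$ (a, b) * v $$ (z, y) else 0) else 0))"
          by (rule sum.cong) (use xy in \<open>auto simp: P_def distrib_right\<close>)
        also have "\<dots> = v $$ (x, y) + (if x = i then t / v $$ (a, b) * v $$ (a, y) else 0)"
          using xy 2 by (simp add: sum.distrib)
        also have "\<dots> = vt t $$ (x, y)"
        proof -
          have "v $$ (a, y) = 0" if "y \<noteq> b" using uniq[of a a y b] am vab[OF am] that xy ab' ij by auto
          then show ?thesis using xy ab' vab[OF am] by (subst vt) auto
        qed
        finally show "corner a' b' (vt t) $$ (x, y) = (P * corner a' b' v) $$ (x, y)" using xy by simp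
      qed (auto simp: P_def corner_def)
      moreover have "P \<in> carrier_mat a' a'" by (simp add: P_def)
      ultimately show ?thesis
        using rank_mult_left[of P a' a' "corner a' b' v" b']
        by (simp add: corner_rank_eq[OF vtc ab'] corner_rank_eq[OF v ab'])
    next
      case 3
      then have qn: "q < n" using ab' by simp
      define Q where "Q = mat b' b' (\<lambda>(z, y). (if z = y then 1 else 0) + (if y = b \<and> z = q then t / v $$ (i, q) else 0))"
      have "corner a' b' (vt t) = corner a' b' v * Q"
      proof (rule eq_matI)
        fix x y assume "x < dim_row (corner a' b' v * Q)" "y < dim_col (corner a' b' v * Q)"
        then have xy: "x < a'" "y < b'" by (auto simp: Q_def corner_def)
        have "(corner a' b' v * Q) $$ (x, y) = (\<Sum>z<b'. corner a' b' v $$ (x, z) * Q $$ (z, y))"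
          by (rule mult_mat_index[of _ a' b' _ b']) (use xy in \<open>auto simp: Q_def\<close>)
        also have "\<dots> = (\<Sum>z<b'. (if z = y then v $$ (x, z) else 0) +
            (if z = q then (if y = b then v $$ (x, z) * (t / v $$ (i, q)) else 0) else 0))"
          by (rule sum.cong) (use xy in \<open>auto simp: Q_def distrib_left\<close>)
        also have "\<dots> = v $$ (x, y) + (if y = b then v $$ (x, q) * (t / v $$ (i, q)) else 0)"
          using xy 3 by (simp add: sum.distrib)
        also have "\<dots> = vt t $$ (x, y)"
        proof -
          have "v $$ (x, q) = 0" if "x \<noteq> i" using uniq[of x i q q] qn viq[OF qn] that xy ab' ij by auto
          then show ?thesis using xy ab' viq[OF qn] by (subst vt) auto
        qed
        finally show "corner a' b' (vt t) $$ (x, y) = (corner a' b' v * Q) $$ (x, y)" using xy by simp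
      qed (auto simp: Q_def corner_def)
      moreover have "Q \<in> carrier_mat b' b'" by (simp add: Q_def)
      ultimately show ?thesis
        using rank_mult_right[of "corner a' b' v" a' b' Q b']
        by (simp add: corner_rank_eq[OF vtc ab'] corner_rank_eq[OF v ab'])
    qed
  qed
  show "corner_rank (vt t) a' b' = Suc (card (dots v a' b'))"
    if R: "i < a'" "a' \<le> a" "b < b'" "b' \<le> q" and t: "t \<noteq> 0"
  proof -
    have ab': "a' \<le> m" "b' \<le> n" using R a ij by auto
    have nz: "vt t $$ (x, y) \<noteq> 0 \<longleftrightarrow> x = i \<and> y = b \<or> v $$ (x, y) \<noteq> 0" if "x < a'" "y < b'" for x y
    proof (cases "x = i \<and> y = b")
      case True
      then have "v $$ (x, y) = 0" using row[of b] ij by simp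
      then show ?thesis using True t that ab' vt[of x y] by simp
    next
      case False
      then have "vt t $$ (x, y) = v $$ (x, y)" using that ab' vt[of x y] by auto
      then show ?thesis using False by auto
    qed
    have v0: "v $$ (i, y) = 0" "v $$ (x, b) = 0" if "x < a'" "y < b'" for x y using that R row col by auto
    have "partial_perm a' b' (vt t)"
      unfolding partial_perm_def
    proof (intro allI impI)
      fix x x' y y' assume *: "x < a'" "x' < a'" "y < b'" "y' < b'" "vt t $$ (x, y) \<noteq> 0" "vt t $$ (x', y') \<noteq> 0"
      have 1: "x = i \<and> y = b \<or> v $$ (x, y) \<noteq> 0" using nz * by blast
      have 2: "x' = i \<and> y' = b \<or> v $$ (x', y') \<noteq> 0" using nz * by blast
      have 3: "v $$ (x, y) \<noteq> 0 \<Longrightarrow> x \<noteq> i \<and> y \<noteq> b" using v0(1)[of x y] v0(2)[of x y] * by auto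
      have 4: "v $$ (x', y') \<noteq> 0 \<Longrightarrow> x' \<noteq> i \<and> y' \<noteq> b" using v0(1)[of x' y'] v0(2)[of x' y'] * by auto
      show "x = x' \<longleftrightarrow> y = y'"
        using 1 2 3 4 uniq[of x x' y y'] * ab' by auto
    qed
    then have "corner_rank (vt t) a' b' = card (dots (vt t) a' b')"
      by (rule corner_rank_partial_perm[OF vtc ab'])
    also have "dots (vt t) a' b' = insert (i, b) (dots v a' b')"
      using nz R by (auto simp: dots_def)
    also have "card \<dots> = Suc (card (dots v a' b'))"
      using row[of b] ij by (subst card_insert_disjoint) (auto simp: dots_def)
    finally show ?thesis .
  qed
qed

text \<open>
  One step of the deformation. The smallest \<open>d\<close> for which row \<open>i\<close> raises the rank of the first
  \<open>d\<close> columns measures how far right the pivot of row \<open>i\<close> is, with \<open>n + 1\<close> standing for no pivot;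
  for \<open>t \<noteq> 0\<close> it is smaller than for \<open>M\<close>. On the normal form \<open>v\<close> of \<open>M\<close> the step adds an entry at \<open>(i, b)\<close> with
  \<open>b\<close> from \<open>pivot_exists\<close>. Ranks only grow in corners where \<open>v\<close> has no nonzero entries
  south-east of \<open>(i, j)\<close>, so that all of them lie in the first \<open>i\<close> rows or the first \<open>j\<close> columns;
  there the assumed inequality for \<open>w\<close> leaves room for one more.
\<close>

lemma MSV_line:
  fixes w :: "'k::field mat"
  assumes w: "w \<in> carrier_mat m n" and ij: "i < m" "j < n"
    and K: "\<And>a b. i < a \<Longrightarrow> a \<le> m \<Longrightarrow> j < b \<Longrightarrow> b \<le> n \<Longrightarrow>
      corner_rank w i b + corner_rank w a j < corner_rank w a b"
    and M: "M \<in> MSV m n w" and box: "\<And>x y. x \<le> i \<Longrightarrow> y \<le> j \<Longrightarrow> M $$ (x, y) = 0"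
    and d: "d = Suc n \<or> (d \<le> n \<and> corner_rank M i d < corner_rank M (Suc i) d)"
  obtains C d' where "d' < d" "d' \<le> n"
    "\<And>t. mat m n (\<lambda>(x, y). M $$ (x, y) + t * C x y) \<in> MSV m n w"
    "\<And>t. t \<noteq> 0 \<Longrightarrow> corner_rank (mat m n (\<lambda>(x, y). M $$ (x, y) + t * C x y)) i d' <
      corner_rank (mat m n (\<lambda>(x, y). M $$ (x, y) + t * C x y)) (Suc i) d'"
proof -
  have Mc: "M \<in> carrier_mat m n" using M by (simp add: MSV_def)
  obtain L v U where L: "unit_lower m L" and U: "unit_upper n U" and v: "v \<in> carrier_mat m n"
    and pp: "partial_perm m n v" and MLvU: "M = L * v * U" using normal_form[OF Mc] .
  have Lc: "L \<in> carrier_mat m m" and Uc: "U \<in> carrier_mat n n"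
    using L U by (auto simp: unit_lower_def unit_upper_def)
  have rM: "corner_rank M a b = card (dots v a b)" if "a \<le> m" "b \<le> n" for a b
    using corner_rank_mult_triangular(1)[OF L U v that] corner_rank_partial_perm[OF v that partial_perm_mono[OF pp that]] MLvU
    by simp
  have vbox: "v $$ (x, y) = 0" if "x \<le> i" "y \<le> j" for x y
  proof -
    have "Suc i \<le> m" "Suc j \<le> n" using ij by auto
    then obtain P Q where PQ: "P \<in> carrier_mat (Suc i) (Suc i)" "Q \<in> carrier_mat (Suc j) (Suc j)"
      "P * corner (Suc i) (Suc j) M * Q = corner (Suc i) (Suc j) v"
      using corner_rank_mult_triangular(2)[OF L U v] MLvU by blast
    have "corner (Suc i) (Suc j) M = 0\<^sub>m (Suc i) (Suc j)"
      by (rule eq_matI) (use box in \<open>auto simp: corner_def\<close>)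
    then have "corner (Suc i) (Suc j) v = 0\<^sub>m (Suc i) (Suc j)"
      using PQ by (simp add: right_mult_zero_mat[OF PQ(1)] left_mult_zero_mat[OF PQ(2)])
    then have "corner (Suc i) (Suc j) v $$ (x, y) = 0\<^sub>m (Suc i) (Suc j) $$ (x, y)" by simp
    then show ?thesis using that by simp
  qed
  define q where "q = (if \<exists>y<n. v $$ (i, y) \<noteq> 0 then (LEAST y. y < n \<and> v $$ (i, y) \<noteq> 0) else n)"
  have q: "q \<le> n" "q < n \<Longrightarrow> v $$ (i, q) \<noteq> 0" "\<And>y. y < q \<Longrightarrow> v $$ (i, y) = 0"
  proof -
    have "q \<le> n \<and> (q < n \<longrightarrow> v $$ (i, q) \<noteq> 0) \<and> (\<forall>y<q. v $$ (i, y) = 0)"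
    proof (cases "\<exists>y<n. v $$ (i, y) \<noteq> 0")
      case True
      then have qq: "q = (LEAST y. y < n \<and> v $$ (i, y) \<noteq> 0)" by (simp add: q_def)
      have 1: "q < n \<and> v $$ (i, q) \<noteq> 0" unfolding qq by (rule LeastI_ex[OF True])
      have "v $$ (i, y) = 0" if "y < q" for y
        using not_less_Least[OF that[unfolded qq]] that 1 by auto
      then show ?thesis using 1 by simp
    next
      case False
      then show ?thesis by (auto simp: q_def)
    qed
    then show "q \<le> n" "q < n \<Longrightarrow> v $$ (i, q) \<noteq> 0" "\<And>y. y < q \<Longrightarrow> v $$ (i, y) = 0" by auto
  qed
  have jq: "j < q"
  proof (rule ccontr)
    assume "\<not> j < q"
    then show False using q(2) vbox[of i q] ij by simp
  qed
  have qd: "q < d"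
  proof (rule ccontr)
    assume "\<not> q < d"
    then have dq: "d \<le> q" by simp
    then have "d \<le> n" "corner_rank M i d < corner_rank M (Suc i) d" using d q(1) by auto
    then have "card (dots v i d) < card (dots v (Suc i) d)" using rM ij by simp
    moreover have "dots v (Suc i) d \<subseteq> dots v i d"
    proof
      fix p assume p: "p \<in> dots v (Suc i) d"
      then have "fst p \<noteq> i" using q(3)[of "snd p"] dq by (auto simp: dots_def)
      then show "p \<in> dots v i d" using p by (auto simp: dots_def less_Suc_eq)
    qed
    then have "card (dots v (Suc i) d) \<le> card (dots v i d)" by (rule card_mono[rotated]) simp
    ultimately show False by simp
  qed
  obtain a b where ab: "i < a" "a \<le> m" "j \<le> b" "b < q" "a < m \<Longrightarrow> v $$ (a, b) \<noteq> 0"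
    and empty: "\<And>x y. i \<le> x \<Longrightarrow> x < a \<Longrightarrow> j \<le> y \<Longrightarrow> y < q \<Longrightarrow> v $$ (x, y) = 0"
    and col: "\<And>x. x < a \<Longrightarrow> v $$ (x, b) = 0"
  proof (rule pivot_exists[OF pp ij(1) jq q(1) _ q(3)])
    show "v $$ (x, j) = 0" if "x < i" for x using vbox[of x j] that by simp
  qed auto
  define vt where "vt = (\<lambda>t. mat m n (\<lambda>(x, y). v $$ (x, y) + (if x = i \<and> y = b then t else 0)))"
  note hyps = v pp ij(1) ab(4) q(1) ab(1,2,5) q(2,3) col
  have perturb1: "corner_rank (vt t) a' b' \<le> corner_rank v a' b'"
    if "a' \<le> m" "b' \<le> n" "\<not> (i < a' \<and> a' \<le> a \<and> b < b' \<and> b' \<le> q)" for t a' b'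
    unfolding vt_def by (rule corner_rank_new_entry(1)[OF hyps that])
  have perturb2: "corner_rank (vt t) a' b' = Suc (card (dots v a' b'))"
    if "i < a'" "a' \<le> a" "b < b'" "b' \<le> q" "t \<noteq> 0" for t a' b'
    unfolding vt_def by (rule corner_rank_new_entry(2)[OF hyps that])
  have perturb3: "corner_rank (vt t) i b' = corner_rank v i b'" if "b' \<le> n" for t b'
    unfolding vt_def by (rule corner_rank_new_entry(3)[OF hyps that])
  have perturb4: "corner_rank (vt 0) a' b' = corner_rank v a' b'" for a' b'
    unfolding vt_def by (rule corner_rank_new_entry(4)[OF hyps])
  have vtc: "vt t \<in> carrier_mat m n" for t by (simp add: vt_def)
  \<comment> \<open>The new entry at \<open>(i, b)\<close> of \<open>v\<close> becomes this direction after multiplying back by \<open>L\<close> and \<open>U\<close>.\<close>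
  define C where "C = (\<lambda>x y. L $$ (x, i) * U $$ (b, y))"
  define Mt where "Mt = (\<lambda>t. mat m n (\<lambda>(x, y). M $$ (x, y) + t * C x y))"
  have Mt: "Mt t = L * vt t * U" for t
  proof -
    define E where "E = mat m n (\<lambda>(x, y). if x = i \<and> y = b then t else 0)"
    have Ec: "E \<in> carrier_mat m n" by (simp add: E_def)
    have "vt t = v + E" by (rule eq_matI) (use v in \<open>auto simp: vt_def E_def\<close>)
    then have "L * vt t * U = (L * v + L * E) * U" by (simp add: mult_add_distrib_mat[OF Lc v Ec])
    also have "\<dots> = M + L * E * U"
      unfolding MLvU by (rule add_mult_distrib_mat[of _ m n]) (use Lc v Ec Uc in auto)
    finally have eq: "L * vt t * U = M + L * E * U" .
    have LE: "(L * E) $$ (x, z) = (if z = b then L $$ (x, i) * t else 0)" if "x < m" "z < n" for x z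
    proof -
      have "(L * E) $$ (x, z) = (\<Sum>u<m. L $$ (x, u) * E $$ (u, z))" by (rule mult_mat_index[OF Lc Ec that])
      also have "\<dots> = (\<Sum>u<m. if u = i then (if z = b then L $$ (x, i) * t else 0) else 0)"
        by (rule sum.cong) (use that in \<open>auto simp: E_def\<close>)
      finally show ?thesis using ij by simp
    qed
    have LEU: "(L * E * U) $$ (x, y) = t * C x y" if "x < m" "y < n" for x y
    proof -
      have "(L * E * U) $$ (x, y) = (\<Sum>z<n. (L * E) $$ (x, z) * U $$ (z, y))"
        by (rule mult_mat_index[OF _ Uc that]) (use Lc Ec in auto)
      also have "\<dots> = (\<Sum>z<n. if z = b then L $$ (x, i) * t * U $$ (b, y) else 0)"
        by (rule sum.cong) (use that LE in auto)
      finally show ?thesis using ab(4) q(1) by (simp add: C_def mult_ac)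
    qed
    show ?thesis unfolding eq Mt_def
      by (rule eq_matI) (use Mc Lc Ec Uc LEU in \<open>auto simp del: index_mult_mat(1)\<close>)
  qed
  have rMt: "corner_rank (Mt t) a' b' = corner_rank (vt t) a' b'" if "a' \<le> m" "b' \<le> n" for t a' b'
    unfolding Mt by (rule corner_rank_mult_triangular(1)[OF L U vtc that])
  have rv: "corner_rank v a' b' = corner_rank M a' b'" if "a' \<le> m" "b' \<le> n" for a' b'
    unfolding MLvU by (rule corner_rank_mult_triangular(1)[OF L U v that, symmetric])
  have "Mt t \<in> MSV m n w" for t
  proof -
    have "corner_rank (Mt t) a' b' \<le> corner_rank w a' b'" if a'b': "a' \<le> m" "b' \<le> n" for a' b'
    proof (cases "t \<noteq> 0 \<and> i < a' \<and> a' \<le> a \<and> b < b' \<and> b' \<le> q")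
      case True
      have sub: "dots v a' b' \<subseteq> dots v i b' \<union> dots v a' j"
      proof
        fix p assume p: "p \<in> dots v a' b'"
        then have "\<not> (i \<le> fst p \<and> j \<le> snd p)"
          using empty[of "fst p" "snd p"] True by (auto simp: dots_def)
        then show "p \<in> dots v i b' \<union> dots v a' j" using p by (auto simp: dots_def)
      qed
      have le: "i \<le> m" "j \<le> n" using ij by auto
      have "card (dots v a' b') \<le> card (dots v i b' \<union> dots v a' j)" by (rule card_mono[OF _ sub]) simp
      also have "\<dots> \<le> card (dots v i b') + card (dots v a' j)" by (rule card_Un_le)
      also have "\<dots> = corner_rank M i b' + corner_rank M a' j" using rM a'b' le by simp
      also have "\<dots> \<le> corner_rank w i b' + corner_rank w a' j"
        by (intro add_mono MSV_corner_rank_le[OF M w]) (use le a'b' in auto)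
      also have "\<dots> < corner_rank w a' b'" by (rule K) (use True a'b' ab in auto)
      finally show ?thesis using rMt[OF a'b'] perturb2[of a' b' t] True by simp
    next
      case False
      then have "corner_rank (vt t) a' b' \<le> corner_rank v a' b'"
        using perturb1[OF a'b', of t] perturb4[of a' b'] by auto
      also have "\<dots> \<le> corner_rank w a' b'" using rv[OF a'b'] MSV_corner_rank_le[OF M w a'b'] by simp
      finally show ?thesis using rMt[OF a'b'] by simp
    qed
    moreover have "Mt t \<in> carrier_mat m n" by (simp add: Mt_def)
    ultimately show ?thesis by (simp add: MSV_def)
  qed
  moreover have "corner_rank (Mt t) i (Suc b) < corner_rank (Mt t) (Suc i) (Suc b)" if t: "t \<noteq> 0" for t
  proof -
    have le: "i \<le> m" "Suc i \<le> m" "Suc b \<le> n" using ij ab(4) q(1) by auto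
    have "corner_rank (Mt t) i (Suc b) = card (dots v i (Suc b))"
      using rMt[OF le(1,3)] perturb3[OF le(3), of t] rv[OF le(1,3)] rM[OF le(1,3)] by simp
    also have "\<dots> \<le> card (dots v (Suc i) (Suc b))" by (rule card_mono[OF _ dots_mono]) auto
    also have "\<dots> < corner_rank (vt t) (Suc i) (Suc b)"
      using perturb2[of "Suc i" "Suc b" t] t ab by simp
    finally show ?thesis using rMt[OF le(2,3)] by simp
  qed
  moreover have "Suc b < d" "Suc b \<le> n" using ab(4) qd q(1) by auto
  ultimately show thesis using that[of "Suc b" C] unfolding Mt_def by blast
qed

text \<open>
  By induction on the column of the pivot of row \<open>i\<close>, as measured in \<open>MSV_line\<close>. Where the
  entry at \<open>(i, j)\<close> is nonzero there is nothing to do. Otherwise \<open>g\<close> vanishes on a line through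
  \<open>M\<close> except possibly at \<open>M\<close>, and its restriction to the line is a polynomial in \<open>t\<close>.
\<close>

lemma vanishes_if_multiple_vanishes:
  fixes w :: "'k::alg_closed_field mat"
  assumes w: "w \<in> carrier_mat m n" and ij: "i < m" "j < n"
    and K: "\<And>a b. i < a \<Longrightarrow> a \<le> m \<Longrightarrow> j < b \<Longrightarrow> b \<le> n \<Longrightarrow>
      corner_rank w i b + corner_rank w a j < corner_rank w a b"
    and zero: "corner_rank w (Suc i) j = 0" "corner_rank w i (Suc j) = 0"
    and g: "g \<in> carrier (mpoly_ring (mat_vars m n))"
    and van: "\<And>M. M \<in> MSV m n w \<Longrightarrow> M $$ (i, j) * eval (\<lambda>p. M $$ p) g = 0"
    and M: "M \<in> MSV m n w"
  shows "eval (\<lambda>p. M $$ p) g = 0"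
proof -
  have main: "eval (\<lambda>p. M $$ p) g = 0"
    if "M \<in> MSV m n w" "d = Suc n \<or> (d \<le> n \<and> corner_rank M i d < corner_rank M (Suc i) d)" for M d
    using that
  proof (induction d arbitrary: M rule: less_induct)
    case (less d)
    note M = less.prems(1)
    have Mc: "M \<in> carrier_mat m n" using M by (simp add: MSV_def)
    show ?case
    proof (cases "M $$ (i, j) = 0")
      case False
      then show ?thesis using van[OF M] by simp
    next
      case True
      have le: "Suc i \<le> m" "Suc j \<le> n" "i \<le> m" "j \<le> n" using ij by auto
      have r0: "corner_rank M (Suc i) j = 0" "corner_rank M i (Suc j) = 0"
        using MSV_corner_rank_le[OF M w le(1,4)] MSV_corner_rank_le[OF M w le(3,2)] zero by auto
      have box: "M $$ (x, y) = 0" if xy: "x \<le> i" "y \<le> j" for x y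
      proof -
        consider "y < j" | "x < i" | "x = i" "y = j" using xy by linarith
        then show ?thesis
        proof cases
          case 1
          then show ?thesis using corner_rank_zero_entries[OF Mc le(1,4) r0(1), of x y] xy by simp
        next
          case 2
          then show ?thesis using corner_rank_zero_entries[OF Mc le(3,2) r0(2), of x y] xy by simp
        next
          case 3
          then show ?thesis using True by simp
        qed
      qed
      obtain C d' where d': "d' < d" "d' \<le> n"
        and 1: "\<And>t. mat m n (\<lambda>(x, y). M $$ (x, y) + t * C x y) \<in> MSV m n w"
        and 2: "\<And>t. t \<noteq> 0 \<Longrightarrow> corner_rank (mat m n (\<lambda>(x, y). M $$ (x, y) + t * C x y)) i d' <
          corner_rank (mat m n (\<lambda>(x, y). M $$ (x, y) + t * C x y)) (Suc i) d'"
        by (rule MSV_line[OF w ij K M box less.prems(2)]; (assumption | (rule that; assumption)))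
      define h where "h = (\<lambda>p. [:M $$ p, C (fst p) (snd p):])"
      obtain P where P: "\<And>t. eval (\<lambda>v. poly (h v) t) g = poly P t"
        using eval_along_curve[of h g] by metis
      have Mt: "eval (\<lambda>p. mat m n (\<lambda>(x, y). M $$ (x, y) + t * C x y) $$ p) g = poly P t" for t
      proof -
        have "eval (\<lambda>p. mat m n (\<lambda>(x, y). M $$ (x, y) + t * C x y) $$ p) g = eval (\<lambda>v. poly (h v) t) g"
          by (rule eval_cong[OF g]) (auto simp: mat_vars_def h_def)
        then show ?thesis using P by simp
      qed
      have "poly P t = 0" if "t \<noteq> 0" for t
        using less.IH[OF d'(1) 1[of t]] 2[OF that] d'(2) Mt[of t] by simp
      then have "UNIV - {0} \<subseteq> {t. poly P t = 0}" by auto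
      moreover have "infinite (UNIV - {0 :: 'k})" using infinite_alg_closed by simp
      ultimately have "infinite {t. poly P t = 0}" using finite_subset by blast
      then have "P = 0" using poly_roots_finite by blast
      then have "eval (\<lambda>p. mat m n (\<lambda>(x, y). M $$ (x, y) + 0 * C x y) $$ p) g = 0" using Mt[of 0] by simp
      moreover have "mat m n (\<lambda>(x, y). M $$ (x, y) + 0 * C x y) = M"
        by (rule eq_matI) (use Mc in auto)
      ultimately show ?thesis by simp
    qed
  qed
  \<comment> \<open>The value \<open>n + 1\<close> covers every matrix, whether or not row \<open>i\<close> has a pivot.\<close>
  show ?thesis by (rule main[OF M, of "Suc n"]) simp
qed

text \<open>
  All other entries weakly north-west of a nonzero entry with minimal \<open>i + j\<close> are zero. In the normal
  form the entry \<open>(i, j)\<close> is then nonzero as well, and it is counted in addition to the entries in the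
  first \<open>i\<close> rows and those in the first \<open>j\<close> columns, which are disjoint sets.
\<close>

lemma outer_corner:
  fixes w :: "'k::field mat"
  assumes w: "w \<in> carrier_mat m n" and nz: "w \<noteq> 0\<^sub>m m n"
  obtains i j where "i < m" "j < n" "w $$ (i, j) \<noteq> 0"
    "corner_rank w (Suc i) j = 0" "corner_rank w i (Suc j) = 0"
    "\<And>a b. i < a \<Longrightarrow> a \<le> m \<Longrightarrow> j < b \<Longrightarrow> b \<le> n \<Longrightarrow>
      corner_rank w i b + corner_rank w a j < corner_rank w a b"
proof -
  have "\<exists>p. fst p < m \<and> snd p < n \<and> w $$ p \<noteq> 0"
  proof (rule ccontr)
    assume *: "\<nexists>p. fst p < m \<and> snd p < n \<and> w $$ p \<noteq> 0"
    have "w = 0\<^sub>m m n"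
    proof (rule eq_matI)
      fix x y assume "x < dim_row (0\<^sub>m m n :: 'k mat)" "y < dim_col (0\<^sub>m m n :: 'k mat)"
      then show "w $$ (x, y) = 0\<^sub>m m n $$ (x, y)" using * by (metis fst_conv snd_conv index_zero_mat)
    qed (use w in auto)
    then show False using nz by simp
  qed
  then obtain p where p: "fst p < m \<and> snd p < n \<and> w $$ p \<noteq> 0"
    and pmin: "\<And>p'. fst p' < m \<and> snd p' < n \<and> w $$ p' \<noteq> 0 \<Longrightarrow> fst p + snd p \<le> fst p' + snd p'"
    using ex_has_least_nat[of "\<lambda>p. fst p < m \<and> snd p < n \<and> w $$ p \<noteq> 0" _ "\<lambda>p. fst p + snd p"] by metis
  define i j where "i = fst p" and "j = snd p"
  have ij: "i < m" "j < n" and wij: "w $$ (i, j) \<noteq> 0" using p by (auto simp: i_def j_def)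
  have box: "w $$ (x, y) = 0" if "x \<le> i" "y \<le> j" "x + y < i + j" for x y
    using pmin[of "(x, y)"] that ij unfolding i_def[symmetric] j_def[symmetric] by fastforce
  have le: "Suc i \<le> m" "Suc j \<le> n" "i \<le> m" "j \<le> n" using ij by auto
  have "corner (Suc i) j w = 0\<^sub>m (Suc i) j"
    by (rule eq_matI) (use box in \<open>auto simp: corner_def\<close>)
  then have z1: "corner_rank w (Suc i) j = 0"
    using corner_rank_eq[OF w le(1,4)] vec_space.rank_0I by simp
  have "corner i (Suc j) w = 0\<^sub>m i (Suc j)"
    by (rule eq_matI) (use box in \<open>auto simp: corner_def\<close>)
  then have z2: "corner_rank w i (Suc j) = 0"
    using corner_rank_eq[OF w le(3,2)] vec_space.rank_0I by simp
  obtain L v U where L: "unit_lower m L" and U: "unit_upper n U" and v: "v \<in> carrier_mat m n"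
    and pp: "partial_perm m n v" and wLvU: "w = L * v * U" using normal_form[OF w] .
  have rw: "corner_rank w a b = card (dots v a b)" if "a \<le> m" "b \<le> n" for a b
    using corner_rank_mult_triangular(1)[OF L U v that] corner_rank_partial_perm[OF v that partial_perm_mono[OF pp that]] wLvU
    by simp
  have e1: "dots v (Suc i) j = {}" and e2: "dots v i (Suc j) = {}"
    using rw[OF le(1,4)] rw[OF le(3,2)] z1 z2 by auto
  have "corner_rank w (Suc i) (Suc j) \<noteq> 0"
    using corner_rank_zero_entries[OF w le(1,2), of i j] wij by auto
  then have "dots v (Suc i) (Suc j) \<noteq> {}" using rw[OF le(1,2)] by auto
  then obtain x y where xy: "x < Suc i" "y < Suc j" "v $$ (x, y) \<noteq> 0" by (auto simp: dots_def)
  have "\<not> y < j"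
  proof
    assume "y < j"
    then have "(x, y) \<in> dots v (Suc i) j" using xy by (simp add: dots_def)
    then show False using e1 by simp
  qed
  moreover have "\<not> x < i"
  proof
    assume "x < i"
    then have "(x, y) \<in> dots v i (Suc j)" using xy by (simp add: dots_def)
    then show False using e2 by simp
  qed
  ultimately have "x = i" "y = j" using xy by auto
  then have vij: "v $$ (i, j) \<noteq> 0" using xy by simp
  have "corner_rank w i b + corner_rank w a j < corner_rank w a b"
    if ab: "i < a" "a \<le> m" "j < b" "b \<le> n" for a b
  proof -
    have disj: "dots v i b \<inter> dots v a j = {}"
    proof (rule ccontr)
      assume "dots v i b \<inter> dots v a j \<noteq> {}"
      then obtain p where "p \<in> dots v i b" "p \<in> dots v a j" by blast
      then have "p \<in> dots v i (Suc j)" by (auto simp: dots_def)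
      then show False using e2 by simp
    qed
    have "corner_rank w i b + corner_rank w a j = card (dots v i b \<union> dots v a j)"
      using rw[of i b] rw[of a j] ab le by (simp add: card_Un_disjoint[OF _ _ disj])
    also have "\<dots> < card (insert (i, j) (dots v i b \<union> dots v a j))"
      by (subst card_insert_disjoint) (auto simp: dots_def)
    also have "\<dots> \<le> card (dots v a b)"
      by (rule card_mono) (use ab vij in \<open>auto simp: dots_def\<close>)
    finally show ?thesis using rw[of a b] ab by simp
  qed
  then show thesis using that[OF ij wij z1 z2] by blast
qed

section \<open>Dependence on the corner ranks\<close>

lemma self_in_MSV: "w \<in> carrier_mat m n \<Longrightarrow> w \<in> MSV m n w"
  by (simp add: MSV_def)

lemma MSV_mono:
  assumes "\<And>a b. a \<in> {1..m} \<Longrightarrow> b \<in> {1..n} \<Longrightarrow> corner_rank w' a b \<le> corner_rank w a b"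
  shows "MSV m n w' \<subseteq> MSV m n w"
  unfolding MSV_def using assms order_trans by blast

lemma corner_rank_zero_mat: "a \<le> m \<Longrightarrow> b \<le> n \<Longrightarrow> corner_rank (0\<^sub>m m n :: 'k::field mat) a b = 0"
proof -
  assume ab: "a \<le> m" "b \<le> n"
  have "corner a b (0\<^sub>m m n :: 'k mat) = 0\<^sub>m a b"
    by (rule eq_matI) (use ab in \<open>auto simp: corner_def\<close>)
  then show ?thesis using corner_rank_eq[OF zero_carrier_mat ab, where 'a='k] vec_space.rank_0I by simp
qed

lemma zero_in_MSV: "0\<^sub>m m n \<in> MSV m n w"
  by (simp add: MSV_def corner_rank_zero_mat)

lemma vanishing_ideal_proper:
  "w \<in> carrier_mat m n \<Longrightarrow> vanishing_ideal m n (MSV m n w) \<noteq> carrier (mpoly_ring (mat_vars m n))"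
proof
  assume w: "w \<in> carrier_mat m n" "vanishing_ideal m n (MSV m n w) = carrier (mpoly_ring (mat_vars m n))"
  then have "1 \<in> vanishing_ideal m n (MSV m n w)" by simp
  then show False using self_in_MSV[OF w(1)] by (auto simp: vanishing_ideal_def)
qed

lemma J_ideal_proper: "J_ideal m n w \<noteq> carrier (mpoly_ring (mat_vars m n))"
proof
  assume "J_ideal m n w = carrier (mpoly_ring (mat_vars m n))"
  then have "1 \<in> J_ideal m n w" by simp
  then show False by (auto simp: mem_J_ideal_iff has_antidiagonal_def antidiagonal_def)
qed

text \<open>
  Let \<open>k\<close> be the corner rank of \<open>w\<close> and choose \<open>X\<close>, \<open>Y\<close> as in \<open>corner_rank_witness\<close>. The
  determinant of \<open>X * G * Y\<close> with the generic corner \<open>G\<close> is a polynomial with value one at \<open>w\<close>. It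
  vanishes wherever the corner rank is less than \<open>k\<close>.
\<close>

lemma corner_rank_le_if_ideal_subset:
  fixes w w' :: "'k::field mat"
  assumes w: "w \<in> carrier_mat m n"
    and sub: "vanishing_ideal m n (MSV m n w') \<subseteq> vanishing_ideal m n (MSV m n w)"
    and ab: "a \<in> {1..m}" "b \<in> {1..n}"
  shows "corner_rank w a b \<le> corner_rank w' a b"
proof (rule ccontr)
  assume gt: "\<not> corner_rank w a b \<le> corner_rank w' a b"
  define k where "k = corner_rank w a b"
  have le: "a \<le> m" "b \<le> n" using ab by auto
  obtain X Y where X: "X \<in> carrier_mat k a" and Y: "Y \<in> carrier_mat b k" and XY: "X * corner a b w * Y = 1\<^sub>m k"
    using corner_rank_witness[OF w le] unfolding k_def by blast
  define G :: "(nat \<times> nat, 'k) mpoly mat" where "G = mat a b var"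
  define F where "F = map_mat const X * G * map_mat const Y"
  have c: "map_mat const X \<in> carrier_mat k a" "G \<in> carrier_mat a b" "map_mat const Y \<in> carrier_mat b k"
    using X Y by (auto simp: G_def)
  have Fc: "F \<in> carrier_mat k k" using c unfolding F_def by simp
  have XG: "(map_mat const X * G) $$ (l, y) \<in> carrier (mpoly_ring (mat_vars m n))" if "l < k" "y < b" for l y
  proof -
    have "(map_mat const X * G) $$ (l, y) = (\<Sum>x<a. map_mat const X $$ (l, x) * G $$ (x, y))"
      by (rule mult_mat_index[OF c(1,2) that])
    also have "\<dots> \<in> carrier (mpoly_ring (mat_vars m n))"
      by (intro carrier_sum carrier_mult)
         (use that X le in \<open>auto simp: G_def mat_vars_def intro!: const_in_carrier var_in_carrier\<close>)
    finally show ?thesis .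
  qed
  have "F $$ (l, l') \<in> carrier (mpoly_ring (mat_vars m n))" if "l < k" "l' < k" for l l'
  proof -
    have "F $$ (l, l') = (\<Sum>y<b. (map_mat const X * G) $$ (l, y) * map_mat const Y $$ (y, l'))"
      unfolding F_def by (rule mult_mat_index[OF _ c(3) that]) (use c in auto)
    also have "\<dots> \<in> carrier (mpoly_ring (mat_vars m n))"
      by (intro carrier_sum carrier_mult XG) (use that Y in \<open>auto intro!: const_in_carrier\<close>)
    finally show ?thesis .
  qed
  then have Fcarr: "det F \<in> carrier (mpoly_ring (mat_vars m n))" by (rule det_in_carrier[OF Fc])
  have ev: "eval (\<lambda>p. M $$ p) (det F) = det (X * corner a b M * Y)" for M :: "'k mat"
  proof -
    interpret E: comm_ring_hom "eval (\<lambda>p. M $$ p)" by (rule eval_hom)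
    have "map_mat (eval (\<lambda>p. M $$ p)) F = X * corner a b M * Y"
      unfolding F_def
    proof (subst E.mat_hom_mult[OF _ c(3)])
      show "map_mat const X * G \<in> carrier_mat k b" using c by simp
      have "map_mat (eval (\<lambda>p. M $$ p)) (map_mat const Z) = Z" for Z :: "'k mat" by (rule eq_matI) auto
      moreover have "map_mat (eval (\<lambda>p. M $$ p)) G = corner a b M"
        by (rule eq_matI) (auto simp: G_def corner_def)
      ultimately show "map_mat (eval (\<lambda>p. M $$ p)) (map_mat const X * G) * map_mat (eval (\<lambda>p. M $$ p)) (map_mat const Y)
          = X * corner a b M * Y"
        by (simp add: E.mat_hom_mult[OF c(1,2)])
    qed
    then show ?thesis using eval_det[OF Fc] by simp
  qed
  have "eval (\<lambda>p. M $$ p) (det F) = 0" if M: "M \<in> MSV m n w'" for M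
    unfolding ev
  proof (rule det_zero_of_rank_less)
    have Mc: "M \<in> carrier_mat m n" and r: "corner_rank M a b \<le> corner_rank w' a b"
      using M ab by (auto simp: MSV_def)
    show "X * corner a b M * Y \<in> carrier_mat k k"
      by (rule mult_carrier_mat[OF mult_carrier_mat[OF X corner_carrier] Y])
    have "vec_space.rank k (X * corner a b M * Y) \<le> vec_space.rank a (corner a b M)"
      by (rule rank_mult_both_sides[OF X _ Y]) simp
    then show "vec_space.rank k (X * corner a b M * Y) < k"
      using r gt corner_rank_eq[OF Mc le] by (simp add: k_def)
  qed
  then have "det F \<in> vanishing_ideal m n (MSV m n w')" using Fcarr by (simp add: vanishing_ideal_def)
  then have "eval (\<lambda>p. w $$ p) (det F) = 0"
    using sub self_in_MSV[OF w] by (auto simp: vanishing_ideal_def)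
  then show False unfolding ev XY by simp
qed

lemma J_idealI:
  assumes "p \<in> carrier (mpoly_ring (mat_vars m n))"
    "\<And>t. t \<in> supp p \<Longrightarrow> \<exists>i\<in>{1..m}. \<exists>j\<in>{1..n}.
      has_antidiagonal (supp t) i j (Suc (corner_rank w i j))"
  shows "p \<in> J_ideal m n w"
  unfolding mem_J_ideal_iff by (intro conjI ballI assms)

lemma J_idealE:
  assumes "p \<in> J_ideal m n w" "t \<in> supp p"
  obtains i j where "i \<in> {1..m}" "j \<in> {1..n}"
    "has_antidiagonal (supp t) i j (Suc (corner_rank w i j))"
proof -
  have "\<exists>i\<in>{1..m}. \<exists>j\<in>{1..n}. has_antidiagonal (supp t) i j (Suc (corner_rank w i j))"
    by (rule assms(1)[unfolded mem_J_ideal_iff, THEN conjunct2, THEN bspec, OF assms(2)])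
  then show thesis by (elim bexE) (rule that)
qed

lemma J_ideal_carrier: "p \<in> J_ideal m n w \<Longrightarrow> p \<in> carrier (mpoly_ring (mat_vars m n))"
  by (simp only: mem_J_ideal_iff)

lemma J_ideal_mono:
  assumes "\<And>a b. a \<in> {1..m} \<Longrightarrow> b \<in> {1..n} \<Longrightarrow> corner_rank w' a b \<le> corner_rank w a b"
  shows "J_ideal m n w \<subseteq> J_ideal m n (w' :: 'k::field mat)"
proof
  fix p assume p: "p \<in> J_ideal m n w"
  show "p \<in> J_ideal m n w'"
  proof (rule J_idealI[OF J_ideal_carrier[OF p]])
    fix t assume "t \<in> supp p"
    then obtain i j where ij: "i \<in> {1..m}" "j \<in> {1..n}"
      "has_antidiagonal (supp t) i j (Suc (corner_rank w i j))"
      by (rule J_idealE[OF p])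
    have "has_antidiagonal (supp t) i j (Suc (corner_rank w' i j))"
      by (rule has_antidiagonal_mono[OF ij(3)]) (use assms[OF ij(1,2)] in auto)
    then show "\<exists>i\<in>{1..m}. \<exists>j\<in>{1..n}. has_antidiagonal (supp t) i j (Suc (corner_rank w' i j))"
      by (intro bexI[OF _ ij(1)] bexI[OF _ ij(2)])
  qed
qed

lemma J_ideal_cong:
  assumes "\<And>a b. a \<in> {1..m} \<Longrightarrow> b \<in> {1..n} \<Longrightarrow> corner_rank w' a b = corner_rank w a b"
  shows "J_ideal m n w' = J_ideal m n (w :: 'k::field mat)"
  by (rule subset_antisym; rule J_ideal_mono) (simp_all only: assms order_refl)

section \<open>The ideal of the origin\<close>

lemma eval_zero:
  fixes f :: "('v, 'k::field) mpoly"
  shows "eval (\<lambda>_. 0) f = Poly_Mapping.lookup f 0"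
proof -
  have m: "monom_eval (\<lambda>_. 0) t = (if t = 0 then 1 else (0 :: 'k))" for t :: "'v monom"
  proof (cases "t = 0")
    case True
    then show ?thesis by (simp add: monom_eval_def)
  next
    case False
    then obtain v where v: "v \<in> supp t" by (metis ex_in_conv keys_eq_empty)
    then have "monom_eval (\<lambda>_. 0 :: 'k) t = 0"
      unfolding monom_eval_def by (intro prod_zero[OF finite_keys]) (auto simp: in_keys_iff)
    then show ?thesis using False by simp
  qed
  have "eval (\<lambda>_. 0) f = (\<Sum>t \<in> supp f. Poly_Mapping.lookup f t * monom_eval (\<lambda>_. 0) t)"
    by (rule eval_superset) auto
  also have "\<dots> = (\<Sum>t \<in> supp f. if t = 0 then Poly_Mapping.lookup f 0 else 0)"
    by (rule sum.cong) (auto simp: m)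
  finally show ?thesis by (simp add: in_keys_iff)
qed

lemma single_1_neq_0: "Poly_Mapping.single p (1 :: nat) \<noteq> 0"
  by (metis lookup_single_eq lookup_zero zero_neq_one)

definition origin_ideal :: "'v set \<Rightarrow> ('v, 'k::field) mpoly set" where
  "origin_ideal V = {f \<in> carrier (mpoly_ring V). Poly_Mapping.lookup f 0 = 0}"

lemma origin_ideal_eq: "origin_ideal (mat_vars m n) = vanishing_ideal m n {0\<^sub>m m n}"
proof -
  have "eval (\<lambda>p. 0\<^sub>m m n $$ p) f = Poly_Mapping.lookup f 0"
    if "f \<in> carrier (mpoly_ring (mat_vars m n))" for f :: "(nat \<times> nat, 'a) mpoly"
    unfolding eval_zero[symmetric] by (rule eval_cong[OF that]) (auto simp: mat_vars_def)
  then show ?thesis unfolding origin_ideal_def vanishing_ideal_def by auto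
qed

text \<open>
  An ideal with a further element contains the constant term of this element, a unit.
\<close>

lemma origin_ideal_maximal:
  "maximalideal (origin_ideal (mat_vars m n) :: (nat \<times> nat, 'k::field) mpoly set) (mpoly_ring (mat_vars m n))"
proof (rule maximalidealI)
  let ?Z = "origin_ideal (mat_vars m n) :: (nat \<times> nat, 'k) mpoly set"
  let ?S = "mpoly_ring (mat_vars m n) :: (nat \<times> nat, 'k) mpoly ring"
  show "ideal ?Z ?S" unfolding origin_ideal_eq by (rule vanishing_ideal_ideal)
  have "(1 :: (nat \<times> nat, 'k) mpoly) \<notin> ?Z" by (simp add: origin_ideal_def)
  then show "carrier ?S \<noteq> ?Z" using carrier_1 by blast
  fix J assume J: "ideal J ?S" "?Z \<subseteq> J" "J \<subseteq> carrier ?S"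
  show "J = ?Z \<or> J = carrier ?S"
  proof (cases "J \<subseteq> ?Z")
    case True
    then show ?thesis using J by blast
  next
    case False
    then obtain g where g: "g \<in> J" "g \<notin> ?Z" by blast
    define c where "c = Poly_Mapping.lookup g 0"
    have gc: "g \<in> carrier ?S" using g J by blast
    then have c0: "c \<noteq> 0" using g(2) by (simp add: origin_ideal_def c_def)
    have "g + const (- c) \<in> ?Z"
      using carrier_add[OF gc const_in_carrier[of "- c"]] by (simp add: origin_ideal_def lookup_add const_def c_def)
    then have "g + const (- c) \<in> J" using J by blast
    then have "- 1 * (g + const (- c)) \<in> J" using J(1) unfolding ideal_mpoly_ring_iff by (metis carrier_1 carrier_uminus)
    then have "g + - 1 * (g + const (- c)) \<in> J" using J(1) g(1) unfolding ideal_mpoly_ring_iff by metis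
    moreover have "g + - 1 * (g + const (- c)) = const c"
      by (simp add: algebra_simps const_def single_uminus)
    ultimately have "const c \<in> J" by simp
    then have "const (1 / c) * const c \<in> J" using J(1) const_in_carrier unfolding ideal_mpoly_ring_iff by blast
    then have one: "1 \<in> J" using c0 by (simp add: const_def mult_single)
    have "p \<in> J" if "p \<in> carrier ?S" for p
    proof -
      have "p * 1 \<in> J" using J(1) one that unfolding ideal_mpoly_ring_iff by blast
      then show ?thesis by simp
    qed
    then show ?thesis using J by blast
  qed
qed

lemma vanishing_ideal_subset_origin: "vanishing_ideal m n (MSV m n w) \<subseteq> origin_ideal (mat_vars m n)"
  unfolding origin_ideal_eq using zero_in_MSV by (auto simp: vanishing_ideal_def)

lemma vanishing_ideal_zero: "vanishing_ideal m n (MSV m n (0\<^sub>m m n)) = origin_ideal (mat_vars m n)"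
proof -
  have "MSV m n (0\<^sub>m m n) = {0\<^sub>m m n :: 'a mat}"
  proof
    show "MSV m n (0\<^sub>m m n) \<subseteq> {0\<^sub>m m n :: 'a mat}"
    proof
      fix M :: "'a mat" assume M: "M \<in> MSV m n (0\<^sub>m m n)"
      then have Mc: "M \<in> carrier_mat m n" by (simp add: MSV_def)
      have "corner_rank M m n = 0"
        using MSV_corner_rank_le[OF M zero_carrier_mat order_refl order_refl] corner_rank_zero_mat[of m m n n, where ?'k='a] by simp
      then have "M $$ (x, y) = 0" if "x < m" "y < n" for x y
        using corner_rank_zero_entries[OF Mc order_refl order_refl] that by blast
      then have "M = 0\<^sub>m m n" using Mc by (intro eq_matI) auto
      then show "M \<in> {0\<^sub>m m n}" by simp
    qed
  qed (use zero_in_MSV in blast)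
  then show ?thesis by (simp add: origin_ideal_eq)
qed

text \<open>
  Every vanishing ideal in question is contained in the ideal of the origin, so a maximal one
  equals it. Then all variables vanish at \<open>w\<close>, so \<open>w = 0\<close> and \<open>J\<close> contains all polynomials
  without constant term, in particular the initial terms.
\<close>

lemma J_eq_init_if_maximal:
  fixes w :: "'k::field mat"
  assumes w: "w \<in> carrier_mat m n"
    and max: "maximalideal (vanishing_ideal m n (MSV m n w)) (mpoly_ring (mat_vars m n))"
  shows "J_ideal m n w = init_ideal revlex (vanishing_ideal m n (MSV m n w))"
proof
  let ?Z = "origin_ideal (mat_vars m n) :: (nat \<times> nat, 'k) mpoly set"
  let ?S = "mpoly_ring (mat_vars m n) :: (nat \<times> nat, 'k) mpoly ring"
  have Z: "ideal ?Z ?S" "carrier ?S \<noteq> ?Z"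
    by (rule maximalideal.axioms(1)[OF origin_ideal_maximal], rule maximalideal.I_notcarr[OF origin_ideal_maximal])
  have Zc: "?Z \<subseteq> carrier ?S" by (auto simp: origin_ideal_def)
  have I: "vanishing_ideal m n (MSV m n w) = ?Z"
    using maximalideal.I_maximal[OF max Z(1) vanishing_ideal_subset_origin Zc] Z(2) by auto
  have w0: "w $$ (x, y) = 0" if "x < m" "y < n" for x y
  proof -
    have "var (x, y) \<in> ?Z"
      using that var_in_carrier[of "(x, y)" "mat_vars m n"] single_1_neq_0[of "(x, y)"]
      by (auto simp: origin_ideal_def mat_vars_def var_def monomial_def lookup_single when_def)
    then show ?thesis unfolding I[symmetric] using self_in_MSV[OF w] by (auto simp: vanishing_ideal_def)
  qed
  have "w = 0\<^sub>m m n" by (rule eq_matI) (use w w0 in auto)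
  then have r0: "corner_rank w a b = 0" if "a \<le> m" "b \<le> n" for a b using corner_rank_zero_mat that by simp
  have J: "f \<in> J_ideal m n w" if "f \<in> ?Z" for f
  proof (rule J_idealI)
    show f: "f \<in> carrier ?S" using that by (simp add: origin_ideal_def)
    fix t assume t: "t \<in> supp f"
    then have "t \<noteq> 0" using that by (auto simp: origin_ideal_def in_keys_iff)
    then obtain p where p: "p \<in> supp t" by (metis ex_in_conv keys_eq_empty)
    then have "p \<in> mat_vars m n" using f t by (auto simp: carrier_mpoly_ring)
    then have pmn: "Suc (fst p) \<in> {1..m}" "Suc (snd p) \<in> {1..n}" by (auto simp: mat_vars_def)
    then have "corner_rank w (Suc (fst p)) (Suc (snd p)) = 0" by (intro r0) auto
    moreover have "antidiagonal (supp t) (Suc (fst p)) (Suc (snd p)) (Suc 0) (\<lambda>_. fst p) (\<lambda>_. snd p)"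
      using p by (simp add: antidiagonal_def)
    ultimately show "\<exists>i\<in>{1..m}. \<exists>j\<in>{1..n}. has_antidiagonal (supp t) i j (Suc (corner_rank w i j))"
      using pmn unfolding has_antidiagonal_def by metis
  qed
  interpret K: Modules.module "\<lambda>c p. const c * p :: (nat \<times> nat, 'k) mpoly" by (rule kspan_module)
  have "init revlex f \<in> J_ideal m n w" if f: "f \<in> ?Z" for f
  proof (cases "f = 0")
    case True
    then show ?thesis using J[OF f] by (simp add: init_def)
  next
    case False
    then obtain t where t: "t \<in> supp f" "init revlex f = monomial t" using init_in_keys by blast
    have "t \<noteq> 0" using t f by (auto simp: origin_ideal_def in_keys_iff)
    moreover have "supp t \<subseteq> mat_vars m n" using t(1) f by (auto simp: origin_ideal_def carrier_mpoly_ring)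
    ultimately have "monomial t \<in> ?Z"
      by (auto simp: origin_ideal_def monomial_def lookup_single when_def intro!: carrier_single)
    then show ?thesis using J t(2) by simp
  qed
  moreover have "K.subspace (J_ideal m n w)"
    using J_ideal_ideal[of m n w] const_in_carrier unfolding K.subspace_def ideal_mpoly_ring_iff by blast
  ultimately show "init_ideal revlex (vanishing_ideal m n (MSV m n w)) \<subseteq> J_ideal m n w"
    unfolding init_ideal_def kspan_def I by (intro K.span_minimal) auto
qed (rule J_subset_init_ideal)

lemma maximal_if_zero: "maximalideal (vanishing_ideal m n (MSV m n (0\<^sub>m m n :: 'k::field mat))) (mpoly_ring (mat_vars m n))"
  unfolding vanishing_ideal_zero by (rule origin_ideal_maximal)

section \<open>The transition at an outer corner\<close>

lemma init_var: "init revlex (var p :: (nat \<times> nat, 'k::field) mpoly) = var p"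
  unfolding var_def by (rule init_eqI) (auto simp: monomial_def)

lemma var_not_const: "(var p :: ('v, 'k::field) mpoly) \<notin> range const"
proof
  assume "(var p :: ('v, 'k) mpoly) \<in> range const"
  then obtain c where "(var p :: ('v, 'k) mpoly) = const c" by blast
  then have "Poly_Mapping.lookup (var p :: ('v, 'k) mpoly) (Poly_Mapping.single p 1) =
      Poly_Mapping.lookup (const c) (Poly_Mapping.single p 1)" by simp
  then show False using single_1_neq_0[of p] by (simp add: var_def monomial_def const_def lookup_single when_def)
qed

lemma mem_set_add_iff: "x \<in> A <+>\<^bsub>mpoly_ring V\<^esub> B \<longleftrightarrow> (\<exists>a\<in>A. \<exists>b\<in>B. x = a + b)"
  by (auto simp: set_add_def')

text \<open>
  The matrix \<open>w'\<close> has the antidiagonal lengths of \<open>S\<close> as corner ranks. As \<open>S\<close> avoids \<open>(i, j)\<close>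
  and the rest of the corner ending there, this corner of \<open>w'\<close> has rank zero.
\<close>

lemma matrix_below_avoiding_support:
  fixes w :: "'k::field mat"
  assumes w: "w \<in> carrier_mat m n" and ij: "i < m" "j < n"
    and zero: "corner_rank w (Suc i) j = 0" "corner_rank w i (Suc j) = 0"
    and S: "(i, j) \<notin> S"
    and free: "\<And>a b. a \<in> {1..m} \<Longrightarrow> b \<in> {1..n} \<Longrightarrow> \<not> has_antidiagonal S a b (Suc (corner_rank w a b))"
  obtains w' :: "'k mat" where "w' \<in> carrier_mat m n"
    "\<And>a b. a \<in> {1..m} \<Longrightarrow> b \<in> {1..n} \<Longrightarrow> corner_rank w' a b \<le> corner_rank w a b"
    "corner_rank w' (Suc i) (Suc j) = 0"
    "\<And>a b. a \<in> {1..m} \<Longrightarrow> b \<in> {1..n} \<Longrightarrow> \<not> has_antidiagonal S a b (Suc (corner_rank w' a b))"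
proof -
  obtain w' :: "'k mat" where w': "w' \<in> carrier_mat m n"
    and r: "\<And>a b. a \<le> m \<Longrightarrow> b \<le> n \<Longrightarrow> corner_rank w' a b = antidiag_rank S a b"
    using antidiag_rank_realised[of m n S, where 'k='k] by blast
  have "corner_rank w' a b \<le> corner_rank w a b" if "a \<in> {1..m}" "b \<in> {1..n}" for a b
    using free[OF that] r[of a b] that by (simp add: has_antidiagonal_iff)
  moreover have "\<not> has_antidiagonal S (Suc i) (Suc j) (Suc 0)"
  proof
    assume "has_antidiagonal S (Suc i) (Suc j) (Suc 0)"
    then obtain f g where "antidiagonal S (Suc i) (Suc j) (Suc 0) f g"
      by (auto simp: has_antidiagonal_def)
    then have fg: "f 0 \<le> i" "g 0 \<le> j" "(f 0, g 0) \<in> S" by (auto simp: antidiagonal_def)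
    have "f 0 < i \<or> g 0 < j" using fg S by (metis le_neq_implies_less)
    then show False
    proof
      assume *: "f 0 < i"
      have "antidiagonal S i (Suc j) (Suc 0) (\<lambda>_. f 0) (\<lambda>_. g 0)" using fg * by (simp add: antidiagonal_def)
      then have "has_antidiagonal S i (Suc j) (Suc (corner_rank w i (Suc j)))"
        unfolding zero has_antidiagonal_def by blast
      then show False using free[of i "Suc j"] * ij by simp
    next
      assume *: "g 0 < j"
      have "antidiagonal S (Suc i) j (Suc 0) (\<lambda>_. f 0) (\<lambda>_. g 0)" using fg * by (simp add: antidiagonal_def)
      then have "has_antidiagonal S (Suc i) j (Suc (corner_rank w (Suc i) j))"
        unfolding zero has_antidiagonal_def by blast
      then show False using free[of "Suc i" j] * ij by simp
    qed
  qed
  then have "corner_rank w' (Suc i) (Suc j) = 0" using r[of "Suc i" "Suc j"] ij by (simp add: has_antidiagonal_iff)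
  moreover have "\<not> has_antidiagonal S a b (Suc (corner_rank w' a b))" if "a \<in> {1..m}" "b \<in> {1..n}" for a b
    using r[of a b] that by (simp add: has_antidiagonal_iff)
  ultimately show thesis using that[OF w'] by blast
qed

text \<open>
  For the inclusion of the intersection in the sum, split \<open>p\<close> into the terms divisible by the
  variable and the others. If one of the latter were outside the ideal of \<open>w\<close>, it would be outside
  the ideal of the matrix from \<open>matrix_below_avoiding_support\<close>.
\<close>

lemma J_ideal_transition:
  fixes w :: "'k::field mat"
  assumes w: "w \<in> carrier_mat m n" and ij: "i < m" "j < n"
    and zero: "corner_rank w (Suc i) j = 0" "corner_rank w i (Suc j) = 0"
  defines "W \<equiv> {w' \<in> carrier_mat m n. (\<forall>a\<in>{1..m}. \<forall>b\<in>{1..n}. corner_rank w' a b \<le> corner_rank w a b) \<and>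
      corner_rank w' (Suc i) (Suc j) = 0}"
  shows "J_ideal m n w <+>\<^bsub>mpoly_ring (mat_vars m n)\<^esub> genideal (mpoly_ring (mat_vars m n)) {var (i, j)} =
    (\<Inter>w'\<in>W. J_ideal m n w')" (is "?L = ?R")
proof
  let ?S = "mpoly_ring (mat_vars m n) :: (nat \<times> nat, 'k) mpoly ring"
  have v: "(var (i, j) :: (nat \<times> nat, 'k) mpoly) \<in> carrier ?S"
    using ij by (intro var_in_carrier) (simp add: mat_vars_def)
  then have G: "ideal (genideal ?S {var (i, j)}) ?S"
    by (intro ring.genideal_ideal[OF mpoly_ring_ring]) simp
  have vG: "var (i, j) \<in> genideal ?S {var (i, j)}"
    using ring.genideal_self[OF mpoly_ring_ring, of "{var (i, j)}"] v by simp
  show "?L \<subseteq> ?R"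
  proof
    fix x assume "x \<in> ?L"
    then obtain p q where pq: "p \<in> J_ideal m n w" "q \<in> genideal ?S {var (i, j)}" "x = p + q"
      unfolding mem_set_add_iff by blast
    have "x \<in> J_ideal m n w'" if w': "w' \<in> W" for w'
    proof -
      have "p \<in> J_ideal m n w'" using pq(1) w' J_ideal_mono[of m n w' w] by (auto simp: W_def)
      moreover have "var (i, j) \<in> J_ideal m n w'"
      proof -
        have "antidiagonal {(i, j)} (Suc i) (Suc j) (Suc 0) (\<lambda>_. i) (\<lambda>_. j)" by (simp add: antidiagonal_def)
        moreover have "corner_rank w' (Suc i) (Suc j) = 0" using w' by (simp add: W_def)
        moreover have "Suc i \<in> {1..m}" "Suc j \<in> {1..n}" using ij by auto
        ultimately have "\<exists>a\<in>{1..m}. \<exists>b\<in>{1..n}. has_antidiagonal {(i, j)} a b (Suc (corner_rank w' a b))"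
          unfolding has_antidiagonal_def by metis
        then show ?thesis using v by (intro J_idealI) (simp_all add: var_def monomial_def)
      qed
      then have "genideal ?S {var (i, j)} \<subseteq> J_ideal m n w'"
        by (intro ring.genideal_minimal[OF mpoly_ring_ring J_ideal_ideal]) simp
      ultimately show ?thesis using pq J_ideal_ideal[of m n w'] unfolding ideal_mpoly_ring_iff by blast
    qed
    then show "x \<in> ?R" by blast
  qed
  show "?R \<subseteq> ?L"
  proof
    fix p assume p: "p \<in> ?R"
    have "0\<^sub>m m n \<in> W" using ij by (simp add: W_def corner_rank_zero_mat)
    then have "p \<in> J_ideal m n (0\<^sub>m m n)" using p by blast
    then have pc: "p \<in> carrier ?S" by (rule J_ideal_carrier)
    let ?s = "\<lambda>t. Poly_Mapping.single t (Poly_Mapping.lookup p t)"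
    let ?A = "{t \<in> supp p. (i, j) \<notin> supp t}"
    let ?B = "{t \<in> supp p. (i, j) \<in> supp t}"
    have "?s t \<in> J_ideal m n w" if t: "t \<in> ?A" for t
    proof -
      have "\<exists>a\<in>{1..m}. \<exists>b\<in>{1..n}. has_antidiagonal (supp t) a b (Suc (corner_rank w a b))"
      proof (rule ccontr)
        assume "\<not> ?thesis"
        then have free: "\<not> has_antidiagonal (supp t) a b (Suc (corner_rank w a b))"
          if "a \<in> {1..m}" "b \<in> {1..n}" for a b using that by blast
        have ntS: "(i, j) \<notin> supp t" using t by simp
        obtain w' :: "'k mat" where w': "w' \<in> carrier_mat m n"
          "\<And>a b. a \<in> {1..m} \<Longrightarrow> b \<in> {1..n} \<Longrightarrow> corner_rank w' a b \<le> corner_rank w a b"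
          "corner_rank w' (Suc i) (Suc j) = 0"
          and nw': "\<And>a b. a \<in> {1..m} \<Longrightarrow> b \<in> {1..n} \<Longrightarrow>
            \<not> has_antidiagonal (supp t) a b (Suc (corner_rank w' a b))"
          by (rule matrix_below_avoiding_support[OF w ij zero ntS free]; (assumption | (rule that; assumption)))
        have "w' \<in> W" using w' by (simp add: W_def)
        then have "p \<in> J_ideal m n w'" using p by blast
        moreover have "t \<in> supp p" using t by simp
        ultimately obtain a b where "a \<in> {1..m}" "b \<in> {1..n}"
          "has_antidiagonal (supp t) a b (Suc (corner_rank w' a b))" by (rule J_idealE)
        then show False using nw' by blast
      qed
      moreover have "?s t \<in> carrier ?S" using pc t by (intro carrier_single) (auto simp: carrier_mpoly_ring)
      ultimately show ?thesis by (intro J_idealI) (auto split: if_splits)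
    qed
    then have A: "sum ?s ?A \<in> J_ideal m n w" by (intro ideal_sum[OF J_ideal_ideal])
    have "?s t \<in> genideal ?S {var (i, j)}" if t: "t \<in> ?B" for t
    proof -
      let ?e = "Poly_Mapping.single (i, j) (1 :: nat)"
      have te: "t = (t - ?e) + ?e"
      proof (rule poly_mapping_eqI)
        fix q
        show "Poly_Mapping.lookup t q = Poly_Mapping.lookup ((t - ?e) + ?e) q"
          using t by (auto simp: lookup_add lookup_minus lookup_single when_def in_keys_iff)
      qed
      have "supp t \<subseteq> mat_vars m n" using pc t by (auto simp: carrier_mpoly_ring)
      then have "supp (t - ?e) \<subseteq> mat_vars m n" using te keys_add_monom[of "t - ?e" ?e] by auto
      then have "Poly_Mapping.single (t - ?e) (Poly_Mapping.lookup p t) * var (i, j) \<in> genideal ?S {var (i, j)}"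
        using G vG carrier_single unfolding ideal_mpoly_ring_iff by blast
      moreover have "Poly_Mapping.single (t - ?e) (Poly_Mapping.lookup p t) * var (i, j) = ?s t"
        unfolding var_def monomial_def mult_single te[symmetric] by simp
      ultimately show ?thesis by simp
    qed
    then have B: "sum ?s ?B \<in> genideal ?S {var (i, j)}" by (intro ideal_sum[OF G])
    have "p = sum ?s (supp p)" by (rule poly_mapping_sum_single)
    also have "supp p = ?A \<union> ?B" by blast
    also have "sum ?s (?A \<union> ?B) = sum ?s ?A + sum ?s ?B" by (rule sum.union_disjoint) auto
    finally show "p \<in> ?L" unfolding mem_set_add_iff using A B by blast
  qed
qed

lemma vanishing_ideal_sum_subset:
  fixes w w' :: "'k::field mat"
  assumes w': "w' \<in> carrier_mat m n" and ij: "i < m" "j < n"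
    and le: "\<And>a b. a \<in> {1..m} \<Longrightarrow> b \<in> {1..n} \<Longrightarrow> corner_rank w' a b \<le> corner_rank w a b"
    and z: "corner_rank w' (Suc i) (Suc j) = 0"
  shows "vanishing_ideal m n (MSV m n w) <+>\<^bsub>mpoly_ring (mat_vars m n)\<^esub>
      genideal (mpoly_ring (mat_vars m n)) {var (i, j)} \<subseteq> vanishing_ideal m n (MSV m n w')"
proof
  let ?S = "mpoly_ring (mat_vars m n) :: (nat \<times> nat, 'k) mpoly ring"
  let ?I' = "vanishing_ideal m n (MSV m n w')"
  fix x assume "x \<in> vanishing_ideal m n (MSV m n w) <+>\<^bsub>?S\<^esub> genideal ?S {var (i, j)}"
  then obtain p q where pq: "p \<in> vanishing_ideal m n (MSV m n w)" "q \<in> genideal ?S {var (i, j)}" "x = p + q"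
    unfolding mem_set_add_iff by blast
  have "p \<in> ?I'" using pq(1) MSV_mono[OF le] by (auto simp: vanishing_ideal_def)
  moreover have "var (i, j) \<in> ?I'"
  proof -
    have "M $$ (i, j) = 0" if M: "M \<in> MSV m n w'" for M
    proof -
      have Mc: "M \<in> carrier_mat m n" using M by (simp add: MSV_def)
      have le: "Suc i \<le> m" "Suc j \<le> n" using ij by auto
      have "corner_rank M (Suc i) (Suc j) = 0" using MSV_corner_rank_le[OF M w' le] z by simp
      then show ?thesis using corner_rank_zero_entries[OF Mc le, of i j] by simp
    qed
    moreover have "(var (i, j) :: (nat \<times> nat, 'k) mpoly) \<in> carrier ?S"
      using ij by (intro var_in_carrier) (simp add: mat_vars_def)
    ultimately show ?thesis by (simp add: vanishing_ideal_def)
  qed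
  then have "genideal ?S {var (i, j)} \<subseteq> ?I'"
    by (intro ring.genideal_minimal[OF mpoly_ring_ring vanishing_ideal_ideal]) simp
  ultimately show "x \<in> ?I'" using pq vanishing_ideal_ideal[of m n "MSV m n w'"] unfolding ideal_mpoly_ring_iff by blast
qed

lemma colon_var:
  fixes w :: "'k::alg_closed_field mat"
  assumes w: "w \<in> carrier_mat m n" and ij: "i < m" "j < n"
    and K: "\<And>a b. i < a \<Longrightarrow> a \<le> m \<Longrightarrow> j < b \<Longrightarrow> b \<le> n \<Longrightarrow>
      corner_rank w i b + corner_rank w a j < corner_rank w a b"
    and zero: "corner_rank w (Suc i) j = 0" "corner_rank w i (Suc j) = 0"
  shows "colon (mat_vars m n) (vanishing_ideal m n (MSV m n w)) (var (i, j)) = vanishing_ideal m n (MSV m n w)"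
    (is "?C = ?I")
proof
  show "?C \<subseteq> ?I"
  proof
    fix g assume g: "g \<in> ?C"
    then have gc: "g \<in> carrier (mpoly_ring (mat_vars m n))" and van: "var (i, j) * g \<in> ?I" by (auto simp: colon_def)
    have "M $$ (i, j) * eval (\<lambda>p. M $$ p) g = 0" if "M \<in> MSV m n w" for M
      using van that by (auto simp: vanishing_ideal_def eval_mult)
    then have "eval (\<lambda>p. M $$ p) g = 0" if "M \<in> MSV m n w" for M
      using vanishes_if_multiple_vanishes[OF w ij K zero gc _ that] by blast
    then show "g \<in> ?I" using gc by (simp add: vanishing_ideal_def)
  qed
  show "?I \<subseteq> ?C"
  proof -
    have "(var (i, j) :: (nat \<times> nat, 'k) mpoly) \<in> carrier (mpoly_ring (mat_vars m n))"
      using ij by (intro var_in_carrier) (simp add: mat_vars_def)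
    then show ?thesis
      using vanishing_ideal_ideal[of m n "MSV m n w"] unfolding colon_def ideal_mpoly_ring_iff by blast
  qed
qed

text \<open>
  Both ideals only depend on the corner ranks, which are bounded by \<open>n\<close>.
\<close>

lemma finite_matrix_schubert_pairs:
  "finite {(vanishing_ideal m n (MSV m n w), J_ideal m n w) | w :: 'k::field mat. w \<in> carrier_mat m n}"
proof -
  let ?F = "\<lambda>w :: 'k mat. (vanishing_ideal m n (MSV m n w), J_ideal m n w)"
  let ?r = "\<lambda>w :: 'k mat. restrict (\<lambda>(a, b). corner_rank w a b) ({1..m} \<times> {1..n})"
  let ?W = "carrier_mat m n :: 'k mat set"
  have "?r ` ?W \<subseteq> ({1..m} \<times> {1..n}) \<rightarrow>\<^sub>E {0..n}"
  proof
    fix r assume "r \<in> ?r ` ?W"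
    then obtain w where w: "w \<in> ?W" "r = ?r w" by blast
    have "corner_rank w a b \<le> n" if "a \<in> {1..m}" "b \<in> {1..n}" for a b
      using corner_rank_eq[OF w(1), of a b] vec_space.rank_le_nc[of "corner a b w" a b] that by simp
    then show "r \<in> ({1..m} \<times> {1..n}) \<rightarrow>\<^sub>E {0..n}" unfolding w(2) by auto
  qed
  then have fin: "finite (?r ` ?W)" by (rule finite_subset) (intro finite_PiE; simp)
  have cong: "?F w = ?F w'" if "?r w = ?r w'" for w w'
  proof -
    have eq: "corner_rank w a b = corner_rank w' a b" if "a \<in> {1..m}" "b \<in> {1..n}" for a b
      using fun_cong[OF \<open>?r w = ?r w'\<close>, of "(a, b)"] that by simp
    have "MSV m n w = MSV m n w'" using MSV_mono[of m n w w'] MSV_mono[of m n w' w] eq by (simp add: eq subset_antisym)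
    moreover have "J_ideal m n w = J_ideal m n w'" by (rule J_ideal_cong) (rule eq)
    ultimately show ?thesis by simp
  qed
  have "?F ` ?W \<subseteq> (\<lambda>r. ?F (inv_into ?W ?r r)) ` (?r ` ?W)"
  proof
    fix x assume "x \<in> ?F ` ?W"
    then obtain w where w: "w \<in> ?W" "x = ?F w" by blast
    have "?r (inv_into ?W ?r (?r w)) = ?r w" by (rule f_inv_into_f) (use w in blast)
    then have "?F (inv_into ?W ?r (?r w)) = x" unfolding w(2) by (rule cong)
    then show "x \<in> (\<lambda>r. ?F (inv_into ?W ?r r)) ` (?r ` ?W)" using w(1) by blast
  qed
  then have "finite (?F ` ?W)" using fin finite_subset by blast
  moreover have "{?F w | w. w \<in> ?W} = ?F ` ?W" by blast
  ultimately show ?thesis by simp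
qed

lemma transition_at_outer_corner:
  fixes w :: "'k::alg_closed_field mat"
  assumes w: "w \<in> carrier_mat m n" and nz: "w \<noteq> 0\<^sub>m m n"
  defines "S \<equiv> mpoly_ring (mat_vars m n) :: (nat \<times> nat, 'k) mpoly ring"
  defines "I \<equiv> \<lambda>w :: 'k mat. vanishing_ideal m n (MSV m n w)"
  defines "T \<equiv> {(I w, J_ideal m n w) | w. w \<in> carrier_mat m n}"
  shows "\<exists>f \<Phi>. f \<in> carrier S \<and> f \<notin> range const \<and> f \<notin> I w \<and> finite \<Phi> \<and> \<Phi> \<noteq> {} \<and> \<Phi> \<subseteq> T \<and>
    I w <+>\<^bsub>S\<^esub> genideal S {f} \<subseteq> (\<Inter>(P, Q) \<in> \<Phi>. P) \<and>
    J_ideal m n w <+>\<^bsub>S\<^esub> genideal S {init revlex f} = (\<Inter>(P, Q) \<in> \<Phi>. Q) \<and>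
    (colon (mat_vars m n) (I w) f \<noteq> I w \<longrightarrow>
      (colon (mat_vars m n) (I w) f, colon (mat_vars m n) (J_ideal m n w) (init revlex f)) \<in> T)"
proof -
  obtain i j where ij: "i < m" "j < n" and wij: "w $$ (i, j) \<noteq> 0"
    and zero: "corner_rank w (Suc i) j = 0" "corner_rank w i (Suc j) = 0"
    and K: "\<And>a b. i < a \<Longrightarrow> a \<le> m \<Longrightarrow> j < b \<Longrightarrow> b \<le> n \<Longrightarrow>
      corner_rank w i b + corner_rank w a j < corner_rank w a b"
    by (rule outer_corner[OF w nz]; (rule that; assumption))
  define W :: "'k mat set" where "W = {w' \<in> carrier_mat m n. (\<forall>a\<in>{1..m}. \<forall>b\<in>{1..n}. corner_rank w' a b \<le> corner_rank w a b) \<and>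
      corner_rank w' (Suc i) (Suc j) = 0}"
  define \<Phi> where "\<Phi> = (\<lambda>w'. (I w', J_ideal m n w')) ` W"
  have Wc: "W \<subseteq> carrier_mat m n" by (auto simp: W_def)
  have "0\<^sub>m m n \<in> W" using ij by (simp add: W_def corner_rank_zero_mat)
  then have ne: "\<Phi> \<noteq> {}" by (auto simp: \<Phi>_def)
  have \<Phi>T: "\<Phi> \<subseteq> T" using Wc by (auto simp: \<Phi>_def T_def)
  have fin: "finite \<Phi>"
    by (rule finite_subset[OF \<Phi>T]) (simp only: T_def I_def finite_matrix_schubert_pairs)
  have P: "(\<Inter>(P, Q) \<in> \<Phi>. P) = (\<Inter>w'\<in>W. I w')" and Q: "(\<Inter>(P, Q) \<in> \<Phi>. Q) = (\<Inter>w'\<in>W. J_ideal m n w')"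
    by (simp_all add: \<Phi>_def)
  have 1: "var (i, j) \<in> carrier S" unfolding S_def by (rule var_in_carrier) (use ij in \<open>simp add: mat_vars_def\<close>)
  have 2: "var (i, j) \<notin> I w" using self_in_MSV[OF w] wij by (auto simp: I_def vanishing_ideal_def)
  have 3: "I w <+>\<^bsub>S\<^esub> genideal S {var (i, j)} \<subseteq> (\<Inter>(P, Q) \<in> \<Phi>. P)"
    unfolding P S_def I_def by (rule INT_greatest, rule vanishing_ideal_sum_subset[OF _ ij]) (simp_all add: W_def)
  have 4: "J_ideal m n w <+>\<^bsub>S\<^esub> genideal S {init revlex (var (i, j))} = (\<Inter>(P, Q) \<in> \<Phi>. Q)"
    unfolding Q S_def W_def init_var by (rule J_ideal_transition[OF w ij zero])
  have 5: "colon (mat_vars m n) (I w) (var (i, j)) = I w"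
    unfolding I_def by (rule colon_var[OF w ij K zero])
  show ?thesis
    by (rule exI[of _ "var (i, j)"], rule exI[of _ \<Phi>]) (simp only: 1 2 3 4 5 var_not_const fin ne \<Phi>T simp_thms)
qed

theorem theorem4p3:
  fixes m n :: nat
  assumes "m > 0" and "n > 0"
  shows "let T = {(vanishing_ideal m n (MSV m n w), J_ideal m n w) | w :: 'k::alg_closed_field mat.
                    w \<in> carrier_mat m n}
         in finite T \<and> transition_system (mat_vars m n) revlex T"
proof -
  define S where "S = (mpoly_ring (mat_vars m n) :: (nat \<times> nat, 'k) mpoly ring)"
  define I where "I = (\<lambda>w :: 'k mat. vanishing_ideal m n (MSV m n w))"
  define T where "T = {(I w, J_ideal m n w) | w. w \<in> carrier_mat m n}"
  have T: "\<exists>w\<in>carrier_mat m n. x = (I w, J_ideal m n w)" if "x \<in> T" for x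
    using that by (auto simp: T_def)
  have 1: "\<forall>(I, J) \<in> T. ideal I S \<and> I \<noteq> carrier S \<and> ideal J S \<and> J \<noteq> carrier S"
  proof
    fix x assume "x \<in> T"
    then obtain w where w: "w \<in> carrier_mat m n" "x = (I w, J_ideal m n w)" using T by blast
    then show "case x of (I, J) \<Rightarrow> ideal I S \<and> I \<noteq> carrier S \<and> ideal J S \<and> J \<noteq> carrier S"
      unfolding I_def S_def
      by (simp add: vanishing_ideal_ideal J_ideal_ideal vanishing_ideal_proper J_ideal_proper)
  qed
  have 2: "\<forall>(I, J) \<in> T. monomial_ideal (mat_vars m n) J \<and> J \<subseteq> init_ideal revlex I \<and>
         (maximalideal I S \<longrightarrow> J = init_ideal revlex I)"
  proof
    fix x assume "x \<in> T"
    then obtain w where w: "w \<in> carrier_mat m n" "x = (I w, J_ideal m n w)" using T by blast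
    then show "case x of (I, J) \<Rightarrow> monomial_ideal (mat_vars m n) J \<and> J \<subseteq> init_ideal revlex I \<and>
         (maximalideal I S \<longrightarrow> J = init_ideal revlex I)"
      using J_eq_init_if_maximal[OF w(1)] unfolding I_def S_def
      by (simp add: monomial_ideal_J_ideal J_subset_init_ideal)
  qed
  have 3: "\<forall>(I, J) \<in> T. \<forall>(I', J') \<in> T. I = I' \<longrightarrow> J = J'"
  proof (intro ballI, unfold split_beta, intro ballI impI)
    fix x y assume xy: "x \<in> T" "y \<in> T" "fst x = fst y"
    obtain w where w: "w \<in> carrier_mat m n" "x = (I w, J_ideal m n w)" using T[OF xy(1)] by blast
    obtain w' where w': "w' \<in> carrier_mat m n" "y = (I w', J_ideal m n w')" using T[OF xy(2)] by blast
    have eq: "I w = I w'" using xy(3) w w' by simp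
    have "corner_rank w a b = corner_rank w' a b" if "a \<in> {1..m}" "b \<in> {1..n}" for a b
      using corner_rank_le_if_ideal_subset[OF w(1), of w', OF _ that]
        corner_rank_le_if_ideal_subset[OF w'(1), of w, OF _ that] eq unfolding I_def by simp
    then have "J_ideal m n w = J_ideal m n w'" by (rule J_ideal_cong)
    then show "snd x = snd y" using w w' by simp
  qed
  have 4: "\<forall>(I, J) \<in> T. \<not> maximalideal I S \<and> I \<noteq> J \<longrightarrow>
         (\<exists>f \<Phi>. f \<in> carrier S \<and> f \<notin> range const \<and> f \<notin> I \<and>
            finite \<Phi> \<and> \<Phi> \<noteq> {} \<and> \<Phi> \<subseteq> T \<and>
            I <+>\<^bsub>S\<^esub> genideal S {f} \<subseteq> (\<Inter>(P, Q) \<in> \<Phi>. P) \<and>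
            J <+>\<^bsub>S\<^esub> genideal S {init revlex f} = (\<Inter>(P, Q) \<in> \<Phi>. Q) \<and>
            (colon (mat_vars m n) I f \<noteq> I \<longrightarrow>
              (colon (mat_vars m n) I f, colon (mat_vars m n) J (init revlex f)) \<in> T))"
    (is "\<forall>(I, J) \<in> T. \<not> maximalideal I S \<and> I \<noteq> J \<longrightarrow> ?transition I J")
  proof
    fix x assume "x \<in> T"
    then obtain w where w: "w \<in> carrier_mat m n" "x = (I w, J_ideal m n w)" using T by blast
    have "?transition (I w) (J_ideal m n w)" if "\<not> maximalideal (I w) S"
    proof -
      have "w \<noteq> 0\<^sub>m m n" using that maximal_if_zero unfolding I_def S_def by blast
      from transition_at_outer_corner[OF w(1) this] show ?thesis unfolding S_def T_def I_def .
    qed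
    then show "case x of (I, J) \<Rightarrow> \<not> maximalideal I S \<and> I \<noteq> J \<longrightarrow> ?transition I J"
      unfolding w(2) split by (intro impI) (elim conjE)
  qed
  have "finite T" unfolding T_def I_def by (rule finite_matrix_schubert_pairs)
  moreover have "transition_system (mat_vars m n) revlex T"
    unfolding transition_system_def Let_def S_def[symmetric] by (intro conjI 1 2 3 4)
  ultimately show ?thesis unfolding Let_def T_def I_def by (intro conjI)
qed

end
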